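(* Suppose $u=(\rho,m):\mathbb{R}^+\times\mathbb{R}\to\mathbb{R}^2$ is a bounded entropy solution to the isentropic Euler equations with $\gamma=3$. Then $$\rho=\overline\rho,\quad \lambda_1=\underline\lambda_1,\quad\text{and}\quad\lambda_2=\overline\lambda_2\quad\text{almost everywhere on }\{\underline\rho\neq0\},$$ and $$m=\begin{cases}\overline m&\text{almost everywhere on }\{\underline\rho\ne0\}\cap\{\underline\lambda_1\ge0\},\\ \underline m&\text{almost everywhere on }\{\underline\rho\neq0\}\cap\{\overline\lambda_2\le0\}.\end{cases}$$
   Context: The isentropic Euler equations with $\gamma=3$, for $(t,x)\in\mathbb{R}^+\times\mathbb{R}$, are $$\rho_t+m_x=0,\qquad m_t+\left(\frac{m^2}{\rho}+\frac{\rho^3}{12}\right)_x=0,$$ with unknown $u=(\rho,m)$ and flux $f(\rho,m)=(m,\,m^2/\rho+\rho^3/12)$. A bounded entropy solution is a measurable $u=(\rho,m)$ on $\mathbb{R}^+\times\mathbb{R}$ with $\rho\ge 0$ and $\rho,\ m/\rho\in L^\infty(\mathbb{R}^+\times\mathbb{R})$ (so $m=0$ where $\rho=0$, and $m^2/\rho$ is read as $0$ there) which satisfies the system in the sense of distributions and satisfies $\eta(u)_t+q(u)_x\le 0$ in the sense of distributions for every pair $(\eta,q)$ of functions of the state $(\rho,m)$ such that $\eta$ is convex, $\eta,q\in C(\mathbb{R}^+\times\mathbb{R})$ and $q'=\eta' f'$. At vacuum states $\rho=0$, $\eta(u)$ and $q(u)$ are understood as the limits of $\eta,q$ as $\rho\to0^+$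 with $m/\rho$ bounded (for pairs for which these limits exist). The Riemann invariants are $\lambda_1=\frac m\rho-\frac\rho2$ and $\lambda_2=\frac m\rho+\frac\rho2$, regarded as functions of $(t,x)$ through $u(t,x)$. For a function $g(t,x)$, the upper and lower semicontinuous envelopes, defined at every point, are $$\overline g(t,x)=\lim_{r\to0^+}\operatorname*{ess\,sup}_{(\tau,y)\in B_r(t,x)}g(\tau,y),\qquad \underline g(t,x)=\lim_{r\to0^+}\operatorname*{ess\,inf}_{(\tau,y)\in B_r(t,x)}g(\tau,y),$$ where $B_r(t,x)\subset\mathbb{R}^2$ is the ball of radius $r$ centered at $(t,x)$. *)

theory Defs
  imports "HOL-Analysis.Analysis" "HOL-Probability.Essential_Supremum"
begin

text \<open>
  The open half plane serves both as the domain of the points \<open>(t, x)\<close> and as the set of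
  non-vacuum states \<open>(\<rho>, m)\<close>.
\<close>

definition half_plane :: "(real \<times> real) set" where
  "half_plane = {0<..} \<times> UNIV"

definition pd1 :: "(real \<times> real \<Rightarrow> real) \<Rightarrow> real \<times> real \<Rightarrow> real" where
  "pd1 g p = deriv (\<lambda>s. g (s, snd p)) (fst p)"

definition pd2 :: "(real \<times> real \<Rightarrow> real) \<Rightarrow> real \<times> real \<Rightarrow> real" where
  "pd2 g p = deriv (\<lambda>s. g (fst p, s)) (snd p)"

primrec Ck :: "nat \<Rightarrow> (real \<times> real \<Rightarrow> real) \<Rightarrow> bool" where
  "Ck 0 g \<longleftrightarrow> continuous_on UNIV g"
| "Ck (Suc k) g \<longleftrightarrow> (\<forall>p. g differentiable (at p)) \<and> Ck k (pd1 g) \<and> Ck k (pd2 g)"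

text \<open>Smooth functions with compact support in the half plane, extended by zero to the plane.\<close>

definition test_function :: "(real \<times> real \<Rightarrow> real) \<Rightarrow> bool" where
  "test_function \<phi> \<longleftrightarrow>
     (\<forall>k. Ck k \<phi>) \<and> (\<exists>K. compact K \<and> K \<subseteq> half_plane \<and> (\<forall>p. p \<notin> K \<longrightarrow> \<phi> p = 0))"

text \<open>
  The distributional partial derivatives of a locally integrable function \<open>g\<close> on the half
  plane, applied to a test function \<open>\<phi>\<close>.
\<close>

definition dist_d1 :: "(real \<times> real \<Rightarrow> real) \<Rightarrow> (real \<times> real \<Rightarrow> real) \<Rightarrow> real" where
  "dist_d1 g \<phi> = - (LINT p|lebesgue_on half_plane. g p * pd1 \<phi> p)"

definition dist_d2 :: "(real \<times> real \<Rightarrow> real) \<Rightarrow> (real \<times> real \<Rightarrow> real) \<Rightarrow> real" where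
  "dist_d2 g \<phi> = - (LINT p|lebesgue_on half_plane. g p * pd2 \<phi> p)"

text \<open>
  The components of the flux. Since \<open>x / 0 = 0\<close>, the term \<open>m\<^sup>2 / \<rho>\<close> vanishes at vacuum.
\<close>

definition flux1 :: "real \<times> real \<Rightarrow> real" where
  "flux1 = (\<lambda>(\<rho>, m). m)"

definition flux2 :: "real \<times> real \<Rightarrow> real" where
  "flux2 = (\<lambda>(\<rho>, m). m\<^sup>2 / \<rho> + \<rho> ^ 3 / 12)"

text \<open>
  As \<open>\<eta>\<close> and \<open>q\<close> are merely continuous, the identity \<open>q' = \<eta>' f'\<close> of row vectors is required
  in the sense of distributions on the half plane of states. The flux is smooth there, and the
  product of a smooth function \<open>a\<close> and a distribution \<open>T\<close> is \<open>\<phi> \<mapsto> T (a \<phi>)\<close>.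
\<close>

definition entropy_pair :: "(real \<times> real \<Rightarrow> real) \<Rightarrow> (real \<times> real \<Rightarrow> real) \<Rightarrow> bool" where
  "entropy_pair \<eta> q \<longleftrightarrow>
     convex_on half_plane \<eta> \<and>
     continuous_on half_plane \<eta> \<and> continuous_on half_plane q \<and>
     (\<forall>\<phi>. test_function \<phi> \<longrightarrow>
        dist_d1 q \<phi> = dist_d1 \<eta> (\<lambda>p. pd1 flux1 p * \<phi> p) + dist_d2 \<eta> (\<lambda>p. pd1 flux2 p * \<phi> p) \<and>
        dist_d2 q \<phi> = dist_d1 \<eta> (\<lambda>p. pd2 flux1 p * \<phi> p) + dist_d2 \<eta> (\<lambda>p. pd2 flux2 p * \<phi> p))"

text \<open>
  \<open>g\<close> tends to \<open>L\<close> as \<open>\<rho> \<rightarrow> 0+\<close> with \<open>m / \<rho>\<close> bounded; in the cone \<open>\<bar>m\<bar> \<le> M \<rho>\<close>, \<open>\<rho> \<rightarrow> 0\<close> is the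
  same as \<open>(\<rho>, m) \<rightarrow> (0, 0)\<close>.
\<close>

definition vacuum_limit :: "(real \<times> real \<Rightarrow> real) \<Rightarrow> real \<Rightarrow> bool" where
  "vacuum_limit g L \<longleftrightarrow>
     (\<forall>M. (g \<longlongrightarrow> L) (at (0, 0) within {(\<rho>, m). 0 < \<rho> \<and> \<bar>m\<bar> \<le> M * \<rho>}))"

definition with_vacuum :: "(real \<times> real \<Rightarrow> real) \<Rightarrow> real \<Rightarrow> real \<times> real \<Rightarrow> real" where
  "with_vacuum g L s = (if 0 < fst s then g s else L)"

definition bounded_entropy_solution ::
    "(real \<times> real \<Rightarrow> real) \<Rightarrow> (real \<times> real \<Rightarrow> real) \<Rightarrow> bool" where
  "bounded_entropy_solution \<rho> m \<longleftrightarrow>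
     \<rho> \<in> borel_measurable (lebesgue_on half_plane) \<and>
     m \<in> borel_measurable (lebesgue_on half_plane) \<and>
     (AE p in lebesgue_on half_plane. 0 \<le> \<rho> p \<and> (\<rho> p = 0 \<longrightarrow> m p = 0)) \<and>
     (\<exists>C. AE p in lebesgue_on half_plane. \<bar>\<rho> p\<bar> \<le> C \<and> \<bar>m p / \<rho> p\<bar> \<le> C) \<and>
     (\<forall>\<phi>. test_function \<phi> \<longrightarrow>
        dist_d1 \<rho> \<phi> + dist_d2 (\<lambda>p. flux1 (\<rho> p, m p)) \<phi> = 0 \<and>
        dist_d1 m \<phi> + dist_d2 (\<lambda>p. flux2 (\<rho> p, m p)) \<phi> = 0) \<and>
     (\<forall>\<eta> q a b. entropy_pair \<eta> q \<and> vacuum_limit \<eta> a \<and> vacuum_limit q b \<longrightarrow>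
        (\<forall>\<phi>. test_function \<phi> \<and> (\<forall>p. 0 \<le> \<phi> p) \<longrightarrow>
           dist_d1 (\<lambda>p. with_vacuum \<eta> a (\<rho> p, m p)) \<phi> +
           dist_d2 (\<lambda>p. with_vacuum q b (\<rho> p, m p)) \<phi> \<le> 0))"

text \<open>At vacuum the Riemann invariants take the value \<open>0\<close>, as \<open>x / 0 = 0\<close>.\<close>

definition riemann1 ::
    "(real \<times> real \<Rightarrow> real) \<Rightarrow> (real \<times> real \<Rightarrow> real) \<Rightarrow> real \<times> real \<Rightarrow> real" where
  "riemann1 \<rho> m p = m p / \<rho> p - \<rho> p / 2"

definition riemann2 ::
    "(real \<times> real \<Rightarrow> real) \<Rightarrow> (real \<times> real \<Rightarrow> real) \<Rightarrow> real \<times> real \<Rightarrow> real" where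
  "riemann2 \<rho> m p = m p / \<rho> p + \<rho> p / 2"

text \<open>
  The envelopes at points of the half plane. Intersecting the ball with the half plane has no
  effect for small radii.
\<close>

definition upper_env :: "(real \<times> real \<Rightarrow> real) \<Rightarrow> real \<times> real \<Rightarrow> ereal" where
  "upper_env g p =
     Lim (at_right 0) (\<lambda>r. esssup (lebesgue_on (ball p r \<inter> half_plane)) (\<lambda>z. ereal (g z)))"

text \<open>The essential infimum of \<open>g\<close> is minus the essential supremum of \<open>- g\<close>.\<close>

definition lower_env :: "(real \<times> real \<Rightarrow> real) \<Rightarrow> real \<times> real \<Rightarrow> ereal" where
  "lower_env g p =
     Lim (at_right 0) (\<lambda>r. - esssup (lebesgue_on (ball p r \<inter> half_plane)) (\<lambda>z. ereal (- g z)))"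

end

theory Submission
  imports Defs
begin

text \<open>
  One family of entropies suffices. For a sign \<open>s\<close> and a level \<open>h\<close>, the integral of \<open>(s v - h)\<^sub>+\<close> over
  the velocities \<open>v\<close> between the two Riemann invariants is a convex entropy (\<open>entropy_pair_kin\<close>). Write
  \<open>w = s m / \<rho> + \<rho> / 2\<close>, which is \<open>\<lambda>\<^sub>2\<close> for \<open>s = 1\<close> and \<open>- \<lambda>\<^sub>1\<close> for \<open>s = -1\<close>. Where \<open>w - \<rho>\<close> is below
  \<open>h\<close>, the entropy depends on \<open>w\<close> alone: it equals \<open>E\<^sub>h = (w - h)\<^sub>+\<^sup>2 / 2\<close>, with a flux \<open>F\<^sub>h\<close> that is bounded
  by a multiple of \<open>E\<^sub>h\<close>. The claims about \<open>\<lambda>\<^sub>1\<close> and \<open>\<lambda>\<^sub>2\<close> thus become one: almost everywhere on the set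
  where \<open>\<rho>\<close> is locally bounded below, \<open>w\<close> equals its upper envelope.

  The nonlinearity enters through an interaction estimate (\<open>interaction_estimate\<close>). For levels
  \<open>h < h'\<close>, consider the integral of \<open>E\<^sub>h\<^sub>'(t, x) E\<^sub>h(t, y)\<close> over \<open>x < y\<close>. The energy above the higher
  level travels faster, so that this integral decreases in time for \<open>s = 1\<close> (and the one over
  \<open>x > y\<close> for \<open>s = -1\<close>), at a rate that is at least the integral over \<open>x\<close> of
  \<open>(h' - h) (w - h')\<^sub>+\<^sup>2 (w - h)\<^sub>+\<^sup>2 / 12\<close> (\<open>level_bilinear_bound\<close>). Hence the space-time integral of
  \<open>E\<^sub>h\<^sub>'\<close> is bounded by a constant times the square of that of \<open>E\<^sub>h\<close>. This gain of a power drives a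
  De Giorgi iteration over levels increasing from \<open>k\<close> to \<open>k + d\<close> (\<open>de_giorgi\<close>): if \<open>{w > k}\<close> fills only a
  small part of a ball around \<open>p\<close>, where small does not depend on the radius, then \<open>w \<le> k + d\<close> almost
  everywhere near \<open>p\<close>.

  By Lebesgue's density theorem, almost every point \<open>p\<close> is such that for all rational \<open>k \<ge> w p\<close> the set
  \<open>{w > k}\<close> has density zero at \<open>p\<close>. Suppose that \<open>\<rho> \<ge> c > 0\<close> near \<open>p\<close> and that the upper envelope \<open>M\<close> of
  \<open>w\<close> at \<open>p\<close> exceeds \<open>w p\<close>. Choose \<open>k\<close> between \<open>w p\<close> and \<open>M\<close>, close to \<open>M\<close>. Near \<open>p\<close> the function \<open>w\<close> is
  hardly larger than \<open>M\<close>, so that \<open>w - \<rho> < k\<close> there, and the iteration bounds the envelope by a number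
  smaller than \<open>M\<close>, a contradiction. The statements on \<open>\<rho>\<close> and \<open>m\<close> follow from \<open>\<rho> = \<lambda>\<^sub>2 - \<lambda>\<^sub>1\<close> and
  \<open>m = (\<lambda>\<^sub>2\<^sup>2 - \<lambda>\<^sub>1\<^sup>2) / 2\<close>.
\<close>

section \<open>Smooth functions of one variable\<close>

primrec times_differentiable :: "nat \<Rightarrow> (real \<Rightarrow> real) \<Rightarrow> bool" where
  "times_differentiable 0 f \<longleftrightarrow> True"
| "times_differentiable (Suc k) f \<longleftrightarrow>
     (\<exists>f'. (\<forall>x. (f has_real_derivative f' x) (at x)) \<and> times_differentiable k f')"

definition smooth :: "(real \<Rightarrow> real) \<Rightarrow> bool" where
  "smooth f \<longleftrightarrow> (\<forall>k. times_differentiable k f)"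

lemma times_differentiable_Suc_imp: "times_differentiable (Suc k) f \<Longrightarrow> times_differentiable k f"
  by (induction k arbitrary: f) auto

lemma times_differentiable_add:
  "times_differentiable k f \<Longrightarrow> times_differentiable k g \<Longrightarrow> times_differentiable k (\<lambda>x. f x + g x)"
proof (induction k arbitrary: f g)
  case (Suc k)
  obtain f' where f': "\<And>x. (f has_real_derivative f' x) (at x)" "times_differentiable k f'"
    using Suc.prems(1) unfolding times_differentiable.simps by blast
  obtain g' where g': "\<And>x. (g has_real_derivative g' x) (at x)" "times_differentiable k g'"
    using Suc.prems(2) unfolding times_differentiable.simps by blast
  have "\<forall>x. ((\<lambda>x. f x + g x) has_real_derivative f' x + g' x) (at x)"
    using f'(1) g'(1) by (intro allI DERIV_add)
  with Suc.IH[OF f'(2) g'(2)] show ?case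
    unfolding times_differentiable.simps by (intro exI[of _ "\<lambda>x. f' x + g' x"] conjI)
qed simp

lemma times_differentiable_mult:
  "times_differentiable k f \<Longrightarrow> times_differentiable k g \<Longrightarrow> times_differentiable k (\<lambda>x. f x * g x)"
proof (induction k arbitrary: f g)
  case (Suc k)
  obtain f' where f': "\<And>x. (f has_real_derivative f' x) (at x)" "times_differentiable k f'"
    using Suc.prems(1) unfolding times_differentiable.simps by blast
  obtain g' where g': "\<And>x. (g has_real_derivative g' x) (at x)" "times_differentiable k g'"
    using Suc.prems(2) unfolding times_differentiable.simps by blast
  have "times_differentiable k (\<lambda>x. f' x * g x + g' x * f x)"
    by (rule times_differentiable_add[OF Suc.IH[OF f'(2) times_differentiable_Suc_imp[OF Suc.prems(2)]]
          Suc.IH[OF g'(2) times_differentiable_Suc_imp[OF Suc.prems(1)]]])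
  moreover have "\<forall>x. ((\<lambda>x. f x * g x) has_real_derivative f' x * g x + g' x * f x) (at x)"
    using f'(1) g'(1) by (intro allI DERIV_mult)
  ultimately show ?case
    unfolding times_differentiable.simps
    by (intro exI[of _ "\<lambda>x. f' x * g x + g' x * f x"] conjI)
qed simp

lemma times_differentiable_const: "times_differentiable k (\<lambda>_. c)"
  by (induction k arbitrary: c) (auto intro!: exI[of _ "\<lambda>_. 0"])

lemma times_differentiable_affine:
  "times_differentiable k f \<Longrightarrow> times_differentiable k (f \<circ> (\<lambda>x. a * x + b))"
proof (induction k arbitrary: f)
  case (Suc k)
  let ?l = "\<lambda>x. a * x + b"
  from Suc.prems obtain f' where *: "\<And>x. (f has_real_derivative f' x) (at x)" "times_differentiable k f'"
    by auto
  have 1: "((f \<circ> ?l) has_real_derivative a * (f' \<circ> ?l) x) (at x)" for x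
  proof -
    have "(?l has_real_derivative a) (at x)" by (auto intro!: derivative_eq_intros)
    from DERIV_chain[OF *(1) this] show ?thesis by (simp add: mult.commute)
  qed
  have 2: "times_differentiable k (\<lambda>x. a * (f' \<circ> ?l) x)"
    by (rule times_differentiable_mult[OF times_differentiable_const Suc.IH[OF *(2)]])
  show ?case
    unfolding times_differentiable.simps
    by (rule exI[of _ "\<lambda>x. a * (f' \<circ> ?l) x"], rule conjI, rule allI, rule 1, rule 2)
qed simp

lemma smooth_derivE:
  assumes "smooth f"
  obtains f' where "\<And>x. (f has_real_derivative f' x) (at x)" "smooth f'"
proof -
  have *: "\<exists>f'. (\<forall>x. (f has_real_derivative f' x) (at x)) \<and> times_differentiable k f'" for k
    using assms unfolding smooth_def by (metis times_differentiable.simps(2))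
  then obtain f' where f': "\<And>x. (f has_real_derivative f' x) (at x)" by blast
  have "times_differentiable k f'" for k
  proof -
    obtain g where "\<And>x. (f has_real_derivative g x) (at x)" "times_differentiable k g"
      using * by blast
    moreover have "g = f'" using f' DERIV_unique calculation(1) by blast
    ultimately show ?thesis by simp
  qed
  then show ?thesis using f' that by (auto simp: smooth_def)
qed

lemma smoothI_deriv:
  assumes "\<And>x. (f has_real_derivative f' x) (at x)" "smooth f'"
  shows "smooth f"
  unfolding smooth_def
proof
  fix k show "times_differentiable k f"
  proof (cases k)
    case (Suc j)
    with assms show ?thesis
      unfolding smooth_def by (simp only: times_differentiable.simps) (intro exI[of _ f'], simp)
  qed simp
qed

lemma smooth_mult: "smooth f \<Longrightarrow> smooth g \<Longrightarrow> smooth (\<lambda>x. f x * g x)"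
  by (auto simp: smooth_def intro: times_differentiable_mult)

lemma smooth_const: "smooth (\<lambda>_. c)"
  by (auto simp: smooth_def intro: times_differentiable_const)

lemma smooth_affine: "smooth f \<Longrightarrow> smooth (\<lambda>x. f (a * x + b))"
  unfolding smooth_def
  using times_differentiable_affine[of _ f a b] by (simp add: o_def)

text \<open>
  The derivative of each of these functions is a linear combination of two others, so all of them
  are smooth. For \<open>n = 0\<close> this is \<open>exp (- 1 / s)\<close>, extended by zero.
\<close>

definition flat_exp :: "nat \<Rightarrow> real \<Rightarrow> real" where
  "flat_exp n s = (if 0 < s then (1 / s) ^ n * exp (- (1 / s)) else 0)"

lemma flat_exp_tendsto_0: "(flat_exp n \<longlongrightarrow> 0) (at 0)"
proof -
  have 1: "filterlim (\<lambda>s::real. 1 / s) at_top (at_right 0)"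
    using filterlim_inverse_at_top_right by (simp add: inverse_eq_divide)
  have "((\<lambda>s::real. (1 / s) ^ n / exp (1 / s)) \<longlongrightarrow> 0) (at_right 0)"
    using filterlim_compose[OF tendsto_power_div_exp_0[of n] 1] .
  then have r: "(flat_exp n \<longlongrightarrow> 0) (at_right 0)"
    by (rule Lim_transform_eventually)
      (auto simp: flat_exp_def exp_minus field_simps eventually_at_filter)
  have l: "(flat_exp n \<longlongrightarrow> 0) (at_left 0)"
    by (rule Lim_transform_eventually[OF tendsto_const[of 0]])
      (auto simp: flat_exp_def eventually_at_filter)
  show ?thesis using r l by (simp add: filterlim_split_at)
qed

lemma flat_exp_deriv:
  "(flat_exp n has_real_derivative (- real n) * flat_exp (Suc n) s + flat_exp (n + 2) s) (at s)"
proof (rule linorder_cases[of s 0])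
  assume "s < 0"
  have "((\<lambda>_. 0) has_real_derivative 0) (at s)" by simp
  then have "(flat_exp n has_real_derivative 0) (at s)"
    by (rule has_field_derivative_transform_within_open[where S="{..<0}"])
      (use \<open>s < 0\<close> in \<open>auto simp: flat_exp_def\<close>)
  with \<open>s < 0\<close> show ?thesis by (simp add: flat_exp_def)
next
  assume s: "s = 0"
  have "((\<lambda>y. flat_exp (Suc n) y) \<longlongrightarrow> 0) (at 0)" by (rule flat_exp_tendsto_0)
  then have "((\<lambda>y. (flat_exp n y - flat_exp n 0) / (y - 0)) \<longlongrightarrow> 0) (at 0)"
    by (rule Lim_transform_eventually) (auto simp: flat_exp_def eventually_at_filter)
  then show ?thesis using s by (simp add: has_field_derivative_iff flat_exp_def)
next
  assume s: "0 < s"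
  have "((\<lambda>s. (1 / s) ^ n * exp (- (1 / s))) has_real_derivative
      (- real n) * ((1 / s) ^ Suc n * exp (- (1 / s))) + (1 / s) ^ (n + 2) * exp (- (1 / s))) (at s)"
  proof -
    have i: "((\<lambda>s::real. 1 / s) has_real_derivative - ((1 / s) ^ 2)) (at s)"
      using s by (auto intro!: derivative_eq_intros simp: power2_eq_square)
    have p: "((\<lambda>s::real. (1 / s) ^ n) has_real_derivative - real n * (1 / s) ^ Suc n) (at s)"
    proof (cases n)
      case (Suc j)
      then show ?thesis
        by (intro DERIV_cong[OF DERIV_power[OF i]])
            (simp add: power2_eq_square algebra_simps diff_divide_distrib add_divide_distrib)
    qed simp
    have e: "((\<lambda>s::real. exp (- (1 / s))) has_real_derivative exp (- (1 / s)) * (1 / s) ^ 2) (at s)"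
      using DERIV_chain2[OF DERIV_exp DERIV_minus[OF i]] by simp
    show ?thesis
      by (rule DERIV_cong[OF DERIV_mult[OF p e]]) (simp add: power2_eq_square algebra_simps)
  qed
  then have "(flat_exp n has_real_derivative
      (- real n) * ((1 / s) ^ Suc n * exp (- (1 / s))) + (1 / s) ^ (n + 2) * exp (- (1 / s))) (at s)"
    by (rule has_field_derivative_transform_within_open[where S="{0<..}"])
      (use s in \<open>auto simp: flat_exp_def\<close>)
  with s show ?thesis by (simp add: flat_exp_def)
qed

lemma smooth_flat_exp: "smooth (flat_exp n)"
  unfolding smooth_def
proof
  fix k show "times_differentiable k (flat_exp n)"
  proof (induction k arbitrary: n)
    case (Suc k)
    have "times_differentiable k (\<lambda>s. (- real n) * flat_exp (Suc n) s + flat_exp (n + 2) s)"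
      by (rule times_differentiable_add[OF times_differentiable_mult[OF times_differentiable_const Suc] Suc])
    then show ?case using flat_exp_deriv
      unfolding times_differentiable.simps
      by (intro exI[of _ "\<lambda>s. (- real n) * flat_exp (Suc n) s + flat_exp (n + 2) s"]) simp
  qed simp
qed

definition raw_bump :: "real \<Rightarrow> real" where
  "raw_bump s = flat_exp 0 (1 + s) * flat_exp 0 (1 - s)"

lemma smooth_raw_bump: "smooth raw_bump"
proof -
  have "smooth (\<lambda>s. flat_exp 0 (1 * s + 1) * flat_exp 0 ((-1) * s + 1))"
    by (rule smooth_mult[OF smooth_affine[OF smooth_flat_exp] smooth_affine[OF smooth_flat_exp]])
  then show ?thesis by (simp add: raw_bump_def[abs_def] add.commute)
qed

lemma smooth_continuous: "smooth f \<Longrightarrow> continuous_on UNIV f"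
  by (metis smooth_derivE DERIV_continuous_on has_field_derivative_at_within)

lemma raw_bump_nonneg: "0 \<le> raw_bump s"
  by (simp add: raw_bump_def flat_exp_def)

lemma raw_bump_zero: "1 \<le> \<bar>s\<bar> \<Longrightarrow> raw_bump s = 0"
  by (auto simp: raw_bump_def flat_exp_def)

definition bump_mass :: real where "bump_mass = integral {-1..1} raw_bump"

lemma bump_mass_pos: "0 < bump_mass"
proof -
  have c: "continuous_on {-1..1} raw_bump"
    using smooth_continuous[OF smooth_raw_bump] continuous_on_subset by blast
  have "bump_mass \<noteq> 0"
  proof
    assume "bump_mass = 0"
    then have "integral {-1..1} raw_bump = 0" by (simp add: bump_mass_def)
    then have "\<forall>x\<in>{-1..1}. raw_bump x = 0"
      using integral_eq_0_iff[OF c] raw_bump_nonneg by simp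
    then have "raw_bump 0 = 0" by auto
    then show False by (simp add: raw_bump_def flat_exp_def)
  qed
  moreover have "0 \<le> bump_mass"
    unfolding bump_mass_def
    by (rule integral_nonneg) (auto intro!: integrable_continuous_real c simp: raw_bump_nonneg)
  ultimately show ?thesis by simp
qed

definition bump :: "real \<Rightarrow> real" where
  "bump s = raw_bump s / bump_mass"

text \<open>
  The lower limit lies to the left of the support of \<open>bump\<close>, so this antiderivative rises from 0 to 1
  on \<open>{-1..1}\<close>.
\<close>

definition step :: "real \<Rightarrow> real" where
  "step s = integral {-2..s} bump"

lemma smooth_bump: "smooth bump"
  using smooth_mult[OF smooth_raw_bump smooth_const[of "1 / bump_mass"]]
  by (simp add: bump_def[abs_def])

lemma bump_nonneg: "0 \<le> bump s"
  using raw_bump_nonneg bump_mass_pos by (simp add: bump_def)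

lemma bump_zero: "1 \<le> \<bar>s\<bar> \<Longrightarrow> bump s = 0"
  by (simp add: bump_def raw_bump_zero)

lemma bump_continuous: "continuous_on S bump"
  using smooth_continuous[OF smooth_bump] continuous_on_subset by blast

lemma step_left: "s \<le> -1 \<Longrightarrow> step s = 0"
proof -
  assume "s \<le> -1"
  then have "integral {-2..s} bump = integral {-2..s} (\<lambda>_. 0::real)"
    by (intro integral_cong) (auto simp: bump_zero)
  then show ?thesis by (simp add: step_def)
qed

lemma step_deriv: "(step has_real_derivative bump s) (at s)"
proof (cases "s < -1")
  case True
  have "((\<lambda>_. 0) has_real_derivative 0) (at s)" by simp
  then have "(step has_real_derivative 0) (at s)"
    by (rule has_field_derivative_transform_within_open[where S="{..<-1}"])
      (use True in \<open>auto simp: step_left\<close>)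
  with True show ?thesis by (simp add: bump_zero)
next
  case False
  have s: "s \<in> {-2..s + 1}" "s \<in> interior {-2..s + 1}" using False by auto
  have "((\<lambda>u. integral {-2..u} bump) has_vector_derivative bump s) (at s within {-2..s + 1})"
    by (rule integral_has_vector_derivative[OF bump_continuous s(1)])
  then have "((\<lambda>u. integral {-2..u} bump) has_vector_derivative bump s) (at s)"
    by (simp only: at_within_interior[OF s(2)])
  then show ?thesis
    unfolding step_def[abs_def] has_real_derivative_iff_has_vector_derivative .
qed

lemma smooth_step: "smooth step"
  by (rule smoothI_deriv[OF step_deriv smooth_bump])

lemma step_mono: "a \<le> b \<Longrightarrow> step a \<le> step b"
  by (erule DERIV_nonneg_imp_nondecreasing, rule exI, rule conjI, rule step_deriv, rule bump_nonneg)

lemma step_right: assumes "1 \<le> s" shows "step s = 1"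
proof -
  have i: "raw_bump integrable_on {a..b}" for a b
    by (rule integrable_continuous_real, rule continuous_on_subset[OF smooth_continuous[OF smooth_raw_bump]]) simp
  have "integral {-2..s} raw_bump = integral {-2..-1} raw_bump + integral {-1..s} raw_bump"
    using assms i by (intro Henstock_Kurzweil_Integration.integral_combine[symmetric]) auto
  also have "integral {-2..-1} raw_bump = integral {-2..-1::real} (\<lambda>_. 0::real)"
    by (intro integral_cong) (auto simp: raw_bump_zero)
  also have "integral {-1..s} raw_bump = integral {-1..1} raw_bump + integral {1..s} raw_bump"
    using assms i by (intro Henstock_Kurzweil_Integration.integral_combine[symmetric]) auto
  also have "integral {1..s} raw_bump = integral {1..s} (\<lambda>_. 0::real)"
    by (intro integral_cong) (auto simp: raw_bump_zero)
  finally have "integral {-2..s} raw_bump = bump_mass" by (simp add: bump_mass_def)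
  then show ?thesis using bump_mass_pos by (simp add: step_def bump_def[abs_def])
qed

lemma step_nonneg: "0 \<le> step s"
  using step_mono[of "-1" s] step_left[of s] step_left[of "-1"] by (cases "s \<le> -1") auto

lemma step_le_1: "step s \<le> 1"
  using step_mono[of s 1] step_right[of s] step_right[of 1] by (cases "1 \<le> s") auto

lemma bump_bounded: obtains K where "0 < K" "\<And>s. bump s \<le> K"
proof -
  have "compact (bump ` {-1..1})"
    by (intro compact_continuous_image bump_continuous) auto
  then obtain K where "\<And>y. y \<in> bump ` {-1..1} \<Longrightarrow> norm y \<le> K"
    using compact_imp_bounded bounded_iff by metis
  then have K: "\<bar>bump s\<bar> \<le> K" if "\<bar>s\<bar> \<le> 1" for s
    using that by (auto simp: abs_le_iff)
  have "bump s \<le> \<bar>K\<bar> + 1" for s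
    using K[of s] bump_zero[of s] by (cases "\<bar>s\<bar> \<le> 1") auto
  then show ?thesis by (intro that[of "\<bar>K\<bar> + 1"]) auto
qed

section \<open>Smooth functions of two variables\<close>

lemma has_partial1:
  assumes "g differentiable (at p)"
  shows "((\<lambda>s. g (s, snd p)) has_real_derivative pd1 g p) (at (fst p))"
proof -
  obtain D where D: "(g has_derivative D) (at p)"
    using assms unfolding differentiable_def by blast
  have l: "((\<lambda>s. (s, snd p)) has_derivative (\<lambda>h. (h, 0))) (at (fst p))"
    by (intro has_derivative_Pair has_derivative_ident has_derivative_const)
  have "(g has_derivative D) (at (fst p, snd p))" using D by simp
  from diff_chain_at[OF l this] have "((\<lambda>s. g (s, snd p)) has_derivative (\<lambda>h. D (h, 0))) (at (fst p))"
    by (simp add: o_def)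
  moreover have "(\<lambda>h. D (h, 0)) = (*) (D (1, 0))"
  proof
    fix h show "D (h, 0) = D (1, 0) * h"
      using linear_cmul[OF has_derivative_linear[OF D], of h "(1, 0)"] by simp
  qed
  ultimately have "((\<lambda>s. g (s, snd p)) has_real_derivative D (1, 0)) (at (fst p))"
    unfolding has_field_derivative_def by (simp only:)
  with DERIV_imp_deriv[OF this] show ?thesis unfolding pd1_def by simp
qed

lemma has_partial2:
  assumes "g differentiable (at p)"
  shows "((\<lambda>s. g (fst p, s)) has_real_derivative pd2 g p) (at (snd p))"
proof -
  obtain D where D: "(g has_derivative D) (at p)"
    using assms unfolding differentiable_def by blast
  have l: "((\<lambda>s. (fst p, s)) has_derivative (\<lambda>h. (0, h))) (at (snd p))"
    by (intro has_derivative_Pair has_derivative_ident has_derivative_const)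
  have "(g has_derivative D) (at (fst p, snd p))" using D by simp
  from diff_chain_at[OF l this] have "((\<lambda>s. g (fst p, s)) has_derivative (\<lambda>h. D (0, h))) (at (snd p))"
    by (simp add: o_def)
  moreover have "(\<lambda>h. D (0, h)) = (*) (D (0, 1))"
  proof
    fix h show "D (0, h) = D (0, 1) * h"
      using linear_cmul[OF has_derivative_linear[OF D], of h "(0, 1)"] by simp
  qed
  ultimately have "((\<lambda>s. g (fst p, s)) has_real_derivative D (0, 1)) (at (snd p))"
    unfolding has_field_derivative_def by (simp only:)
  with DERIV_imp_deriv[OF this] show ?thesis unfolding pd2_def by simp
qed

lemma pd1_eq: "((\<lambda>s. g (s, snd p)) has_real_derivative d) (at (fst p)) \<Longrightarrow> pd1 g p = d"
  unfolding pd1_def by (rule DERIV_imp_deriv)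

lemma pd2_eq: "((\<lambda>s. g (fst p, s)) has_real_derivative d) (at (snd p)) \<Longrightarrow> pd2 g p = d"
  unfolding pd2_def by (rule DERIV_imp_deriv)

lemma Ck_Suc_imp: "Ck (Suc k) g \<Longrightarrow> Ck k g"
proof (induction k arbitrary: g)
  case 0
  then show ?case
    by (auto simp: continuous_on_eq_continuous_at intro: differentiable_imp_continuous_within)
next
  case (Suc k)
  have "(\<forall>p. g differentiable (at p)) \<and> Ck (Suc k) (pd1 g) \<and> Ck (Suc k) (pd2 g)"
    using Suc.prems unfolding Ck.simps(2)[of "Suc k"] .
  then show ?case
    unfolding Ck.simps(2)[of k g] using Suc.IH[of "pd1 g"] Suc.IH[of "pd2 g"] by blast
qed

lemma Ck_add: "Ck k f \<Longrightarrow> Ck k g \<Longrightarrow> Ck k (\<lambda>p. f p + g p)"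
proof (induction k arbitrary: f g)
  case (Suc k)
  have d: "f differentiable (at p)" "g differentiable (at p)" for p
    using Suc.prems unfolding Ck.simps(2) by blast+
  have "pd1 (\<lambda>p. f p + g p) = (\<lambda>p. pd1 f p + pd1 g p)"
  proof
    fix p show "pd1 (\<lambda>p. f p + g p) p = pd1 f p + pd1 g p"
      using DERIV_add[OF has_partial1[OF d(1)[of p]] has_partial1[OF d(2)[of p]]]
      by - (rule pd1_eq, simp)
  qed
  moreover have "pd2 (\<lambda>p. f p + g p) = (\<lambda>p. pd2 f p + pd2 g p)"
  proof
    fix p show "pd2 (\<lambda>p. f p + g p) p = pd2 f p + pd2 g p"
      using DERIV_add[OF has_partial2[OF d(1)[of p]] has_partial2[OF d(2)[of p]]]
      by - (rule pd2_eq, simp)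
  qed
  moreover have "(\<lambda>p. f p + g p) differentiable (at p)" for p
    by (rule differentiable_add[OF d])
  ultimately show ?case using Suc by simp
qed (auto intro: continuous_intros)

lemma Ck_mult: "Ck k f \<Longrightarrow> Ck k g \<Longrightarrow> Ck k (\<lambda>p. f p * g p)"
proof (induction k arbitrary: f g)
  case (Suc k)
  have d: "f differentiable (at p)" "g differentiable (at p)" for p
    using Suc.prems unfolding Ck.simps(2) by blast+
  have "pd1 (\<lambda>p. f p * g p) = (\<lambda>p. pd1 f p * g p + pd1 g p * f p)"
  proof
    fix p show "pd1 (\<lambda>p. f p * g p) p = pd1 f p * g p + pd1 g p * f p"
      using DERIV_mult[OF has_partial1[OF d(1)[of p]] has_partial1[OF d(2)[of p]]]
      by - (rule pd1_eq, simp)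
  qed
  moreover have "pd2 (\<lambda>p. f p * g p) = (\<lambda>p. pd2 f p * g p + pd2 g p * f p)"
  proof
    fix p show "pd2 (\<lambda>p. f p * g p) p = pd2 f p * g p + pd2 g p * f p"
      using DERIV_mult[OF has_partial2[OF d(1)[of p]] has_partial2[OF d(2)[of p]]]
      by - (rule pd2_eq, simp)
  qed
  moreover have "Ck k (\<lambda>p. pd1 f p * g p + pd1 g p * f p)" "Ck k (\<lambda>p. pd2 f p * g p + pd2 g p * f p)"
    using Suc.prems Ck_Suc_imp[OF Suc.prems(1)] Ck_Suc_imp[OF Suc.prems(2)]
    by (auto intro!: Ck_add Suc.IH simp del: Ck.simps(2)) auto
  moreover have "(\<lambda>p. f p * g p) differentiable (at p)" for p
    by (rule differentiable_mult[OF d])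
  ultimately show ?case by simp
qed (auto intro: continuous_intros)

lemma Ck_const: "Ck k (\<lambda>_. c)"
proof (induction k arbitrary: c)
  case (Suc k)
  have "pd1 (\<lambda>_. c) = (\<lambda>_. 0)" "pd2 (\<lambda>_. c) = (\<lambda>_. 0)"
    by (simp_all add: pd1_def pd2_def fun_eq_iff)
  with Suc show ?case by auto
qed auto

text \<open>
  Together with \<open>Ck_mult\<close> this provides all test functions that are used below: they are products of
  functions of one variable composed with affine maps.
\<close>

lemma Ck_smooth_affine: 
  assumes "smooth f" shows "Ck k (\<lambda>p. f (a * fst p + b * snd p + c))"
  using assms
proof (induction k arbitrary: f)
  case 0
  have "continuous_on UNIV (\<lambda>p::real\<times>real. a * fst p + b * snd p + c)" by (intro continuous_intros)
  from continuous_on_compose2[OF smooth_continuous[OF 0] this] show ?case by simp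
next
  case (Suc k)
  obtain f' where f': "\<And>x. (f has_real_derivative f' x) (at x)" "smooth f'"
    using smooth_derivE[OF Suc.prems] by metis
  let ?l = "\<lambda>p::real\<times>real. a * fst p + b * snd p + c"
  have "pd1 (\<lambda>p. f (?l p)) = (\<lambda>p. a * f' (?l p))"
  proof
    fix p
    have "((\<lambda>s. ?l (s, snd p)) has_real_derivative a) (at (fst p))" by (auto intro!: derivative_eq_intros)
    from DERIV_chain2[OF f'(1) this] show "pd1 (\<lambda>p. f (?l p)) p = a * f' (?l p)"
      by - (rule pd1_eq, simp add: mult.commute)
  qed
  moreover have "pd2 (\<lambda>p. f (?l p)) = (\<lambda>p. b * f' (?l p))"
  proof
    fix p
    have "((\<lambda>s. ?l (fst p, s)) has_real_derivative b) (at (snd p))" by (auto intro!: derivative_eq_intros)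
    from DERIV_chain2[OF f'(1) this] show "pd2 (\<lambda>p. f (?l p)) p = b * f' (?l p)"
      by - (rule pd2_eq, simp add: mult.commute)
  qed
  moreover have "(f \<circ> ?l) differentiable (at p)" for p
  proof (rule differentiable_chain_at)
    show "?l differentiable (at p)"
      unfolding differentiable_def by (rule exI) (rule derivative_intros | simp)+
    show "f differentiable (at (?l p))"
      using f'(1)[of "?l p"] unfolding differentiable_def has_field_derivative_def by blast
  qed
  ultimately show ?case using Suc.IH[OF f'(2)]
    by (simp add: o_def Ck_mult Ck_const)
qed

lemma Ck_partials:
  assumes C: "\<And>k. Ck k \<phi>"
  shows "((\<lambda>s. \<phi> (s, snd p)) has_real_derivative pd1 \<phi> p) (at (fst p))"
    "((\<lambda>s. \<phi> (fst p, s)) has_real_derivative pd2 \<phi> p) (at (snd p))"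
    "continuous_on UNIV \<phi>" "continuous_on UNIV (pd1 \<phi>)" "continuous_on UNIV (pd2 \<phi>)"
proof -
  have d: "\<phi> differentiable (at p)" for p using C[of 1] by (simp add: split_paired_all del: split_paired_All)
  show "((\<lambda>s. \<phi> (s, snd p)) has_real_derivative pd1 \<phi> p) (at (fst p))"
    "((\<lambda>s. \<phi> (fst p, s)) has_real_derivative pd2 \<phi> p) (at (snd p))"
    by (rule has_partial1[OF d] has_partial2[OF d])+
  show "continuous_on UNIV \<phi>" "continuous_on UNIV (pd1 \<phi>)" "continuous_on UNIV (pd2 \<phi>)"
    using C[of 0] C[of 1] by auto
qed

section \<open>Lebesgue density and envelopes\<close>

lemma open_half_plane: "open half_plane"
  by (simp add: half_plane_def open_Times)

lemma half_plane_lebesgue: "half_plane \<in> sets lebesgue"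
  using open_half_plane by simp

lemma negligible_imp_AE: "negligible {x. \<not> P x} \<Longrightarrow> AE x in lebesgue. P x"
  unfolding negligible_iff_null_sets by (rule AE_I') auto

lemma AE_imp_negligible: 
  assumes "AE x in lebesgue. P x" shows "negligible {x. \<not> P x}"
proof -
  obtain N where "{x. \<not> P x} \<subseteq> N" "N \<in> null_sets lebesgue"
    using assms unfolding eventually_ae_filter by auto
  then show ?thesis using negligible_subset negligible_iff_null_sets by blast
qed

text \<open>
  Consider the points outside \<open>A\<close> at which arbitrarily small balls contain more than the fraction \<open>e\<close>
  of \<open>A\<close>. Those balls may be taken inside an open set that contains little of \<open>A\<close>. By Vitali's
  theorem a disjoint subfamily covers almost all of these points, and its total measure is at most
  \<open>1 / e\<close> times the measure of the part of \<open>A\<close> in the open set.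
\<close>

lemma lebesgue_density:
  fixes A :: "'a::euclidean_space set"
  assumes A: "A \<in> sets lebesgue"
  shows "AE p in lebesgue. p \<notin> A \<longrightarrow>
    (\<forall>e>0. \<exists>d>0. \<forall>r. 0 < r \<and> r < d \<longrightarrow> measure lebesgue (A \<inter> ball p r) \<le> e * measure lebesgue (ball p r))"
proof -
  define S where "S e = {p. p \<notin> A \<and> (\<forall>d>0. \<exists>r. 0 < r \<and> r < d \<and> e * measure lebesgue (ball p r) < measure lebesgue (A \<inter> ball p r))}" for e
  have "negligible (S e \<inter> ball 0 n)" if e: "0 < e" for e n
    unfolding negligible_outer_le
  proof (intro allI impI)
    fix \<epsilon> :: real assume \<epsilon>: "0 < \<epsilon>"
    let ?B = "ball (0::'a) n - A"
    have "?B \<in> sets lebesgue" using A by auto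
    from sets_lebesgue_outer_open[OF this, of "e * \<epsilon>"] e \<epsilon>
    obtain U where U: "open U" "?B \<subseteq> U" "U - ?B \<in> lmeasurable" "emeasure lebesgue (U - ?B) < ennreal (e * \<epsilon>)"
      by auto
    define V where "V = U \<inter> ball 0 n"
    have V: "open V" "?B \<subseteq> V" using U by (auto simp: V_def)
    define K where "K = {(a, r). 0 < r \<and> ball a r \<subseteq> V \<and> e * measure lebesgue (ball a r) < measure lebesgue (A \<inter> ball a r)}"
    have vit: "\<exists>i. i \<in> K \<and> x \<in> ball (fst i) (snd i) \<and> snd i < d" if x: "x \<in> S e \<inter> ball 0 n" and d: "0 < d" for x d
    proof -
      have "x \<in> V" using x V by (auto simp: S_def)
      then obtain \<delta> where \<delta>: "0 < \<delta>" "ball x \<delta> \<subseteq> V" using V(1) openE by blast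
      obtain r where r: "0 < r" "r < min d \<delta>" "e * measure lebesgue (ball x r) < measure lebesgue (A \<inter> ball x r)"
      proof -
        have "\<forall>d>0. \<exists>r. 0 < r \<and> r < d \<and> e * measure lebesgue (ball x r) < measure lebesgue (A \<inter> ball x r)"
          using x by (simp add: S_def)
        from this[rule_format, of "min d \<delta>"] d \<delta>(1) show ?thesis using that by auto
      qed
      then have "ball x r \<subseteq> V" using \<delta>(2) subset_ball[of r \<delta> x] by auto
      with r show ?thesis by (intro exI[of _ "(x, r)"]) (auto simp: K_def)
    qed
    obtain C where C: "countable C" "C \<subseteq> K"
      "pairwise (\<lambda>i j. disjnt (ball (fst i) (snd i)) (ball (fst j) (snd j))) C"
      "negligible ((S e \<inter> ball 0 n) - (\<Union>i \<in> C. ball (fst i) (snd i)))"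
      by (rule Vitali_covering_theorem_balls[of "S e \<inter> ball 0 n" K fst snd, OF vit])
    define W where "W = (\<Union>i \<in> C. ball (fst i) (snd i))"
    have dis: "disjoint_family_on (\<lambda>i. ball (fst i) (snd i)) C"
      using C(3) by (auto simp: pairwise_def disjnt_def disjoint_family_on_def)
    have K: "ball (fst i) (snd i) \<subseteq> V"
        "e * measure lebesgue (ball (fst i) (snd i)) < measure lebesgue (A \<inter> ball (fst i) (snd i))"
      if "i \<in> C" for i
      using that C(2) by (cases i; force simp: K_def)+
    have W: "open W" "W \<subseteq> V" using K(1) by (auto simp: W_def)
    have "ennreal e * emeasure lebesgue W = ennreal e * (\<integral>\<^sup>+i. emeasure lebesgue (ball (fst i) (snd i)) \<partial>count_space C)"
      unfolding W_def using C(1) dis by (subst emeasure_UN_countable) auto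
    also have "\<dots> = (\<integral>\<^sup>+i. ennreal e * emeasure lebesgue (ball (fst i) (snd i)) \<partial>count_space C)"
      by (simp add: nn_integral_cmult)
    also have "\<dots> \<le> (\<integral>\<^sup>+i. emeasure lebesgue (A \<inter> ball (fst i) (snd i)) \<partial>count_space C)"
    proof (rule nn_integral_mono)
      fix i assume "i \<in> space (count_space C)"
      then have "e * measure lebesgue (ball (fst i) (snd i)) < measure lebesgue (A \<inter> ball (fst i) (snd i))"
        using K(2) by simp
      moreover have "A \<inter> ball (fst i) (snd i) \<in> lmeasurable"
        using A by (intro fmeasurable_Int_fmeasurable[of _ _ A, simplified Int_commute]) auto
      ultimately show "ennreal e * emeasure lebesgue (ball (fst i) (snd i)) \<le> emeasure lebesgue (A \<inter> ball (fst i) (snd i))"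
        using e by (simp add: emeasure_eq_measure2 lmeasurable_ball ennreal_mult'[symmetric])
    qed
    also have "\<dots> = emeasure lebesgue (\<Union>i\<in>C. A \<inter> ball (fst i) (snd i))"
    proof (rule emeasure_UN_countable[symmetric])
      show "disjoint_family_on (\<lambda>i. A \<inter> ball (fst i) (snd i)) C"
        using dis unfolding disjoint_family_on_def by blast
    qed (use C(1) A in auto)
    also have "\<dots> \<le> emeasure lebesgue (U - ?B)"
      using W U(3) by (intro emeasure_mono) (auto simp: W_def V_def fmeasurableD)
    also have "\<dots> < ennreal (e * \<epsilon>)" by (rule U(4))
    finally have "ennreal e * emeasure lebesgue W < ennreal e * ennreal \<epsilon>"
      using e \<epsilon> by (simp add: ennreal_mult)
    then have less: "emeasure lebesgue W < ennreal \<epsilon>"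
      using mult_left_mono[of "ennreal \<epsilon>" "emeasure lebesgue W" "ennreal e"] not_less by fastforce
    have Wm: "W \<in> lmeasurable"
    proof (rule fmeasurableI)
      show "W \<in> sets lebesgue" using W(1) by simp
      show "emeasure lebesgue W < \<infinity>" using less by (simp add: less_top[symmetric] order_less_imp_not_eq) (metis ennreal_neq_top less top.not_eq_extremum order.strict_trans)
    qed
    let ?N = "(S e \<inter> ball 0 n) - W"
    have N: "negligible ?N" using C(4) by (simp add: W_def)
    show "\<exists>T. S e \<inter> ball 0 n \<subseteq> T \<and> T \<in> lmeasurable \<and> measure lebesgue T \<le> \<epsilon>"
    proof (intro exI conjI)
      show "S e \<inter> ball 0 n \<subseteq> W \<union> ?N" by auto
      show "W \<union> ?N \<in> lmeasurable" by (rule fmeasurable.Un[OF Wm negligible_imp_measurable[OF N]])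
      have "measure lebesgue (W \<union> ?N) \<le> measure lebesgue W + measure lebesgue ?N"
        using Wm N by (intro measure_Un_le) (auto simp only: fmeasurableD negligible_imp_sets)
      also have "\<dots> = measure lebesgue W"
        using N by (simp only: negligible_imp_measure0 add_0_right)
      also have "\<dots> \<le> \<epsilon>" using less Wm \<epsilon> by (simp add: emeasure_eq_measure2 ennreal_less_iff)
      finally show "measure lebesgue (W \<union> ?N) \<le> \<epsilon>" .
    qed
  qed
  then have "negligible (\<Union>n::nat. S e \<inter> ball 0 (real n))" if "0 < e" for e
    using that by (intro negligible_countable_Union) auto
  moreover have "(\<Union>n::nat. S e \<inter> ball 0 (real n)) = S e" for e
    by (auto simp: reals_Archimedean2)
  ultimately have "negligible (\<Union>k::nat. S (1 / real (Suc k)))"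
    by (intro negligible_countable_Union) auto
  then have "AE p in lebesgue. p \<notin> (\<Union>k::nat. S (1 / real (Suc k)))"
    by (intro negligible_imp_AE) (simp only: not_not Collect_mem_eq)
  then show ?thesis
  proof (rule eventually_mono, intro impI allI)
    fix p and e :: real
    assume p: "p \<notin> (\<Union>k::nat. S (1 / real (Suc k)))" "p \<notin> A" and e: "0 < e"
    obtain k :: nat where k: "1 / real (Suc k) < e"
      using e by (metis nat_approx_posE)
    have "p \<notin> S (1 / real (Suc k))" using p(1) by blast
    then obtain d where d: "d > 0"
      "\<And>r. 0 < r \<Longrightarrow> r < d \<Longrightarrow> \<not> 1 / real (Suc k) * measure lebesgue (ball p r) < measure lebesgue (A \<inter> ball p r)"
      using p(2) unfolding S_def by blast
    have "measure lebesgue (A \<inter> ball p r) \<le> e * measure lebesgue (ball p r)" if "0 < r" "r < d" for r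
    proof -
      have "1 / real (Suc k) * measure lebesgue (ball p r) \<le> e * measure lebesgue (ball p r)"
        using k by (intro mult_right_mono) auto
      with d(2)[OF that] show ?thesis by linarith
    qed
    with d(1) show "\<exists>d>0. \<forall>r. 0 < r \<and> r < d \<longrightarrow>
        measure lebesgue (A \<inter> ball p r) \<le> e * measure lebesgue (ball p r)" by blast
  qed
qed

lemma AE_half_plane_ball:
  "(AE z in lebesgue_on (ball p r \<inter> half_plane). P z) \<longleftrightarrow> (AE z in lebesgue. z \<in> ball p r \<and> z \<in> half_plane \<longrightarrow> P z)"
  using half_plane_lebesgue by (subst AE_restrict_space_iff) auto

lemma AE_half_plane:
  "(AE z in lebesgue_on half_plane. P z) \<longleftrightarrow> (AE z in lebesgue. z \<in> half_plane \<longrightarrow> P z)"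
  using half_plane_lebesgue by (subst AE_restrict_space_iff) auto

context
  fixes g :: "real \<times> real \<Rightarrow> real"
  assumes g: "g \<in> borel_measurable (lebesgue_on half_plane)"
begin

abbreviation (input) "sup_ball p r \<equiv> esssup (lebesgue_on (ball p r \<inter> half_plane)) (\<lambda>z. ereal (g z))"

lemma sup_ball_measurable: "(\<lambda>z. ereal (g z)) \<in> borel_measurable (lebesgue_on (ball p r \<inter> half_plane))"
proof -
  have "g \<in> borel_measurable (lebesgue_on (ball p r \<inter> half_plane))"
    by (rule measurable_restrict_mono[OF g]) auto
  then show ?thesis by simp
qed

lemma sup_ball_le_iff:
  "sup_ball p r \<le> c \<longleftrightarrow> (AE z in lebesgue. z \<in> ball p r \<and> z \<in> half_plane \<longrightarrow> ereal (g z) \<le> c)"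
proof
  assume "sup_ball p r \<le> c"
  moreover have "AE z in lebesgue. z \<in> ball p r \<and> z \<in> half_plane \<longrightarrow> ereal (g z) \<le> sup_ball p r"
    using esssup_AE[of "\<lambda>z. ereal (g z)" "lebesgue_on (ball p r \<inter> half_plane)"]
    unfolding AE_half_plane_ball .
  ultimately show "AE z in lebesgue. z \<in> ball p r \<and> z \<in> half_plane \<longrightarrow> ereal (g z) \<le> c"
    by (elim eventually_mono) (auto intro: order_trans)
next
  assume "AE z in lebesgue. z \<in> ball p r \<and> z \<in> half_plane \<longrightarrow> ereal (g z) \<le> c"
  then show "sup_ball p r \<le> c"
    by (intro esssup_I sup_ball_measurable) (simp only: AE_half_plane_ball)
qed

lemma sup_ball_mono:
  assumes "r \<le> s" shows "sup_ball p r \<le> sup_ball p s"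
proof -
  have "AE z in lebesgue. z \<in> ball p s \<and> z \<in> half_plane \<longrightarrow> ereal (g z) \<le> sup_ball p s"
    by (simp only: sup_ball_le_iff[symmetric])
  then show ?thesis
    unfolding sup_ball_le_iff by (rule eventually_mono) (use assms in auto)
qed

text \<open>
  The essential supremum over a ball increases with the radius, so the limit exists and is the
  infimum over all radii.
\<close>

lemma sup_ball_tendsto: "((\<lambda>r. sup_ball p r) \<longlongrightarrow> upper_env g p) (at_right 0)"
proof -
  let ?L = "INF r\<in>{0<..}. sup_ball p r"
  have "((\<lambda>r. sup_ball p r) \<longlongrightarrow> ?L) (at_right 0)"
  proof (rule order_tendstoI)
    fix a assume a: "a < ?L"
    show "eventually (\<lambda>r. a < sup_ball p r) (at_right 0)"
      unfolding eventually_at_right_field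
    proof (intro exI[of _ 1] conjI allI impI)
      fix r :: real assume "0 < r"
      then have "?L \<le> sup_ball p r" by (intro INF_lower) auto
      with a show "a < sup_ball p r" by (rule less_le_trans)
    qed simp
  next
    fix a assume "?L < a"
    then obtain s where s: "0 < s" "sup_ball p s < a" by (auto simp: INF_less_iff)
    show "eventually (\<lambda>r. sup_ball p r < a) (at_right 0)"
      unfolding eventually_at_right_field
    proof (intro exI[of _ s] conjI allI impI)
      fix r :: real assume "0 < r" "r < s"
      then have "sup_ball p r \<le> sup_ball p s" by (intro sup_ball_mono) simp
      with s(2) show "sup_ball p r < a" by (rule le_less_trans[rotated])
    qed (rule s)
  qed
  then show ?thesis
    unfolding upper_env_def by (subst tendsto_Lim[where l="?L"]) auto
qed

lemma upper_env_le:
  assumes "0 < r" "AE z in lebesgue. z \<in> ball p r \<and> z \<in> half_plane \<longrightarrow> ereal (g z) \<le> c"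
  shows "upper_env g p \<le> c"
proof (rule tendsto_upperbound[OF sup_ball_tendsto])
  have "sup_ball p r \<le> c" using assms(2) by (simp only: sup_ball_le_iff)
  then show "eventually (\<lambda>s. sup_ball p s \<le> c) (at_right 0)"
    unfolding eventually_at_right_field
    using assms(1) sup_ball_mono[of _ r p] by (intro exI[of _ r]) (meson less_imp_le order_trans)
qed simp

lemma upper_env_lessE:
  assumes "upper_env g p < c"
  obtains r where "0 < r" "AE z in lebesgue. z \<in> ball p r \<and> z \<in> half_plane \<longrightarrow> ereal (g z) < c"
proof -
  obtain d where d: "upper_env g p < d" "d < c" using dense[OF assms] by auto
  have "eventually (\<lambda>r. sup_ball p r < d) (at_right 0)"
    using order_tendstoD(2)[OF sup_ball_tendsto d(1)] .
  then obtain b where b: "0 < b" "\<And>r. 0 < r \<Longrightarrow> r < b \<Longrightarrow> sup_ball p r < d"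
    unfolding eventually_at_right_field by blast
  have "sup_ball p (b / 2) \<le> d" using b by (intro less_imp_le b(2)) auto
  then have "AE z in lebesgue. z \<in> ball p (b / 2) \<and> z \<in> half_plane \<longrightarrow> ereal (g z) \<le> d"
    by (simp only: sup_ball_le_iff)
  then have "AE z in lebesgue. z \<in> ball p (b / 2) \<and> z \<in> half_plane \<longrightarrow> ereal (g z) < c"
    by (rule eventually_mono) (use d(2) in \<open>auto intro: le_less_trans\<close>)
  with b(1) show ?thesis by (intro that[of "b / 2"]) auto
qed

text \<open>
  If \<open>g p\<close> exceeds the envelope, then some rational \<open>q\<close> lies between them, and \<open>{g > q}\<close> is null near
  \<open>p\<close>. So the exceptional set is a countable union of sets that are locally null.
\<close>

lemma le_upper_env: "AE p in lebesgue. p \<in> half_plane \<longrightarrow> ereal (g p) \<le> upper_env g p"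
proof -
  define N where "N q = {p \<in> half_plane. real_of_rat q < g p \<and> upper_env g p < ereal (real_of_rat q)}" for q
  have "negligible (N q)" for q
    unfolding locally_negligible_alt[of "N q"]
  proof
    fix p assume p: "p \<in> N q"
    then obtain r where r: "0 < r" "AE z in lebesgue. z \<in> ball p r \<and> z \<in> half_plane \<longrightarrow> ereal (g z) < ereal (real_of_rat q)"
      unfolding N_def by (auto elim: upper_env_lessE)
    have "negligible {z. \<not> (z \<in> ball p r \<and> z \<in> half_plane \<longrightarrow> ereal (g z) < ereal (real_of_rat q))}"
      by (rule AE_imp_negligible[OF r(2)])
    then have "negligible (N q \<inter> ball p r)"
      by (rule negligible_subset) (auto simp: N_def)
    moreover have "openin (top_of_set (N q)) (N q \<inter> ball p r)" by (simp add: openin_open_Int)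
    ultimately show "\<exists>U. openin (top_of_set (N q)) U \<and> p \<in> U \<and> negligible U"
      using p r(1) by (intro exI[of _ "N q \<inter> ball p r"]) auto
  qed
  then have "negligible (\<Union>q. N q)"
    by (intro negligible_countable_Union) auto
  then have "AE p in lebesgue. p \<notin> (\<Union>q. N q)"
    by (intro negligible_imp_AE) (simp only: not_not Collect_mem_eq)
  then show ?thesis
  proof (rule eventually_mono)
   fix p assume N: "p \<notin> (\<Union>q. N q)"
   show "p \<in> half_plane \<longrightarrow> ereal (g p) \<le> upper_env g p"
   proof (rule impI, rule ccontr)
    assume p: "p \<in> half_plane" "\<not> ereal (g p) \<le> upper_env g p"
    then have "upper_env g p < ereal (g p)" by simp
    then obtain c where c: "upper_env g p < ereal c" "c < g p"
      using ereal_dense2[of "upper_env g p" "ereal (g p)"] by auto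
    obtain q where q: "c < real_of_rat q" "real_of_rat q < g p"
      using of_rat_dense[OF c(2)] by auto
    have "upper_env g p < ereal (real_of_rat q)" using c(1) q(1) by (auto intro: less_trans)
    with p q N show False by (auto simp: N_def)
   qed
  qed
qed

end

lemma lower_env_eq:
  assumes "g \<in> borel_measurable (lebesgue_on half_plane)"
  shows "lower_env g p = - upper_env (\<lambda>z. - g z) p"
proof -
  have "(\<lambda>z. - g z) \<in> borel_measurable (lebesgue_on half_plane)" using assms by simp
  from tendsto_uminus_ereal[OF sup_ball_tendsto[OF this, of p]]
  show ?thesis unfolding lower_env_def by (intro tendsto_Lim) auto
qed

section \<open>Integration by parts in the half plane\<close>

text \<open>
  All integrands below are sums of such products: the rough factors are cut off outside a bounded
  set, the others are continuous.
\<close>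

lemma integrable_bounded_times_continuous:
  fixes f g :: "'a::euclidean_space \<Rightarrow> real"
  assumes f: "f \<in> borel_measurable borel" "\<And>x. \<bar>f x\<bar> \<le> M" "\<And>x. x \<notin> S \<Longrightarrow> f x = 0" "bounded S"
    and g: "continuous_on UNIV g"
  shows "integrable lborel (\<lambda>x. f x * g x)"
proof -
  obtain a where a: "S \<subseteq> cbox (-a) a" using bounded_subset_cbox_symmetric[OF f(4)] by auto
  have "compact (g ` cbox (-a) a)"
    by (intro compact_continuous_image continuous_on_subset[OF g]) auto
  then obtain B where B: "\<And>x. x \<in> cbox (-a) a \<Longrightarrow> \<bar>g x\<bar> \<le> B"
    using compact_imp_bounded[THEN bounded_iff[THEN iffD1]] by (metis imageI real_norm_def)
  have [measurable]: "g \<in> borel_measurable borel" using g by (rule borel_measurable_continuous_onI)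
  show ?thesis
  proof (rule integrableI_bounded_set[where A="cbox (-a) a" and B="M * B"])
    show "AE x in lborel. x \<in> cbox (-a) a \<longrightarrow> norm (f x * g x) \<le> M * B"
    proof (intro AE_I2 impI)
      fix x assume "x \<in> cbox (-a) a"
      then show "norm (f x * g x) \<le> M * B"
        unfolding real_norm_def abs_mult using f(2)[of x] B[of x] by (intro mult_mono) auto
    qed
    show "AE x in lborel. x \<notin> cbox (-a) a \<longrightarrow> f x * g x = 0"
      using a f(3) by (intro AE_I2) auto
    show "emeasure lborel (cbox (-a) a) < \<infinity>" by (intro emeasure_bounded_finite) auto
  qed (use f(1) in auto)
qed

lemma integrable_continuous_compact_support:
  fixes f :: "'a::euclidean_space \<Rightarrow> real"
  assumes "continuous_on UNIV f" "compact K" "\<And>x. x \<notin> K \<Longrightarrow> f x = 0"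
  shows "integrable lborel f"
proof -
  have "(indicator K :: 'a \<Rightarrow> real) \<in> borel_measurable borel"
    by (intro borel_measurable_indicator borel_compact assms)
  then have "integrable lborel (\<lambda>x. indicator K x * f x)"
    by (rule integrable_bounded_times_continuous[where M=1 and S=K])
      (use assms in \<open>auto simp: compact_imp_bounded indicator_def\<close>)
  moreover have "(\<lambda>x. indicator K x * f x) = f" using assms(3) by (auto simp: indicator_def fun_eq_iff)
  ultimately show ?thesis by simp
qed

lemma integral_derivative_eq_0:
  fixes F f :: "real \<Rightarrow> real"
  assumes F: "\<And>x. (F has_real_derivative f x) (at x)" and f: "continuous_on UNIV f"
    and R: "0 \<le> R" "\<And>x. R \<le> \<bar>x\<bar> \<Longrightarrow> F x = 0" "\<And>x. R \<le> \<bar>x\<bar> \<Longrightarrow> f x = 0"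
  shows "(\<integral>x. f x \<partial>lborel) = 0"
proof -
  have "(\<integral>x. f x \<partial>lborel) = (\<integral>x. f x * indicator {-R..R} x \<partial>lborel)"
    by (intro Bochner_Integration.integral_cong) (auto simp: indicator_def intro!: R(3))
  also have "\<dots> = F R - F (-R)"
    using R(1) F f by (intro integral_FTC_Icc_real) (auto simp: continuous_on_eq_continuous_at)
  finally show ?thesis using R(1,2) by simp
qed

lemma derivative_outside_support:
  fixes F :: "'a::t2_space \<Rightarrow> real"
  assumes "((\<lambda>s. F (l s)) has_real_derivative d) (at x)" "compact K" "\<And>p. p \<notin> K \<Longrightarrow> F p = 0"
    "continuous_on UNIV l" "l x \<notin> K"
  shows "d = 0"
proof -
  have o: "open (l -` (- K))"
    using open_Compl[OF compact_imp_closed[OF assms(2)]] assms(4) by (rule open_vimage)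
  have d: "((\<lambda>s. 0) has_real_derivative 0) (at x)" by simp
  have "((\<lambda>s. F (l s)) has_real_derivative 0) (at x)"
    by (rule has_field_derivative_transform_within_open[OF d o]) (use assms(3,5) in auto)
  then show ?thesis using assms(1) DERIV_unique by blast
qed

lemma integral_partial1_eq_0:
  fixes F F1 :: "real \<times> real \<Rightarrow> real"
  assumes F: "\<And>t x. ((\<lambda>s. F (s, x)) has_real_derivative F1 (t, x)) (at t)" and c: "continuous_on UNIV F1"
    and K: "compact K" "\<And>p. p \<notin> K \<Longrightarrow> F p = 0"
  shows "(\<integral>p. F1 p \<partial>lborel) = 0"
proof -
  have z: "F1 (t, x) = 0" if "(t, x) \<notin> K" for t x
    by (rule derivative_outside_support[OF F K, of x t]) (use that in \<open>auto intro: continuous_intros\<close>)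
  have i: "integrable (lborel \<Otimes>\<^sub>M lborel) (\<lambda>(t, x). F1 (t, x))"
    unfolding lborel_prod by (simp, rule integrable_continuous_compact_support[OF c K(1)]) (use z in auto)
  obtain R where R: "0 < R" "\<And>p. p \<in> K \<Longrightarrow> norm p < R"
    using bounded_pos_less[of K] compact_imp_bounded[OF K(1)] by auto
  have out: "(t, x) \<notin> K" if "R \<le> \<bar>t\<bar>" for t x
    using R(2)[of "(t, x)"] that norm_fst_le[of t x] by auto
  have "(\<integral>t. F1 (t, x) \<partial>lborel) = 0" for x
  proof (rule integral_derivative_eq_0[OF F, where R=R])
    show "continuous_on UNIV (\<lambda>t. F1 (t, x))"
      by (rule continuous_on_compose2[OF c]) (auto intro: continuous_intros)
  qed (use R(1) out K(2) z in auto)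
  then have "(\<integral>x. \<integral>t. F1 (t, x) \<partial>lborel \<partial>lborel) = 0" by simp
  then show ?thesis using lborel_pair.integral_snd[OF i] by (simp add: lborel_prod)
qed

lemma integral_partial2_eq_0:
  fixes F F2 :: "real \<times> real \<Rightarrow> real"
  assumes F: "\<And>t x. ((\<lambda>s. F (t, s)) has_real_derivative F2 (t, x)) (at x)" and c: "continuous_on UNIV F2"
    and K: "compact K" "\<And>p. p \<notin> K \<Longrightarrow> F p = 0"
  shows "(\<integral>p. F2 p \<partial>lborel) = 0"
proof -
  have z: "F2 (t, x) = 0" if "(t, x) \<notin> K" for t x
    by (rule derivative_outside_support[OF F K, of t x]) (use that in \<open>auto intro: continuous_intros\<close>)
  have i: "integrable (lborel \<Otimes>\<^sub>M lborel) (\<lambda>(t, x). F2 (t, x))"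
    unfolding lborel_prod by (simp, rule integrable_continuous_compact_support[OF c K(1)]) (use z in auto)
  obtain R where R: "0 < R" "\<And>p. p \<in> K \<Longrightarrow> norm p < R"
    using bounded_pos_less[of K] compact_imp_bounded[OF K(1)] by auto
  have out: "(t, x) \<notin> K" if "R \<le> \<bar>x\<bar>" for t x
    using R(2)[of "(t, x)"] that norm_snd_le[of x t] by auto
  have "(\<integral>x. F2 (t, x) \<partial>lborel) = 0" for t
  proof (rule integral_derivative_eq_0[OF F, where R=R])
    show "continuous_on UNIV (\<lambda>x. F2 (t, x))"
      by (rule continuous_on_compose2[OF c]) (auto intro: continuous_intros)
  qed (use R(1) out K(2) z in auto)
  then have "(\<integral>t. \<integral>x. F2 (t, x) \<partial>lborel \<partial>lborel) = 0" by simp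
  then show ?thesis using lborel_pair.integral_fst[OF i] by (simp add: lborel_prod)
qed

lemma continuous_extend_by_zero:
  fixes F :: "real \<times> real \<Rightarrow> real"
  assumes "continuous_on half_plane F" "compact K" "K \<subseteq> half_plane" "\<And>p. p \<in> half_plane \<Longrightarrow> p \<notin> K \<Longrightarrow> F p = 0"
  shows "continuous_on UNIV (\<lambda>p. if p \<in> half_plane then F p else 0)" (is "continuous_on UNIV ?F")
proof -
  have "continuous_on half_plane ?F"
    by (rule continuous_on_eq[OF assms(1)]) auto
  moreover have "continuous_on (- K) ?F"
    by (rule continuous_on_eq[OF continuous_on_const[of _ 0]]) (use assms in auto)
  ultimately have "continuous_on (half_plane \<union> - K) ?F"
    using open_half_plane assms(2) by (intro continuous_on_open_Un) (auto simp: compact_imp_closed)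
  moreover have "half_plane \<union> - K = UNIV" using assms(3) by auto
  ultimately show ?thesis by simp
qed

lemma half_plane_integral_eq:
  fixes F :: "real \<times> real \<Rightarrow> real"
  assumes "continuous_on half_plane F" "compact K" "K \<subseteq> half_plane" "\<And>p. p \<in> half_plane \<Longrightarrow> p \<notin> K \<Longrightarrow> F p = 0"
  shows "(LINT p|lebesgue_on half_plane. F p) = (\<integral>p. (if p \<in> half_plane then F p else 0) \<partial>lborel)"
    "integrable (lebesgue_on half_plane) F" "integrable lborel (\<lambda>p. if p \<in> half_plane then F p else 0)"
proof -
  have c: "continuous_on UNIV (\<lambda>p. if p \<in> half_plane then F p else 0)"
    by (rule continuous_extend_by_zero[OF assms])
  then have m: "(\<lambda>p. if p \<in> half_plane then F p else 0) \<in> borel_measurable lborel"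
    using borel_measurable_continuous_onI by simp
  show i: "integrable lborel (\<lambda>p. if p \<in> half_plane then F p else 0)"
    by (rule integrable_continuous_compact_support[OF c assms(2)]) (use assms(4) in auto)
  show "(LINT p|lebesgue_on half_plane. F p) = (\<integral>p. (if p \<in> half_plane then F p else 0) \<partial>lborel)"
    using Lebesgue_Measure.integral_restrict_UNIV[OF half_plane_lebesgue, of F] integral_completion[OF m] by simp
  show "integrable (lebesgue_on half_plane) F"
    using Lebesgue_Measure.integrable_restrict_UNIV[OF half_plane_lebesgue, of F] integrable_completion[OF m] i by simp
qed

text \<open>
  The product rule, and the fact that a derivative with compact support has integral zero.
\<close>

lemma dist_d1_eq:
  assumes g: "\<And>p. p \<in> half_plane \<Longrightarrow> ((\<lambda>s. g (s, snd p)) has_real_derivative g1 p) (at (fst p))"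
    "continuous_on half_plane g" "continuous_on half_plane g1"
    and \<psi>: "\<And>p. p \<in> half_plane \<Longrightarrow> ((\<lambda>s. \<psi> (s, snd p)) has_real_derivative \<psi>' p) (at (fst p))"
    "continuous_on half_plane \<psi>" "continuous_on half_plane \<psi>'"
    and K: "compact K" "K \<subseteq> half_plane" "\<And>p. p \<notin> K \<Longrightarrow> \<psi> p = 0"
  shows "dist_d1 g \<psi> = (LINT p|lebesgue_on half_plane. g1 p * \<psi> p)"
proof -
  have z: "\<psi>' p = 0" if "p \<in> half_plane" "p \<notin> K" for p
    by (rule derivative_outside_support[OF \<psi>(1)[OF that(1)] K(1,3)]) (use that in \<open>auto intro: continuous_intros\<close>)
  let ?e = "\<lambda>F p. if p \<in> half_plane then F p else (0::real)"
  have 1: "(\<integral>p. ?e (\<lambda>p. g1 p * \<psi> p + \<psi>' p * g p) p \<partial>lborel) = 0"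
  proof (rule integral_partial1_eq_0[where F="?e (\<lambda>p. g p * \<psi> p)", OF _ _ K(1)])
    show "continuous_on UNIV (?e (\<lambda>p. g1 p * \<psi> p + \<psi>' p * g p))"
      by (rule continuous_extend_by_zero[OF _ K(1,2)]) (use z K(3) g \<psi> in \<open>auto intro!: continuous_intros\<close>)
    show "?e (\<lambda>p. g p * \<psi> p) p = 0" if "p \<notin> K" for p using K(3) that by simp
    fix t x
    show "((\<lambda>s. ?e (\<lambda>p. g p * \<psi> p) (s, x)) has_real_derivative ?e (\<lambda>p. g1 p * \<psi> p + \<psi>' p * g p) (t, x)) (at t)"
    proof (cases "0 < t")
      case True
      have "((\<lambda>s. g (s, x) * \<psi> (s, x)) has_real_derivative g1 (t, x) * \<psi> (t, x) + \<psi>' (t, x) * g (t, x)) (at t)"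
        using DERIV_mult[OF g(1)[of "(t, x)"] \<psi>(1)[of "(t, x)"]] True by (simp add: half_plane_def)
      then have "((\<lambda>s. ?e (\<lambda>p. g p * \<psi> p) (s, x)) has_real_derivative g1 (t, x) * \<psi> (t, x) + \<psi>' (t, x) * g (t, x)) (at t)"
        by (rule has_field_derivative_transform_within_open[where S="{0<..}"]) (use True in \<open>auto simp: half_plane_def\<close>)
      with True show ?thesis by (simp add: half_plane_def)
    next
      case False
      have o: "open ((\<lambda>s. (s, x)) -` (- K))"
        by (intro open_vimage open_Compl compact_imp_closed K(1) continuous_intros)
      have d: "((\<lambda>s. 0) has_real_derivative 0) (at t)" by simp
      have "((\<lambda>s. ?e (\<lambda>p. g p * \<psi> p) (s, x)) has_real_derivative 0) (at t)"
        by (rule has_field_derivative_transform_within_open[OF d o])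
          (use K False in \<open>auto simp: half_plane_def\<close>)
      with False show ?thesis by (simp add: half_plane_def)
    qed
  qed
  have "integrable lborel (?e (\<lambda>p. g1 p * \<psi> p))" "integrable lborel (?e (\<lambda>p. g p * \<psi>' p))"
    and eq: "(LINT p|lebesgue_on half_plane. g1 p * \<psi> p) = (\<integral>p. ?e (\<lambda>p. g1 p * \<psi> p) p \<partial>lborel)"
     "(LINT p|lebesgue_on half_plane. g p * \<psi>' p) = (\<integral>p. ?e (\<lambda>p. g p * \<psi>' p) p \<partial>lborel)"
    by (rule half_plane_integral_eq[OF _ K(1,2)]; use z K(3) g \<psi> in \<open>auto intro!: continuous_intros\<close>)+
  then have "(\<integral>p. ?e (\<lambda>p. g1 p * \<psi> p) p + ?e (\<lambda>p. g p * \<psi>' p) p \<partial>lborel) =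
      (\<integral>p. ?e (\<lambda>p. g1 p * \<psi> p) p \<partial>lborel) + (\<integral>p. ?e (\<lambda>p. g p * \<psi>' p) p \<partial>lborel)"
    by (intro Bochner_Integration.integral_add)
  moreover have "(\<lambda>p. ?e (\<lambda>p. g1 p * \<psi> p) p + ?e (\<lambda>p. g p * \<psi>' p) p) = ?e (\<lambda>p. g1 p * \<psi> p + \<psi>' p * g p)"
    by (auto simp: fun_eq_iff)
  moreover have "(LINT p|lebesgue_on half_plane. g p * pd1 \<psi> p) = (LINT p|lebesgue_on half_plane. g p * \<psi>' p)"
    by (rule Bochner_Integration.integral_cong) (use pd1_eq[OF \<psi>(1)] in auto)
  ultimately show ?thesis using 1 eq unfolding dist_d1_def by simp
qed

lemma dist_d2_eq:
  assumes g: "\<And>p. p \<in> half_plane \<Longrightarrow> ((\<lambda>s. g (fst p, s)) has_real_derivative g2 p) (at (snd p))"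
    "continuous_on half_plane g" "continuous_on half_plane g2"
    and \<psi>: "\<And>p. p \<in> half_plane \<Longrightarrow> ((\<lambda>s. \<psi> (fst p, s)) has_real_derivative \<psi>' p) (at (snd p))"
    "continuous_on half_plane \<psi>" "continuous_on half_plane \<psi>'"
    and K: "compact K" "K \<subseteq> half_plane" "\<And>p. p \<notin> K \<Longrightarrow> \<psi> p = 0"
  shows "dist_d2 g \<psi> = (LINT p|lebesgue_on half_plane. g2 p * \<psi> p)"
proof -
  have z: "\<psi>' p = 0" if "p \<in> half_plane" "p \<notin> K" for p
    by (rule derivative_outside_support[OF \<psi>(1)[OF that(1)] K(1,3)]) (use that in \<open>auto intro: continuous_intros\<close>)
  let ?e = "\<lambda>F p. if p \<in> half_plane then F p else (0::real)"
  have 1: "(\<integral>p. ?e (\<lambda>p. g2 p * \<psi> p + \<psi>' p * g p) p \<partial>lborel) = 0"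
  proof (rule integral_partial2_eq_0[where F="?e (\<lambda>p. g p * \<psi> p)", OF _ _ K(1)])
    show "continuous_on UNIV (?e (\<lambda>p. g2 p * \<psi> p + \<psi>' p * g p))"
      by (rule continuous_extend_by_zero[OF _ K(1,2)]) (use z K(3) g \<psi> in \<open>auto intro!: continuous_intros\<close>)
    show "?e (\<lambda>p. g p * \<psi> p) p = 0" if "p \<notin> K" for p using K(3) that by simp
    fix t x
    show "((\<lambda>s. ?e (\<lambda>p. g p * \<psi> p) (t, s)) has_real_derivative ?e (\<lambda>p. g2 p * \<psi> p + \<psi>' p * g p) (t, x)) (at x)"
      using DERIV_mult[OF g(1)[of "(t, x)"] \<psi>(1)[of "(t, x)"]] by (cases "0 < t") (simp_all add: half_plane_def)
  qed
  have "integrable lborel (?e (\<lambda>p. g2 p * \<psi> p))" "integrable lborel (?e (\<lambda>p. g p * \<psi>' p))"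
    and eq: "(LINT p|lebesgue_on half_plane. g2 p * \<psi> p) = (\<integral>p. ?e (\<lambda>p. g2 p * \<psi> p) p \<partial>lborel)"
     "(LINT p|lebesgue_on half_plane. g p * \<psi>' p) = (\<integral>p. ?e (\<lambda>p. g p * \<psi>' p) p \<partial>lborel)"
    by (rule half_plane_integral_eq[OF _ K(1,2)]; use z K(3) g \<psi> in \<open>auto intro!: continuous_intros\<close>)+
  then have "(\<integral>p. ?e (\<lambda>p. g2 p * \<psi> p) p + ?e (\<lambda>p. g p * \<psi>' p) p \<partial>lborel) =
      (\<integral>p. ?e (\<lambda>p. g2 p * \<psi> p) p \<partial>lborel) + (\<integral>p. ?e (\<lambda>p. g p * \<psi>' p) p \<partial>lborel)"
    by (intro Bochner_Integration.integral_add)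
  moreover have "(\<lambda>p. ?e (\<lambda>p. g2 p * \<psi> p) p + ?e (\<lambda>p. g p * \<psi>' p) p) = ?e (\<lambda>p. g2 p * \<psi> p + \<psi>' p * g p)"
    by (auto simp: fun_eq_iff)
  moreover have "(LINT p|lebesgue_on half_plane. g p * pd2 \<psi> p) = (LINT p|lebesgue_on half_plane. g p * \<psi>' p)"
    by (rule Bochner_Integration.integral_cong) (use pd2_eq[OF \<psi>(1)] in auto)
  ultimately show ?thesis using 1 eq unfolding dist_d2_def by simp
qed

section \<open>The kinetic entropies\<close>

lemma pos_part_power_deriv:
  "((\<lambda>y. (max 0 y) ^ (n + 2)) has_real_derivative real (n + 2) * (max 0 y) ^ (n + 1)) (at (y::real))"
proof (rule linorder_cases[of y 0])
  assume y: "y < 0"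
  have d: "((\<lambda>_. 0) has_real_derivative 0) (at y)" by simp
  have "((\<lambda>y. (max 0 y) ^ (n + 2)) has_real_derivative 0) (at y)"
    by (rule has_field_derivative_transform_within_open[OF d, where S="{..<0}"]) (use y in \<open>auto simp: max_def\<close>)
  with y show ?thesis by (simp add: max_def)
next
  assume y: "0 < y"
  have d: "((\<lambda>y. y ^ (n + 2)) has_real_derivative real (n + 2) * y ^ (n + 1)) (at y)"
    using DERIV_pow[of "n + 2" y] by simp
  have "((\<lambda>y. (max 0 y) ^ (n + 2)) has_real_derivative real (n + 2) * y ^ (n + 1)) (at y)"
    by (rule has_field_derivative_transform_within_open[OF d, where S="{0<..}"]) (use y in \<open>auto simp: max_def\<close>)
  with y show ?thesis by (simp add: max_def)
next
  assume y: "y = 0"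
  have "((\<lambda>h::real. \<bar>h\<bar> ^ (n + 1)) \<longlongrightarrow> \<bar>0\<bar> ^ (n + 1)) (at 0)"
    by (intro tendsto_intros)
  then have l: "((\<lambda>h::real. \<bar>h\<bar> ^ (n + 1)) \<longlongrightarrow> 0) (at 0)" by simp
  have "norm ((max 0 h) ^ (n + 2) / h) \<le> \<bar>h\<bar> ^ (n + 1)" for h :: real
  proof (cases "0 < h")
    case False
    then have "(max 0 h) ^ (n + 2) / h = 0" by simp
    then show ?thesis by (simp only: norm_zero) (rule zero_le_power[OF abs_ge_zero])
  qed (simp add: max_def)
  then have "((\<lambda>h::real. (max 0 h) ^ (n + 2) / h) \<longlongrightarrow> 0) (at 0)"
    by (intro Lim_null_comparison[OF _ l] always_eventually) auto
  then show ?thesis using y by (simp add: has_field_derivative_iff)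
qed

text \<open>
  The antiderivative of the positive part.
\<close>

definition pos_sq :: "real \<Rightarrow> real" where "pos_sq y = (max 0 y)\<^sup>2 / 2"

text \<open>
  The antiderivative of \<open>y\<^sub>+ (y + h)\<close>. With \<open>y = s v - h\<close> the factor \<open>y + h\<close> is the velocity \<open>v\<close>, up to
  the sign \<open>s\<close>.
\<close>

definition pos_flux :: "real \<Rightarrow> real \<Rightarrow> real" where
  "pos_flux h y = (max 0 y) ^ 3 / 3 + h * (max 0 y)\<^sup>2 / 2"

lemma pos_sq_deriv: "(pos_sq has_real_derivative max 0 y) (at y)"
  using DERIV_cdivide[OF pos_part_power_deriv[of 0 y], of 2]
  by (simp add: pos_sq_def[abs_def] numeral_2_eq_2)

lemma pos_flux_deriv: "(pos_flux h has_real_derivative (max 0 y) * (max 0 y + h)) (at y)"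
proof -
  have 3: "((\<lambda>y. (max 0 y) ^ 3 / 3) has_real_derivative (max 0 y)\<^sup>2) (at y)"
    using DERIV_cdivide[OF pos_part_power_deriv[of 1 y], of 3] by (simp add: numeral_3_eq_3 numeral_2_eq_2)
  have 2: "((\<lambda>y. h * pos_sq y) has_real_derivative h * max 0 y) (at y)"
    by (rule DERIV_cmult[OF pos_sq_deriv])
  show ?thesis
    using DERIV_add[OF 3 2]
    by (simp add: pos_flux_def[abs_def] pos_sq_def power2_eq_square algebra_simps)
qed

text \<open>
  For \<open>c = 1 / 2\<close> and \<open>c = - 1 / 2\<close> these are the values of \<open>s v - h\<close> at the ends of the interval of
  velocities \<open>v\<close> between the two Riemann invariants, larger value first. The sign \<open>s = -1\<close> exchanges
  the roles of the invariants.
\<close>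

definition shifted_invariant :: "real \<Rightarrow> real \<Rightarrow> real \<Rightarrow> real \<times> real \<Rightarrow> real" where
  "shifted_invariant s c h p = s * (snd p / fst p) + c * fst p - h"

text \<open>
  The integral of \<open>(s v - h)\<^sub>+\<close> over the velocities \<open>v\<close> between the Riemann invariants; for the flux the
  integrand has the additional factor \<open>v\<close>.
\<close>

definition kin_entropy :: "real \<Rightarrow> real \<Rightarrow> real \<times> real \<Rightarrow> real" where
  "kin_entropy s h p = pos_sq (shifted_invariant s (1/2) h p) - pos_sq (shifted_invariant s (-1/2) h p)"

definition kin_flux :: "real \<Rightarrow> real \<Rightarrow> real \<times> real \<Rightarrow> real" where
  "kin_flux s h p = s * (pos_flux h (shifted_invariant s (1/2) h p) - pos_flux h (shifted_invariant s (-1/2) h p))"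

text \<open>
  The chord of \<open>y\<^sub>+\<close> over \<open>[b, a]\<close> lies above \<open>y\<^sub>+\<close> inside this interval and below it outside, so the
  integral of \<open>y\<^sub>+\<close> minus the chord over \<open>[y1, y2]\<close> is smallest for \<open>[b, a]\<close> itself. The inequality says
  this, multiplied by \<open>2 (a - b)\<close>.
\<close>

lemma chord_inequality:
  fixes a b y1 y2 :: real
  assumes ab: "b < 0" "0 < a" and y: "y1 \<le> y2"
  shows "2 * (a - b) * (pos_sq y2 - pos_sq y1) \<ge> a * ((y2\<^sup>2 - y1\<^sup>2) - 2 * b * (y2 - y1)) + a * b * (a - b)"
proof -
  have A: "0 \<le> (- b) * (y2 - a)\<^sup>2" "0 \<le> a * (y1 - b)\<^sup>2" "0 \<le> (- b) * (y1 - a)\<^sup>2" "0 \<le> a * (y2 - b)\<^sup>2"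
    "0 \<le> a * b\<^sup>2" "0 \<le> (- b) * a\<^sup>2"
    using ab by (auto intro!: mult_nonneg_nonneg simp: mult_le_0_iff)
  consider "y1 \<le> 0" "0 \<le> y2" | "0 \<le> y1" "a \<le> y1" | "0 \<le> y1" "y1 \<le> a" | "y2 \<le> 0" "y2 \<le> b" | "y2 \<le> 0" "b \<le> y2"
    by linarith
  then show ?thesis
  proof cases
    case 1
    then have "pos_sq y2 = y2\<^sup>2 / 2" "pos_sq y1 = 0" by (auto simp: pos_sq_def max_def)
    then show ?thesis using A(1,2) by (simp add: power2_eq_square algebra_simps)
  next
    case 2
    then have e: "pos_sq y2 = y2\<^sup>2 / 2" "pos_sq y1 = y1\<^sup>2 / 2" using y by (auto simp: pos_sq_def max_def)
    have "0 \<le> (- b) * ((y2 - y1) * (y2 + y1 - 2 * a))" using 2 y ab by (intro mult_nonneg_nonneg) auto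
    then show ?thesis using e A(5,6) by (simp add: power2_eq_square algebra_simps)
  next
    case 3
    then have e: "pos_sq y2 = y2\<^sup>2 / 2" "pos_sq y1 = y1\<^sup>2 / 2" using y by (auto simp: pos_sq_def max_def)
    have "(- b) * (y1 - a)\<^sup>2 \<le> (- b) * a\<^sup>2"
      using 3 ab by (intro mult_left_mono) (auto simp: abs_le_square_iff[symmetric])
    then show ?thesis using e A(1,5) by (simp add: power2_eq_square algebra_simps)
  next
    case 4
    then have e: "pos_sq y2 = 0" "pos_sq y1 = 0" using y by (auto simp: pos_sq_def max_def)
    have "0 \<le> a * ((y2 - y1) * (2 * b - y1 - y2))" using 4 y ab by (intro mult_nonneg_nonneg) auto
    then show ?thesis using e A(5,6) by (simp add: power2_eq_square algebra_simps)
  next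
    case 5
    then have e: "pos_sq y2 = 0" "pos_sq y1 = 0" using y by (auto simp: pos_sq_def max_def)
    have "a * (y2 - b)\<^sup>2 \<le> a * b\<^sup>2"
      using 5 ab by (intro mult_left_mono) (auto simp: abs_le_square_iff[symmetric])
    then show ?thesis using e A(2,6) by (simp add: power2_eq_square algebra_simps)
  qed
qed

lemma pos_sq_mono: "y1 \<le> y2 \<Longrightarrow> pos_sq y1 \<le> pos_sq y2"
  by (auto simp: pos_sq_def intro!: power_mono divide_right_mono)

lemma convex_on_supporting_affine:
  fixes f :: "real \<times> real \<Rightarrow> real"
  assumes S: "convex S"
    and sup: "\<And>x. x \<in> S \<Longrightarrow> \<exists>a b c. f x = a * fst x + b * snd x + c \<and> (\<forall>y\<in>S. a * fst y + b * snd y + c \<le> f y)"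
  shows "convex_on S f"
proof (rule convex_onI[OF _ S])
  fix t x y assume t: "0 < t" "t < (1::real)" and xy: "x \<in> S" "y \<in> S"
  let ?z = "(1 - t) *\<^sub>R x + t *\<^sub>R y"
  have "?z \<in> S" using S t xy by (auto simp: convex_alt)
  then obtain a b c where *: "f ?z = a * fst ?z + b * snd ?z + c" "\<And>y. y \<in> S \<Longrightarrow> a * fst y + b * snd y + c \<le> f y"
    using sup by blast
  have "f ?z = (1 - t) * (a * fst x + b * snd x + c) + t * (a * fst y + b * snd y + c)"
    unfolding *(1) by (simp add: algebra_simps)
  also have "\<dots> \<le> (1 - t) * f x + t * f y"
    using t xy *(2) by (intro add_mono mult_left_mono) auto
  finally show "f ?z \<le> (1 - t) * f x + t * f y" .
qed

lemma half_plane_iff: "p \<in> half_plane \<longleftrightarrow> 0 < fst p"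
  by (cases p) (simp add: half_plane_def)

lemma convex_half_plane: "convex half_plane"
  unfolding half_plane_def by (intro convex_Times convex_UNIV) (auto intro: convex_real_interval)

lemma shifted_invariant_identities:
  assumes "0 < fst p"
  shows "shifted_invariant s (1/2) h p - shifted_invariant s (-1/2) h p = fst p"
    "(shifted_invariant s (1/2) h p)\<^sup>2 - (shifted_invariant s (-1/2) h p)\<^sup>2 = 2 * (s * snd p - h * fst p)"
proof -
  show 1: "shifted_invariant s (1/2) h p - shifted_invariant s (-1/2) h p = fst p" by (simp add: shifted_invariant_def)
  have "(shifted_invariant s (1/2) h p)\<^sup>2 - (shifted_invariant s (-1/2) h p)\<^sup>2
      = (shifted_invariant s (1/2) h p + shifted_invariant s (-1/2) h p) * (shifted_invariant s (1/2) h p - shifted_invariant s (-1/2) h p)"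
    by (simp add: power2_eq_square algebra_simps)
  also have "\<dots> = (2 * s * (snd p / fst p) - 2 * h) * fst p" unfolding 1 by (simp add: shifted_invariant_def)
  also have "\<dots> = 2 * (s * snd p - h * fst p)" using assms by (simp add: field_simps)
  finally show "(shifted_invariant s (1/2) h p)\<^sup>2 - (shifted_invariant s (-1/2) h p)\<^sup>2 = 2 * (s * snd p - h * fst p)" .
qed

text \<open>
  The integral of an affine function of \<open>v\<close> over the interval of velocities is an affine function of
  \<open>(\<rho>, m)\<close>. For the affine function that agrees with \<open>y\<^sub>+\<close> at both ends of the interval of the state
  \<open>x\<close>, it supports the entropy at \<open>x\<close>, by \<open>chord_inequality\<close> or because that function is \<open>0\<close> or \<open>y\<close>.
\<close>

lemma convex_kin_entropy: "convex_on half_plane (kin_entropy s h)"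
proof (rule convex_on_supporting_affine[OF convex_half_plane])
  fix x assume "x \<in> half_plane"
  then have x: "0 < fst x" by (simp add: half_plane_iff)
  let ?a = "shifted_invariant s (1/2) h x" and ?b = "shifted_invariant s (-1/2) h x"
  have ab: "?a - ?b = fst x" "?a\<^sup>2 - ?b\<^sup>2 = 2 * (s * snd x - h * fst x)" by (rule shifted_invariant_identities[OF x])+
  consider "?a \<le> 0" | "0 \<le> ?b" | "?b < 0" "0 < ?a" by linarith
  then show "\<exists>a b c. kin_entropy s h x = a * fst x + b * snd x + c \<and>
      (\<forall>y\<in>half_plane. a * fst y + b * snd y + c \<le> kin_entropy s h y)"
  proof cases
    case 1
    have "kin_entropy s h x = 0" using 1 ab(1) x by (simp add: kin_entropy_def pos_sq_def max_def)
    moreover have "0 \<le> kin_entropy s h y" if "y \<in> half_plane" for y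
      using pos_sq_mono[of "shifted_invariant s (-1/2) h y" "shifted_invariant s (1/2) h y"] that
      by (simp add: kin_entropy_def half_plane_iff shifted_invariant_def)
    ultimately show ?thesis by (intro exI[of _ 0]) auto
  next
    case 2
    have "kin_entropy s h x = s * snd x - h * fst x"
      using 2 ab x by (simp add: kin_entropy_def pos_sq_def max_def)
    moreover have "s * snd y - h * fst y \<le> kin_entropy s h y" if "y \<in> half_plane" for y
    proof -
      have y: "0 < fst y" using that by (simp add: half_plane_iff)
      let ?y2 = "shifted_invariant s (1/2) h y" and ?y1 = "shifted_invariant s (-1/2) h y"
      have id: "?y2 - ?y1 = fst y" "?y2\<^sup>2 - ?y1\<^sup>2 = 2 * (s * snd y - h * fst y)"
        by (rule shifted_invariant_identities[OF y])+
      have *: "pos_sq z = z\<^sup>2 / 2 - (min 0 z)\<^sup>2 / 2" for z by (auto simp: pos_sq_def max_def min_def)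
      have "(min 0 ?y2)\<^sup>2 \<le> (min 0 ?y1)\<^sup>2"
        using id(1) y by (simp add: abs_le_square_iff[symmetric] min_def)
      then show ?thesis unfolding kin_entropy_def * using id(2) by (simp add: diff_divide_distrib[symmetric])
    qed
    ultimately show ?thesis by (intro exI[of _ "-h"] exI[of _ s] exI[of _ 0]) (auto simp: algebra_simps)
  next
    case 3
    define \<kappa> where "\<kappa> = ?a / fst x"
    have k: "\<kappa> * fst x = ?a" using x by (simp add: \<kappa>_def)
    let ?L = "\<lambda>y. (- \<kappa> * (h + ?b)) * fst y + (\<kappa> * s) * snd y + ?a * ?b / 2"
    have L: "?L y = \<kappa> * ((s * snd y - h * fst y) - ?b * fst y) + ?a * ?b / 2" for y :: "real \<times> real"
      by (simp add: algebra_simps)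
    have "kin_entropy s h x = ?a\<^sup>2 / 2" using 3 by (simp add: kin_entropy_def pos_sq_def max_def)
    moreover have "?L x = ?a\<^sup>2 / 2"
    proof -
      have "(s * snd x - h * fst x) - ?b * fst x = (?a - ?b) * fst x / 2"
        using ab(2) unfolding ab(1)[symmetric] by (simp add: power2_eq_square algebra_simps)
      then have "\<kappa> * ((s * snd x - h * fst x) - ?b * fst x) = (\<kappa> * fst x) * (?a - ?b) / 2"
        by simp
      also have "\<dots> = ?a * (?a - ?b) / 2" unfolding k ..
      finally have "\<kappa> * ((s * snd x - h * fst x) - ?b * fst x) = ?a * (?a - ?b) / 2" .
      then show ?thesis unfolding L by (simp add: power2_eq_square algebra_simps)
    qed
    moreover have "?L y \<le> kin_entropy s h y" if "y \<in> half_plane" for y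
    proof -
      have y: "0 < fst y" using that by (simp add: half_plane_iff)
      let ?y2 = "shifted_invariant s (1/2) h y" and ?y1 = "shifted_invariant s (-1/2) h y"
      have id: "?y2 - ?y1 = fst y" "?y2\<^sup>2 - ?y1\<^sup>2 = 2 * (s * snd y - h * fst y)"
        by (rule shifted_invariant_identities[OF y])+
      have "2 * fst x * (kin_entropy s h y) \<ge> ?a * (2 * (s * snd y - h * fst y) - 2 * ?b * fst y) + ?a * ?b * fst x"
        using chord_inequality[OF 3, of ?y1 ?y2] id y unfolding ab(1) kin_entropy_def by simp
      also have "?a * (2 * (s * snd y - h * fst y) - 2 * ?b * fst y) + ?a * ?b * fst x = 2 * fst x * ?L y"
        unfolding L k[symmetric] by (simp add: algebra_simps)
      finally show ?thesis using x by (simp add: mult_le_cancel_left)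
    qed
    ultimately show ?thesis
      by (intro exI[of _ "- \<kappa> * (h + ?b)"] exI[of _ "\<kappa> * s"] exI[of _ "?a * ?b / 2"]) auto
  qed
qed

text \<open>
  The partial derivatives of the kinetic entropy, with respect to \<open>\<rho>\<close> and to \<open>m\<close>.
\<close>

definition kin_entropy1 :: "real \<Rightarrow> real \<Rightarrow> real \<times> real \<Rightarrow> real" where
  "kin_entropy1 s h p = max 0 (shifted_invariant s (1/2) h p) * (1/2 - s * snd p / (fst p)\<^sup>2)
     - max 0 (shifted_invariant s (-1/2) h p) * (-1/2 - s * snd p / (fst p)\<^sup>2)"

definition kin_entropy2 :: "real \<Rightarrow> real \<Rightarrow> real \<times> real \<Rightarrow> real" where
  "kin_entropy2 s h p = (max 0 (shifted_invariant s (1/2) h p) - max 0 (shifted_invariant s (-1/2) h p)) * s / fst p"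

lemma shifted_invariant_deriv1:
  assumes "0 < fst p"
  shows "((\<lambda>x. shifted_invariant s c h (x, snd p)) has_real_derivative c - s * snd p / (fst p)\<^sup>2) (at (fst p))"
proof -
  have 1: "((\<lambda>x. snd p / x) has_real_derivative - (snd p / (fst p)\<^sup>2)) (at (fst p))"
    using assms by (auto intro!: derivative_eq_intros simp: power2_eq_square)
  have 2: "((\<lambda>x. c * x - h) has_real_derivative c) (at (fst p))"
    by (auto intro!: derivative_eq_intros)
  show ?thesis
    using DERIV_add[OF DERIV_cmult[OF 1, of s] 2] by (simp add: shifted_invariant_def add_diff_eq)
qed

lemma shifted_invariant_deriv2:
  assumes "0 < fst p"
  shows "((\<lambda>y. shifted_invariant s c h (fst p, y)) has_real_derivative s / fst p) (at (snd p))"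
proof -
  have "((\<lambda>y. s / fst p * y + (c * fst p - h)) has_real_derivative s / fst p) (at (snd p))"
    using assms by (auto intro!: derivative_eq_intros)
  then show ?thesis by (simp add: shifted_invariant_def add_diff_eq)
qed

lemma pos_sq_shifted_invariant_deriv:
  assumes "0 < fst p"
  shows "((\<lambda>x. pos_sq (shifted_invariant s c h (x, snd p))) has_real_derivative
      max 0 (shifted_invariant s c h p) * (c - s * snd p / (fst p)\<^sup>2)) (at (fst p))"
    "((\<lambda>y. pos_sq (shifted_invariant s c h (fst p, y))) has_real_derivative
      max 0 (shifted_invariant s c h p) * (s / fst p)) (at (snd p))"
    "((\<lambda>x. pos_flux h' (shifted_invariant s c h (x, snd p))) has_real_derivative
      (max 0 (shifted_invariant s c h p) * (max 0 (shifted_invariant s c h p) + h')) * (c - s * snd p / (fst p)\<^sup>2)) (at (fst p))"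
    "((\<lambda>y. pos_flux h' (shifted_invariant s c h (fst p, y))) has_real_derivative
      (max 0 (shifted_invariant s c h p) * (max 0 (shifted_invariant s c h p) + h')) * (s / fst p)) (at (snd p))"
  using DERIV_chain2[OF pos_sq_deriv shifted_invariant_deriv1[OF assms, of s c h]]
    DERIV_chain2[OF pos_sq_deriv shifted_invariant_deriv2[OF assms, of s c h]]
    DERIV_chain2[OF pos_flux_deriv[of h'] shifted_invariant_deriv1[OF assms, of s c h]]
    DERIV_chain2[OF pos_flux_deriv[of h'] shifted_invariant_deriv2[OF assms, of s c h]]
  by simp_all

lemma kin_entropy_deriv:
  assumes "0 < fst p"
  shows "((\<lambda>x. kin_entropy s h (x, snd p)) has_real_derivative kin_entropy1 s h p) (at (fst p))"
    "((\<lambda>y. kin_entropy s h (fst p, y)) has_real_derivative kin_entropy2 s h p) (at (snd p))"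
  using DERIV_diff[OF pos_sq_shifted_invariant_deriv(1)[OF assms, of s "1/2" h] pos_sq_shifted_invariant_deriv(1)[OF assms, of s "-1/2" h]]
    DERIV_diff[OF pos_sq_shifted_invariant_deriv(2)[OF assms, of s "1/2" h] pos_sq_shifted_invariant_deriv(2)[OF assms, of s "-1/2" h]]
  unfolding kin_entropy_def kin_entropy1_def kin_entropy2_def
  by (simp_all add: algebra_simps diff_divide_distrib)

lemma pos_part_flux: "max 0 y * (max 0 y + h) = max 0 y * (y + (h::real))"
  by (simp add: max_def)

lemma kin_flux_deriv:
  assumes p: "0 < fst p" and s: "s\<^sup>2 = 1"
  shows "((\<lambda>x. kin_flux s h (x, snd p)) has_real_derivative
      kin_entropy2 s h p * ((fst p)\<^sup>2 / 4 - (snd p)\<^sup>2 / (fst p)\<^sup>2)) (at (fst p))"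
    "((\<lambda>y. kin_flux s h (fst p, y)) has_real_derivative
      kin_entropy1 s h p + kin_entropy2 s h p * (2 * snd p / fst p)) (at (snd p))"
proof -
  define u where "u = snd p / fst p"
  define r where "r = fst p"
  have r: "0 < r" "fst p = r" "snd p = u * r" using p by (auto simp: u_def r_def)
  define A where "A = max 0 (shifted_invariant s (1/2) h p)"
  define B where "B = max 0 (shifted_invariant s (-1/2) h p)"
  have ss: "s * s = 1" using s by (simp add: power2_eq_square)
  have AB: "A * (A + h) = A * (s * u + r / 2)" "B * (B + h) = B * (s * u - r / 2)"
    unfolding A_def B_def pos_part_flux by (simp_all add: shifted_invariant_def u_def r_def)
  have u2: "(s * u + r / 2) * (1/2 - s * u / r) = (r\<^sup>2 / 4 - u\<^sup>2) / r"
    "(s * u - r / 2) * (-1/2 - s * u / r) = (r\<^sup>2 / 4 - u\<^sup>2) / r"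
    using r ss by (simp_all add: field_simps power2_eq_square)
  have "((\<lambda>x. kin_flux s h (x, snd p)) has_real_derivative
      s * ((A * (A + h)) * (1/2 - s * u / r) - (B * (B + h)) * (-1/2 - s * u / r))) (at (fst p))"
    using DERIV_cmult[OF DERIV_diff[OF pos_sq_shifted_invariant_deriv(3)[OF p, of h s "1/2" h] pos_sq_shifted_invariant_deriv(3)[OF p, of h s "-1/2" h]], of s] r
    unfolding kin_flux_def A_def B_def by (simp add: power2_eq_square)
  also have "s * ((A * (A + h)) * (1/2 - s * u / r) - (B * (B + h)) * (-1/2 - s * u / r)) =
     (A - B) * s / r * (r\<^sup>2 / 4 - u\<^sup>2)"
    unfolding AB mult.assoc u2 by (simp add: algebra_simps diff_divide_distrib)
  also have "\<dots> = kin_entropy2 s h p * ((fst p)\<^sup>2 / 4 - (snd p)\<^sup>2 / (fst p)\<^sup>2)"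
    using r by (simp add: kin_entropy2_def A_def B_def power_mult_distrib)
  finally show "((\<lambda>x. kin_flux s h (x, snd p)) has_real_derivative
      kin_entropy2 s h p * ((fst p)\<^sup>2 / 4 - (snd p)\<^sup>2 / (fst p)\<^sup>2)) (at (fst p))" .
  have "((\<lambda>y. kin_flux s h (fst p, y)) has_real_derivative
      s * ((A * (A + h)) * (s / r) - (B * (B + h)) * (s / r))) (at (snd p))"
    using DERIV_cmult[OF DERIV_diff[OF pos_sq_shifted_invariant_deriv(4)[OF p, of h s "1/2" h] pos_sq_shifted_invariant_deriv(4)[OF p, of h s "-1/2" h]], of s] r
    unfolding kin_flux_def A_def B_def by simp
  also have "s * ((A * (A + h)) * (s / r) - (B * (B + h)) * (s / r)) =
     (s * s) * (A * (s * u + r / 2) - B * (s * u - r / 2)) / r"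
    unfolding AB using r by (simp add: field_simps)
  also have "\<dots> = (A * (1/2 - s * u / r) - B * (-1/2 - s * u / r)) + (A - B) * s / r * (2 * u)"
    using r unfolding ss by (simp add: field_simps)
  also have "\<dots> = kin_entropy1 s h p + kin_entropy2 s h p * (2 * snd p / fst p)"
    using r by (simp add: kin_entropy1_def kin_entropy2_def A_def B_def power2_eq_square)
  finally show "((\<lambda>y. kin_flux s h (fst p, y)) has_real_derivative
      kin_entropy1 s h p + kin_entropy2 s h p * (2 * snd p / fst p)) (at (snd p))" .
qed

lemma continuous_shifted_invariant: "continuous_on half_plane (shifted_invariant s c h)"
  unfolding shifted_invariant_def by (intro continuous_intros) (auto simp: half_plane_iff)

lemma continuous_kin:
  "continuous_on half_plane (kin_entropy s h)" "continuous_on half_plane (kin_flux s h)"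
  "continuous_on half_plane (kin_entropy1 s h)" "continuous_on half_plane (kin_entropy2 s h)"
  unfolding kin_entropy_def kin_flux_def kin_entropy1_def kin_entropy2_def pos_sq_def pos_flux_def
  by (intro continuous_intros continuous_shifted_invariant; force simp: half_plane_iff)+

lemma pd_flux:
  "pd1 flux1 p = 0" "pd2 flux1 p = 1"
  "0 < fst p \<Longrightarrow> pd1 flux2 p = (fst p)\<^sup>2 / 4 - (snd p)\<^sup>2 / (fst p)\<^sup>2"
  "0 < fst p \<Longrightarrow> pd2 flux2 p = 2 * snd p / fst p"
proof -
  show "pd1 flux1 p = 0" "pd2 flux1 p = 1"
    by (simp_all add: pd1_def pd2_def flux1_def)
  assume p: "0 < fst p"
  have "((\<lambda>x. flux2 (x, snd p)) has_real_derivative (fst p)\<^sup>2 / 4 - (snd p)\<^sup>2 / (fst p)\<^sup>2) (at (fst p))"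
    unfolding flux2_def using p by (auto intro!: derivative_eq_intros simp: power2_eq_square field_simps)
  then show "pd1 flux2 p = (fst p)\<^sup>2 / 4 - (snd p)\<^sup>2 / (fst p)\<^sup>2"
    unfolding pd1_def by (rule DERIV_imp_deriv)
  have "((\<lambda>y. flux2 (fst p, y)) has_real_derivative 2 * snd p / fst p) (at (snd p))"
    unfolding flux2_def using p by (auto intro!: derivative_eq_intros)
  then show "pd2 flux2 p = 2 * snd p / fst p"
    unfolding pd2_def by (rule DERIV_imp_deriv)
qed

lemma test_function_partials:
  assumes "test_function \<phi>"
  shows "((\<lambda>s. \<phi> (s, snd p)) has_real_derivative pd1 \<phi> p) (at (fst p))"
    "((\<lambda>s. \<phi> (fst p, s)) has_real_derivative pd2 \<phi> p) (at (snd p))"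
    "continuous_on S \<phi>" "continuous_on S (pd1 \<phi>)" "continuous_on S (pd2 \<phi>)"
proof -
  have C: "Ck k \<phi>" for k using assms by (simp add: test_function_def)
  note P = Ck_partials[OF C]
  show "((\<lambda>s. \<phi> (s, snd p)) has_real_derivative pd1 \<phi> p) (at (fst p))"
    "((\<lambda>s. \<phi> (fst p, s)) has_real_derivative pd2 \<phi> p) (at (snd p))"
    by (rule P(1,2))+
  show "continuous_on S \<phi>" "continuous_on S (pd1 \<phi>)" "continuous_on S (pd2 \<phi>)"
    by (rule continuous_on_subset[OF _ subset_UNIV], rule P)+
qed

text \<open>
  Entropy and flux are continuously differentiable, so that the identity of distributions reduces to
  the pointwise identities \<open>kin_flux_deriv\<close>.
\<close>

lemma entropy_pair_kin:
  assumes s: "s\<^sup>2 = 1"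
  shows "entropy_pair (kin_entropy s h) (kin_flux s h)"
  unfolding entropy_pair_def
proof (intro conjI allI impI convex_kin_entropy continuous_kin)
  fix \<phi> assume t: "test_function \<phi>"
  then obtain K where K: "compact K" "K \<subseteq> half_plane" "\<And>p. p \<notin> K \<Longrightarrow> \<phi> p = 0"
    unfolding test_function_def by blast
  note tp = test_function_partials[OF t]
  let ?e1 = "kin_entropy1 s h" and ?e2 = "kin_entropy2 s h"
  let ?a = "\<lambda>p::real\<times>real. (fst p)\<^sup>2 / 4 - (snd p)\<^sup>2 / (fst p)\<^sup>2"
  let ?b = "\<lambda>p::real\<times>real. 2 * snd p / fst p"
  have ca: "continuous_on half_plane ?a" "continuous_on half_plane ?b"
    "continuous_on half_plane (\<lambda>p::real\<times>real. - (2 * snd p / (fst p)\<^sup>2))" "continuous_on half_plane (\<lambda>p::real\<times>real. 2 / fst p)"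
    by (intro continuous_intros; force simp: half_plane_iff)+
  have A: "dist_d2 (kin_entropy s h) (\<lambda>p. pd1 flux2 p * \<phi> p) = (LINT p|lebesgue_on half_plane. ?e2 p * (pd1 flux2 p * \<phi> p))"
  proof (rule dist_d2_eq[OF _ _ _ _ _ _ K(1,2), where \<psi>'="\<lambda>p. ?a p * pd2 \<phi> p + (- (2 * snd p / (fst p)\<^sup>2)) * \<phi> p"])
    fix p :: "real \<times> real" assume "p \<in> half_plane"
    then have p: "0 < fst p" by (simp add: half_plane_iff)
    show "((\<lambda>s'. kin_entropy s h (fst p, s')) has_real_derivative ?e2 p) (at (snd p))"
      by (rule kin_entropy_deriv[OF p])
    have "((\<lambda>y. c - y\<^sup>2 / d) has_real_derivative - (2 * y / d)) (at y)" if "d \<noteq> 0" for c d y :: real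
      using that by (auto intro!: derivative_eq_intros)
    then have "((\<lambda>y. (fst p)\<^sup>2 / 4 - y\<^sup>2 / (fst p)\<^sup>2) has_real_derivative - (2 * snd p / (fst p)\<^sup>2)) (at (snd p))"
      using p by simp
    from DERIV_mult[OF this tp(2)[of p]]
    show "((\<lambda>s. pd1 flux2 (fst p, s) * \<phi> (fst p, s)) has_real_derivative
       ?a p * pd2 \<phi> p + (- (2 * snd p / (fst p)\<^sup>2)) * \<phi> p) (at (snd p))"
      using p by (simp add: pd_flux algebra_simps)
  next
    show "continuous_on half_plane (\<lambda>p. pd1 flux2 p * \<phi> p)"
      by (rule continuous_on_eq[OF continuous_on_mult[OF ca(1) tp(3)]]) (auto simp: half_plane_iff pd_flux)
    show "continuous_on half_plane (\<lambda>p. ?a p * pd2 \<phi> p + (- (2 * snd p / (fst p)\<^sup>2)) * \<phi> p)"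
      by (intro continuous_on_add continuous_on_mult ca tp)
  next
    show "continuous_on half_plane (kin_entropy s h)" "continuous_on half_plane ?e2"
      by (rule continuous_kin)+
  next
    fix p assume "p \<notin> K"
    then show "pd1 flux2 p * \<phi> p = 0" using K(3) by simp
  qed
  have B: "dist_d2 (kin_entropy s h) (\<lambda>p. pd2 flux2 p * \<phi> p) = (LINT p|lebesgue_on half_plane. ?e2 p * (pd2 flux2 p * \<phi> p))"
  proof (rule dist_d2_eq[OF _ _ _ _ _ _ K(1,2), where \<psi>'="\<lambda>p. ?b p * pd2 \<phi> p + (2 / fst p) * \<phi> p"])
    fix p :: "real \<times> real" assume "p \<in> half_plane"
    then have p: "0 < fst p" by (simp add: half_plane_iff)
    show "((\<lambda>s'. kin_entropy s h (fst p, s')) has_real_derivative ?e2 p) (at (snd p))"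
      by (rule kin_entropy_deriv[OF p])
    have "((\<lambda>y. 2 * y / fst p) has_real_derivative 2 / fst p) (at (snd p))"
      using p by (auto intro!: derivative_eq_intros)
    from DERIV_mult[OF this tp(2)[of p]]
    show "((\<lambda>s. pd2 flux2 (fst p, s) * \<phi> (fst p, s)) has_real_derivative
       ?b p * pd2 \<phi> p + (2 / fst p) * \<phi> p) (at (snd p))"
      using p by (simp add: pd_flux algebra_simps)
  next
    show "continuous_on half_plane (\<lambda>p. pd2 flux2 p * \<phi> p)"
      by (rule continuous_on_eq[OF continuous_on_mult[OF ca(2) tp(3)]]) (auto simp: half_plane_iff pd_flux)
    show "continuous_on half_plane (\<lambda>p. ?b p * pd2 \<phi> p + (2 / fst p) * \<phi> p)"
      by (intro continuous_on_add continuous_on_mult ca tp)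
  next
    show "continuous_on half_plane (kin_entropy s h)" "continuous_on half_plane ?e2"
      by (rule continuous_kin)+
  next
    fix p assume "p \<notin> K"
    then show "pd2 flux2 p * \<phi> p = 0" using K(3) by simp
  qed
  have C: "dist_d1 (kin_entropy s h) \<phi> = (LINT p|lebesgue_on half_plane. ?e1 p * \<phi> p)"
    by (rule dist_d1_eq[OF _ _ _ tp(1) tp(3) tp(4) K]) (auto simp: half_plane_iff intro: kin_entropy_deriv continuous_kin)
  have D: "dist_d1 (kin_flux s h) \<phi> = (LINT p|lebesgue_on half_plane. (?e2 p * ?a p) * \<phi> p)"
    by (rule dist_d1_eq[OF _ _ _ tp(1) tp(3) tp(4) K])
      (auto simp: half_plane_iff intro!: kin_flux_deriv(1) s continuous_kin continuous_on_mult ca)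
  have E: "dist_d2 (kin_flux s h) \<phi> = (LINT p|lebesgue_on half_plane. (?e1 p + ?e2 p * ?b p) * \<phi> p)"
  proof (rule dist_d2_eq[OF _ _ _ tp(2) tp(3) tp(5) K])
    show "((\<lambda>y. kin_flux s h (fst p, y)) has_real_derivative ?e1 p + ?e2 p * ?b p) (at (snd p))"
      if "p \<in> half_plane" for p
      using that by (intro kin_flux_deriv(2) s) (simp only: half_plane_iff)
    show "continuous_on half_plane (\<lambda>p. ?e1 p + ?e2 p * ?b p)"
      by (intro continuous_on_add continuous_on_mult continuous_kin ca)
  qed (rule continuous_kin)
  have 0: "dist_d1 (kin_entropy s h) (\<lambda>p. pd1 flux1 p * \<phi> p) = 0"
    unfolding pd_flux dist_d1_def by (simp add: pd1_def)
  have 1: "dist_d1 (kin_entropy s h) (\<lambda>p. pd2 flux1 p * \<phi> p) = dist_d1 (kin_entropy s h) \<phi>"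
    by (simp add: pd_flux)
  show "dist_d1 (kin_flux s h) \<phi> = dist_d1 (kin_entropy s h) (\<lambda>p. pd1 flux1 p * \<phi> p)
      + dist_d2 (kin_entropy s h) (\<lambda>p. pd1 flux2 p * \<phi> p)"
    unfolding A D 0 add_0_left
    by (intro Bochner_Integration.integral_cong) (auto simp: pd_flux half_plane_iff)
  have i: "integrable (lebesgue_on half_plane) (\<lambda>p. ?e1 p * \<phi> p)"
    by (rule half_plane_integral_eq(2)[OF _ K(1,2)]) (use K(3) in \<open>auto intro!: continuous_on_mult continuous_kin tp\<close>)
  have j: "integrable (lebesgue_on half_plane) (\<lambda>p. ?e2 p * (pd2 flux2 p * \<phi> p))"
  proof (rule half_plane_integral_eq(2)[OF _ K(1,2)])
    have "continuous_on half_plane (\<lambda>p. ?e2 p * (?b p * \<phi> p))"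
      by (intro continuous_on_mult continuous_kin ca tp)
    then show "continuous_on half_plane (\<lambda>p. ?e2 p * (pd2 flux2 p * \<phi> p))"
      by (rule continuous_on_eq) (auto simp: half_plane_iff pd_flux)
  qed (use K(3) in auto)
  show "dist_d2 (kin_flux s h) \<phi> = dist_d1 (kin_entropy s h) (\<lambda>p. pd2 flux1 p * \<phi> p)
      + dist_d2 (kin_entropy s h) (\<lambda>p. pd2 flux2 p * \<phi> p)"
    unfolding B E C 1 Bochner_Integration.integral_add[OF i j, symmetric]
    by (intro Bochner_Integration.integral_cong) (auto simp: pd_flux half_plane_iff algebra_simps)
qed

lemma vacuum_limit_of_bound:
  assumes "\<And>M. \<exists>C. \<forall>p. 0 < fst p \<and> fst p \<le> 1 \<and> \<bar>snd p\<bar> \<le> M * fst p \<longrightarrow> \<bar>g p\<bar> \<le> C * fst p"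
  shows "vacuum_limit g 0"
  unfolding vacuum_limit_def
proof
  fix M
  let ?S = "{(\<rho>, m). 0 < \<rho> \<and> \<bar>m\<bar> \<le> M * \<rho>} :: (real \<times> real) set"
  obtain C where C: "\<And>p. 0 < fst p \<Longrightarrow> fst p \<le> 1 \<Longrightarrow> \<bar>snd p\<bar> \<le> M * fst p \<Longrightarrow> \<bar>g p\<bar> \<le> C * fst p"
    using assms[of M] by blast
  have f: "((\<lambda>p. fst p) \<longlongrightarrow> fst ((0::real), (0::real))) (at (0, 0) within ?S)"
    by (intro tendsto_intros)
  have l: "((\<lambda>p::real\<times>real. C * fst p) \<longlongrightarrow> 0) (at (0, 0) within ?S)"
    using tendsto_mult_right_zero[of fst] f by simp
  have "eventually (\<lambda>p. fst p < 1) (at (0, 0) within ?S)"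
    using order_tendstoD(2)[OF f, of 1] by simp
  then have "eventually (\<lambda>p. norm (g p) \<le> C * fst p) (at (0, 0) within ?S)"
    unfolding eventually_at_filter
    by (rule eventually_mono) (auto intro!: C)
  then show "(g \<longlongrightarrow> 0) (at (0, 0) within ?S)"
    by (rule Lim_null_comparison[OF _ l])
qed

lemma lipschitz_of_deriv_bound:
  assumes d: "\<And>y::real. (f has_real_derivative f' y) (at y)" and B: "\<And>y. \<bar>y\<bar> \<le> B \<Longrightarrow> \<bar>f' y\<bar> \<le> C"
    and y: "\<bar>y1\<bar> \<le> B" "\<bar>y2\<bar> \<le> B"
  shows "\<bar>f y2 - f y1\<bar> \<le> C * \<bar>y2 - y1\<bar>"
proof -
  have "norm (f y2 - f y1) \<le> C * norm (y2 - y1)"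
  proof (rule field_differentiable_bound[where S="{-B..B}" and f'=f'])
    show "(f has_field_derivative f' z) (at z within {-B..B})" for z
      using d has_field_derivative_at_within by blast
  qed (use B y in \<open>auto simp: abs_le_iff\<close>)
  then show ?thesis by simp
qed

text \<open>
  The interval of velocities has length \<open>\<rho>\<close> and stays in a bounded set while \<open>m / \<rho>\<close> is bounded.
\<close>

lemma vacuum_limit_kin:
  assumes s: "\<bar>s\<bar> = 1"
  shows "vacuum_limit (kin_entropy s h) 0" "vacuum_limit (kin_flux s h) 0"
proof -
  have B: "\<bar>shifted_invariant s c h p\<bar> \<le> \<bar>M\<bar> + 1 + \<bar>h\<bar>" if "0 < fst p" "fst p \<le> 1" "\<bar>snd p\<bar> \<le> M * fst p" "\<bar>c\<bar> \<le> 1" for c M p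
  proof -
    have "\<bar>s * (snd p / fst p)\<bar> = \<bar>snd p\<bar> / fst p" using that s by (simp add: abs_mult)
    also have "\<dots> \<le> M" using that by (simp add: pos_divide_le_eq)
    finally have 1: "\<bar>s * (snd p / fst p)\<bar> \<le> M" .
    have "\<bar>c * fst p\<bar> \<le> 1 * 1" unfolding abs_mult using that by (intro mult_mono) auto
    with 1 show ?thesis unfolding shifted_invariant_def by linarith
  qed
  have d: "\<bar>shifted_invariant s (1/2) h p - shifted_invariant s (-1/2) h p\<bar> = fst p" if "0 < fst p" for p
    using shifted_invariant_identities(1)[OF that] that by simp
  show "vacuum_limit (kin_entropy s h) 0"
  proof (rule vacuum_limit_of_bound)
    fix M
    let ?B = "\<bar>M\<bar> + 1 + \<bar>h\<bar>"
    have C: "\<bar>max 0 y\<bar> \<le> ?B" if "\<bar>y\<bar> \<le> ?B" for y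
      using that by (auto simp: max_def)
    have "\<bar>kin_entropy s h p\<bar> \<le> ?B * fst p" if p: "0 < fst p" "fst p \<le> 1" "\<bar>snd p\<bar> \<le> M * fst p" for p
    proof -
      have "\<bar>pos_sq (shifted_invariant s (1/2) h p) - pos_sq (shifted_invariant s (-1/2) h p)\<bar> \<le> ?B * \<bar>shifted_invariant s (1/2) h p - shifted_invariant s (-1/2) h p\<bar>"
        by (rule lipschitz_of_deriv_bound[OF pos_sq_deriv, where B="?B"]; intro C B[OF p]) auto
      then show ?thesis using d[OF p(1)] s by (simp add: kin_entropy_def abs_mult)
    qed
    then show "\<exists>C. \<forall>p. 0 < fst p \<and> fst p \<le> 1 \<and> \<bar>snd p\<bar> \<le> M * fst p \<longrightarrow> \<bar>kin_entropy s h p\<bar> \<le> C * fst p"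
      by blast
  qed
  show "vacuum_limit (kin_flux s h) 0"
  proof (rule vacuum_limit_of_bound)
    fix M
    let ?B = "\<bar>M\<bar> + 1 + \<bar>h\<bar>"
    have C: "\<bar>max 0 y * (max 0 y + h)\<bar> \<le> ?B * (?B + \<bar>h\<bar>)" if "\<bar>y\<bar> \<le> ?B" for y
      unfolding abs_mult using that by (intro mult_mono) auto
    have "\<bar>kin_flux s h p\<bar> \<le> (?B * (?B + \<bar>h\<bar>)) * fst p" if p: "0 < fst p" "fst p \<le> 1" "\<bar>snd p\<bar> \<le> M * fst p" for p
    proof -
      have "\<bar>pos_flux h (shifted_invariant s (1/2) h p) - pos_flux h (shifted_invariant s (-1/2) h p)\<bar> \<le> (?B * (?B + \<bar>h\<bar>)) * \<bar>shifted_invariant s (1/2) h p - shifted_invariant s (-1/2) h p\<bar>"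
        by (rule lipschitz_of_deriv_bound[OF pos_flux_deriv, where B="?B"]; intro C B[OF p]) auto
      then show ?thesis using d[OF p(1)] s by (simp add: kin_flux_def abs_mult)
    qed
    then show "\<exists>C. \<forall>p. 0 < fst p \<and> fst p \<le> 1 \<and> \<bar>snd p\<bar> \<le> M * fst p \<longrightarrow> \<bar>kin_flux s h p\<bar> \<le> C * fst p"
      by blast
  qed
qed

section \<open>Mollification\<close>

lemma L1_approx_continuous:
  fixes V :: "'a::euclidean_space \<Rightarrow> real"
  assumes V: "V \<in> borel_measurable borel" "\<And>x. \<bar>V x\<bar> \<le> M" "\<And>x. x \<notin> S \<Longrightarrow> V x = 0" "bounded S" and e: "0 < e"
  obtains g K where "continuous_on UNIV g" "compact K" "\<And>x. x \<notin> K \<Longrightarrow> g x = 0"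
    "(\<integral>x. \<bar>V x - g x\<bar> \<partial>lborel) < e"
proof -
  have M: "0 \<le> M" using V(2)[of undefined] by linarith
  obtain R where R: "\<And>x. x \<in> S \<Longrightarrow> norm x \<le> R" using V(4) bounded_iff by blast
  define \<zeta> where "\<zeta> x = max 0 (min 1 (R + 1 - norm x))" for x :: 'a
  have \<zeta>: "continuous_on UNIV \<zeta>" unfolding \<zeta>_def by (intro continuous_intros)
  have \<zeta>1: "0 \<le> \<zeta> x" "\<zeta> x \<le> 1" "x \<in> S \<Longrightarrow> \<zeta> x = 1" "x \<notin> cball 0 (R + 1) \<Longrightarrow> \<zeta> x = 0" for x
    using R[of x] by (auto simp: \<zeta>_def)
  have "V \<in> borel_measurable (lebesgue_on UNIV)"
    using V(1) by (simp add: lebesgue_on_UNIV_eq measurable_completion)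
  then have "V measurable_on UNIV" by (intro lebesgue_measurable_imp_measurable_on) auto
  then have "\<exists>N h. negligible N \<and> (\<forall>n::nat. continuous_on UNIV (h n)) \<and> (\<forall>x. x \<notin> N \<longrightarrow> (\<lambda>n. h n x) \<longlonglongrightarrow> V x)"
    unfolding measurable_on_def by simp
  then obtain N h where N: "negligible N" and h: "\<And>n::nat. continuous_on UNIV (h n)"
    and lim: "\<And>x. x \<notin> N \<Longrightarrow> (\<lambda>n. h n x) \<longlonglongrightarrow> V x"
    by blast
  \<comment> \<open>Truncation at \<open>M\<close> and the factor \<open>\<zeta>\<close> give an integrable bound for the whole sequence.\<close>
  define g where "g n x = \<zeta> x * max (- M) (min M (h n x))" for n x
  have g: "continuous_on UNIV (g n)" for n
    unfolding g_def by (intro continuous_intros \<zeta> h)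
  have gM: "\<bar>g n x\<bar> \<le> M * indicator (cball 0 (R + 1)) x" for n x
  proof (cases "x \<in> cball 0 (R + 1)")
    case True
    have "\<bar>g n x\<bar> \<le> 1 * M" unfolding g_def abs_mult using \<zeta>1[of x] M by (intro mult_mono) auto
    with True show ?thesis by simp
  qed (use \<zeta>1(4)[of x] in \<open>auto simp: g_def\<close>)
  have VM: "\<bar>V x\<bar> \<le> M * indicator (cball 0 (R + 1)) x" for x
    using V(2,3)[of x] R[of x] by (cases "x \<in> S") (auto simp: indicator_def M)
  have glim: "(\<lambda>n. g n x) \<longlonglongrightarrow> V x" if "x \<notin> N" for x
  proof -
    have "(\<lambda>n. g n x) \<longlonglongrightarrow> \<zeta> x * max (- M) (min M (V x))"
      unfolding g_def by (intro tendsto_intros lim that)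
    also have "\<zeta> x * max (- M) (min M (V x)) = V x"
      using \<zeta>1(3)[of x] V(2,3)[of x] by (cases "x \<in> S") (auto simp: abs_le_iff max_def min_def)
    finally show ?thesis .
  qed
  have [measurable]: "V \<in> borel_measurable borel" "g n \<in> borel_measurable borel" for n
    using V(1) g borel_measurable_continuous_onI by auto
  have "(\<lambda>n. \<integral>x. \<bar>V x - g n x\<bar> \<partial>lborel) \<longlonglongrightarrow> (\<integral>x. 0 \<partial>(lborel :: 'a measure))"
  proof (rule integral_dominated_convergence[where w="\<lambda>x. 2 * M * indicator (cball 0 (R + 1)) x"])
    show "integrable lborel (\<lambda>x. 2 * M * indicator (cball (0::'a) (R + 1)) x)"
      by (intro integrable_mult_right integrable_real_indicator emeasure_bounded_finite bounded_cball) simp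
    have "AE x in lebesgue. x \<notin> N" using N by (intro negligible_imp_AE) simp
    then have "AE x in lebesgue. (\<lambda>n. \<bar>V x - g n x\<bar>) \<longlonglongrightarrow> 0"
    proof (rule eventually_mono)
      fix x assume "x \<notin> N"
      from tendsto_rabs[OF tendsto_diff[OF tendsto_const[of "V x"] glim[OF this]]]
      show "(\<lambda>n. \<bar>V x - g n x\<bar>) \<longlonglongrightarrow> 0" by simp
    qed
    then show "AE x in lborel. (\<lambda>n. \<bar>V x - g n x\<bar>) \<longlonglongrightarrow> 0"
      by (simp add: AE_completion_iff)
    show "AE x in lborel. norm \<bar>V x - g n x\<bar> \<le> 2 * M * indicator (cball 0 (R + 1)) x" for n
    proof (rule AE_I2)
      fix x show "norm \<bar>V x - g n x\<bar> \<le> 2 * M * indicator (cball 0 (R + 1)) x"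
        using VM[of x] gM[of n x] by simp
    qed
  qed auto
  then have "eventually (\<lambda>n. (\<integral>x. \<bar>V x - g n x\<bar> \<partial>lborel) < e) sequentially"
    using e by (intro order_tendstoD) auto
  then obtain n where "(\<integral>x. \<bar>V x - g n x\<bar> \<partial>lborel) < e"
    unfolding eventually_sequentially by blast
  moreover have "g n x = 0" if "x \<notin> cball 0 (R + 1)" for x using \<zeta>1(4)[OF that] by (simp add: g_def)
  ultimately show ?thesis using g[of n] by (intro that[of "g n" "cball 0 (R + 1)"]) auto
qed

definition mollifier :: "real \<Rightarrow> real \<Rightarrow> real" where
  "mollifier \<epsilon> u = bump (u / \<epsilon>) / \<epsilon>"

lemma mollifier_nonneg: "0 < \<epsilon> \<Longrightarrow> 0 \<le> mollifier \<epsilon> u"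
  by (simp add: mollifier_def bump_nonneg)

lemma mollifier_zero: "0 < \<epsilon> \<Longrightarrow> \<epsilon> \<le> \<bar>u\<bar> \<Longrightarrow> mollifier \<epsilon> u = 0"
  by (simp add: mollifier_def bump_zero abs_divide)

lemma continuous_mollifier: "continuous_on S (mollifier \<epsilon>)"
  unfolding mollifier_def divide_inverse
  by (intro continuous_intros continuous_on_compose2[OF bump_continuous[of UNIV]]) auto

lemma step_scaled_deriv:
  assumes "0 < \<epsilon>"
  shows "((\<lambda>u. step (u / \<epsilon>)) has_real_derivative mollifier \<epsilon> u) (at u)"
proof -
  have "((\<lambda>u. u / \<epsilon>) has_real_derivative 1 / \<epsilon>) (at u)"
    using assms by (auto intro!: derivative_eq_intros)
  from DERIV_chain2[OF step_deriv this] show ?thesis by (simp add: mollifier_def)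
qed

lemma mollifier_integral:
  assumes e: "0 < \<epsilon>"
  shows "(\<integral>s. mollifier \<epsilon> (s - t) \<partial>lborel) = 1" "(\<integral>t. mollifier \<epsilon> (s - t) \<partial>lborel) = 1"
proof -
  have c: "isCont (mollifier \<epsilon>) u" for u
    using continuous_mollifier[of UNIV] by (simp add: continuous_on_eq_continuous_at)
  have "(\<integral>u. mollifier \<epsilon> u \<partial>lborel) = (\<integral>u. mollifier \<epsilon> u * indicator {-\<epsilon>..\<epsilon>} u \<partial>lborel)"
    by (intro Bochner_Integration.integral_cong) (auto simp: indicator_def intro!: mollifier_zero[OF e])
  also have "\<dots> = step (\<epsilon> / \<epsilon>) - step ((-\<epsilon>) / \<epsilon>)"
    using e c by (intro integral_FTC_Icc_real step_scaled_deriv) auto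
  also have "\<dots> = 1" using e by (simp add: step_left step_right)
  finally have 1: "(\<integral>u. mollifier \<epsilon> u \<partial>lborel) = 1" .
  show "(\<integral>s. mollifier \<epsilon> (s - t) \<partial>lborel) = 1"
    using lborel_integral_real_affine[of 1 "mollifier \<epsilon>" "-t"] 1 by simp
  show "(\<integral>t. mollifier \<epsilon> (s - t) \<partial>lborel) = 1"
    using lborel_integral_real_affine[of "-1" "mollifier \<epsilon>" s] 1 by simp
qed

definition mollifier2 :: "real \<Rightarrow> real \<times> real \<Rightarrow> real \<times> real \<Rightarrow> real" where
  "mollifier2 \<epsilon> z z' = mollifier \<epsilon> (fst z' - fst z) * mollifier \<epsilon> (snd z' - snd z)"

lemma continuous_mollifier2: "continuous_on S (\<lambda>p. mollifier2 \<epsilon> (fst p) (snd p))"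
  unfolding mollifier2_def
  by (intro continuous_intros continuous_on_compose2[OF continuous_mollifier[of UNIV]]) auto

lemma mollifier2_nonneg: "0 < \<epsilon> \<Longrightarrow> 0 \<le> mollifier2 \<epsilon> z z'"
  by (simp add: mollifier2_def mollifier_nonneg)

lemma mollifier2_near:
  assumes "0 < \<epsilon>" "mollifier2 \<epsilon> z z' \<noteq> 0" shows "dist z z' < 2 * \<epsilon>"
proof -
  have "\<bar>fst z' - fst z\<bar> < \<epsilon>" "\<bar>snd z' - snd z\<bar> < \<epsilon>"
    using assms(2) mollifier_zero[OF assms(1), of "fst z' - fst z"] mollifier_zero[OF assms(1), of "snd z' - snd z"]
    by (auto simp: mollifier2_def not_le[symmetric])
  moreover have "dist z z' \<le> dist (fst z) (fst z') + dist (snd z) (snd z')"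
    unfolding dist_prod_def by (rule sqrt_sum_squares_le_sum) auto
  ultimately show ?thesis by (auto simp: dist_real_def abs_minus_commute)
qed

lemma mollifier2_integral:
  assumes e: "0 < \<epsilon>"
  shows "integrable lborel (\<lambda>z'. mollifier2 \<epsilon> z z')" "(\<integral>z'. mollifier2 \<epsilon> z z' \<partial>lborel) = 1"
    "integrable lborel (\<lambda>z. mollifier2 \<epsilon> z z')" "(\<integral>z. mollifier2 \<epsilon> z z' \<partial>lborel) = 1"
proof -
  have far: "mollifier2 \<epsilon> z z' = 0" if "2 * \<epsilon> \<le> dist z z'" for z z'
    using mollifier2_near[OF e, of z z'] that by force
  have c: "continuous_on UNIV (\<lambda>z'. mollifier2 \<epsilon> z z')" "continuous_on UNIV (\<lambda>z. mollifier2 \<epsilon> z z')" for z z'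
    unfolding mollifier2_def
    by (intro continuous_intros continuous_on_compose2[OF continuous_mollifier[of UNIV]]; simp)+
  show i: "integrable lborel (\<lambda>z'. mollifier2 \<epsilon> z z')" for z
    by (rule integrable_continuous_compact_support[OF c(1), of "cball z (2 * \<epsilon>)"]) (auto intro!: far)
  show j: "integrable lborel (\<lambda>z. mollifier2 \<epsilon> z z')" for z'
    by (rule integrable_continuous_compact_support[OF c(2), of "cball z' (2 * \<epsilon>)"]) (auto intro!: far simp: dist_commute)
  have "integrable (lborel \<Otimes>\<^sub>M lborel) (\<lambda>(a, b). mollifier2 \<epsilon> z (a, b))"
    using i[of z] by (simp add: lborel_prod case_prod_beta')
  from lborel_pair.integral_fst[OF this]
  show "(\<integral>z'. mollifier2 \<epsilon> z z' \<partial>lborel) = 1"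
    by (simp add: lborel_prod mollifier2_def mollifier_integral[OF e] case_prod_beta')
  have "integrable (lborel \<Otimes>\<^sub>M lborel) (\<lambda>(a, b). mollifier2 \<epsilon> (a, b) z')"
    using j[of z'] by (simp add: lborel_prod case_prod_beta')
  from lborel_pair.integral_fst[OF this]
  show "(\<integral>z. mollifier2 \<epsilon> z z' \<partial>lborel) = 1"
    by (simp add: lborel_prod mollifier2_def mollifier_integral[OF e] case_prod_beta')
qed

lemma integrable_tensor_times_continuous:
  fixes U V :: "real \<times> real \<Rightarrow> real"
  assumes U: "U \<in> borel_measurable borel" "\<And>z. \<bar>U z\<bar> \<le> M" "\<And>z. z \<notin> S \<Longrightarrow> U z = 0"
    and V: "V \<in> borel_measurable borel" "\<And>z. \<bar>V z\<bar> \<le> M'" "\<And>z. z \<notin> S' \<Longrightarrow> V z = 0"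
    and S: "bounded S" "bounded S'" and J: "continuous_on UNIV J"
  shows "integrable (lborel \<Otimes>\<^sub>M lborel) (\<lambda>p. (U (fst p) * V (snd p)) * J p)"
  unfolding lborel_prod
proof (rule integrable_bounded_times_continuous[where S="S \<times> S'" and M="M * M'"])
  have "(\<lambda>p. U (fst p)) \<in> borel_measurable borel" "(\<lambda>p. V (snd p)) \<in> borel_measurable borel"
    by (rule measurable_compose[OF _ U(1)] measurable_compose[OF _ V(1)];
        intro borel_measurable_continuous_onI continuous_intros)+
  then show "(\<lambda>p. U (fst p) * V (snd p)) \<in> borel_measurable borel"
    by (rule borel_measurable_times)
  show "\<bar>U (fst x) * V (snd x)\<bar> \<le> M * M'" for x
    unfolding abs_mult using U(2)[of "fst x"] V(2)[of "snd x"] by (intro mult_mono) auto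
  fix x assume "x \<notin> S \<times> S'"
  then have "fst x \<notin> S \<or> snd x \<notin> S'" by (cases x) auto
  then show "U (fst x) * V (snd x) = 0" using U(3)[of "fst x"] V(3)[of "snd x"] by auto
qed (use S J in \<open>auto intro: bounded_Times\<close>)

text \<open>
  It suffices to replace \<open>V z'\<close> by \<open>V z\<close>, as the mollifier has integral one. The error is small because
  \<open>V\<close> is close in \<open>L\<^sup>1\<close> to a uniformly continuous function, and because the mollifier has integral one
  in each of its two arguments.
\<close>

lemma mollification_limit:
  fixes U V :: "real \<times> real \<Rightarrow> real"
  assumes U: "U \<in> borel_measurable borel" "\<And>z. \<bar>U z\<bar> \<le> M" "\<And>z. z \<notin> S \<Longrightarrow> U z = 0"
    and V: "V \<in> borel_measurable borel" "\<And>z. \<bar>V z\<bar> \<le> M'" "\<And>z. z \<notin> S' \<Longrightarrow> V z = 0"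
    and S: "bounded S" "bounded S'"
  shows "((\<lambda>\<epsilon>. \<integral>p. (U (fst p) * V (snd p)) * mollifier2 \<epsilon> (fst p) (snd p) \<partial>(lborel \<Otimes>\<^sub>M lborel))
    \<longlongrightarrow> (\<integral>z. U z * V z \<partial>lborel)) (at_right 0)"
proof (rule tendstoI)
  fix e :: real assume e: "0 < e"
  have M: "0 \<le> M" using U(2)[of "(0, 0)"] by linarith
  have [measurable]: "U \<in> borel_measurable borel" "V \<in> borel_measurable borel" using U V by auto
  have one: "continuous_on UNIV (\<lambda>_::real\<times>real. 1::real)" by simp
  have iU: "integrable lborel (\<lambda>z. \<bar>U z\<bar>)"
    using integrable_bounded_times_continuous[OF U S(1) one] by simp
  define I where "I = (\<integral>z. \<bar>U z\<bar> \<partial>lborel)"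
  have I: "0 \<le> I" unfolding I_def by (rule Bochner_Integration.integral_nonneg) simp
  \<comment> \<open>The error will be at most \<open>2 * M * e1 + I * e2\<close>.\<close>
  define e1 where "e1 = e / (4 * (M + 1))"
  define e2 where "e2 = e / (4 * (I + 1))"
  have pos: "0 < e1" "0 < e2" using e M I by (auto simp: e1_def e2_def)
  have small: "M * e1 \<le> e / 4" "I * e2 \<le> e / 4"
    using e M I by (auto simp: e1_def e2_def field_simps)
  obtain g K where g: "continuous_on UNIV g" "compact K" "\<And>x. x \<notin> K \<Longrightarrow> g x = 0"
    "(\<integral>x. \<bar>V x - g x\<bar> \<partial>lborel) < e1"
    using L1_approx_continuous[OF V S(2) pos(1)] by metis
  have [measurable]: "g \<in> borel_measurable borel" using g(1) by (rule borel_measurable_continuous_onI)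
  obtain B where B: "\<And>x. x \<in> g ` K \<Longrightarrow> norm x \<le> B"
    using compact_imp_bounded[OF compact_continuous_image[OF continuous_on_subset[OF g(1) subset_UNIV] g(2)]]
    unfolding bounded_iff by blast
  have gB: "\<bar>g x\<bar> \<le> \<bar>B\<bar>" for x using B[of "g x"] g(3)[of x] by (cases "x \<in> K") auto
  define W where "W x = \<bar>V x - g x\<bar>" for x
  have W: "W \<in> borel_measurable borel" "\<bar>W z\<bar> \<le> M' + \<bar>B\<bar>" "z \<notin> S' \<union> K \<Longrightarrow> W z = 0" for z
    using V(2)[of z] gB[of z] V(3)[of z] g(3)[of z] by (auto simp: W_def[abs_def])
  have SK: "bounded (S' \<union> K)" using S(2) g(2) by (simp add: compact_imp_bounded)
  have iW: "integrable lborel W"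
    using integrable_bounded_times_continuous[OF W SK one] by simp
  obtain R where R: "\<And>x. x \<in> K \<Longrightarrow> norm x \<le> R" using compact_imp_bounded[OF g(2)] bounded_iff by blast
  have "uniformly_continuous_on (cball 0 (R + 1)) g"
    by (intro compact_uniformly_continuous continuous_on_subset[OF g(1)]) auto
  then obtain d where d: "0 < d"
    "\<And>x y. x \<in> cball 0 (R + 1) \<Longrightarrow> y \<in> cball 0 (R + 1) \<Longrightarrow> dist x y < d \<Longrightarrow> dist (g x) (g y) < e2"
    unfolding uniformly_continuous_on_def using pos(2) by meson
  have gu: "\<bar>g z' - g z\<bar> \<le> e2" if "dist z z' < min d 1" for z z'
  proof (cases "z \<in> K \<or> z' \<in> K")
    case True
    have "norm z' \<le> norm z + dist z z'" "norm z \<le> norm z' + dist z z'"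
      by (metis dist_0_norm dist_triangle add.commute) (metis dist_0_norm dist_triangle dist_commute add.commute)
    then have "norm z \<le> R + 1" "norm z' \<le> R + 1" using True R[of z] R[of z'] that by auto
    then show ?thesis using d(2)[of z z'] that by (auto simp: dist_real_def abs_minus_commute)
  next
    case False
    then show ?thesis using g(3)[of z] g(3)[of z'] pos(2) by simp
  qed
  have "dist (\<integral>p. (U (fst p) * V (snd p)) * mollifier2 \<epsilon> (fst p) (snd p) \<partial>(lborel \<Otimes>\<^sub>M lborel)) (\<integral>z. U z * V z \<partial>lborel) < e"
    if \<epsilon>: "0 < \<epsilon>" "\<epsilon> < min d 1 / 2" for \<epsilon>
  proof -
    let ?j = "\<lambda>p. mollifier2 \<epsilon> (fst p) (snd p)"
    have cj: "continuous_on UNIV ?j" by (rule continuous_mollifier2)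
    have j0: "0 \<le> mollifier2 \<epsilon> z z'" for z z' by (rule mollifier2_nonneg[OF \<epsilon>(1)])
    let ?P = "lborel \<Otimes>\<^sub>M lborel :: ((real \<times> real) \<times> (real \<times> real)) measure"
    have UV: "(\<lambda>z. U z * V z) \<in> borel_measurable borel" "\<bar>U z * V z\<bar> \<le> M * M'" "z \<notin> S \<Longrightarrow> U z * V z = 0" for z
      using U(2)[of z] V(2)[of z] U(3)[of z] by (auto simp: abs_mult intro!: mult_mono)
    have absU: "(\<lambda>z. \<bar>U z\<bar>) \<in> borel_measurable borel" "\<bar>\<bar>U z\<bar>\<bar> \<le> M" "z \<notin> S \<Longrightarrow> \<bar>U z\<bar> = 0" for z
      using U by auto
    have absUW: "(\<lambda>z. \<bar>U z\<bar> * W z) \<in> borel_measurable borel" "\<bar>\<bar>U z\<bar> * W z\<bar> \<le> M * (M' + \<bar>B\<bar>)" "z \<notin> S \<Longrightarrow> \<bar>U z\<bar> * W z = 0" for z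
      using U(2)[of z] W(1) W(2)[of z] U(3)[of z] by (auto simp: abs_mult intro!: mult_mono)
    \<comment> \<open>The mollifier links points of \<open>S\<close> only to points of this bounded set.\<close>
    let ?D = "{z :: real \<times> real. dist 0 z \<le> 1 + \<bar>SOME r. \<forall>z\<in>S. norm z \<le> r\<bar>}"
    have inS: "norm z \<le> (SOME r. \<forall>z\<in>S. norm z \<le> r)" if "z \<in> S" for z
      using someI_ex[of "\<lambda>r. \<forall>z\<in>S. norm z \<le> r"] S(1) that unfolding bounded_iff by blast
    have D: "z' \<in> ?D" if "z \<in> S" "mollifier2 \<epsilon> z z' \<noteq> 0" for z z'
    proof -
      have "dist z z' < 1" using mollifier2_near[OF \<epsilon>(1) that(2)] \<epsilon>(2) by linarith
      moreover have "norm z' \<le> norm z + dist z z'" by (metis dist_0_norm dist_triangle)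
      ultimately show ?thesis using inS[OF that(1)] by auto
    qed
    have bD: "bounded ?D" using bounded_cball[of "0::real\<times>real"] by (simp add: cball_def)
    have mD: "(indicator ?D :: real \<times> real \<Rightarrow> real) \<in> borel_measurable borel"
      using closed_cball[of "0::real\<times>real"] by (intro borel_measurable_indicator borel_closed) (simp add: cball_def)
    have iD: "\<bar>indicator ?D z :: real\<bar> \<le> 1" "z \<notin> ?D \<Longrightarrow> indicator ?D z = (0::real)" for z
      by (auto simp: indicator_def)
    have i_1D: "integrable ?P (\<lambda>p. (f (fst p) * indicator ?D (snd p)) * ?j p)"
      if "f \<in> borel_measurable borel" "\<And>z. \<bar>f z\<bar> \<le> MM" "\<And>z. z \<notin> S \<Longrightarrow> f z = 0" for f MM
      by (rule integrable_tensor_times_continuous[OF that mD iD S(1) bD cj])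
    have drop: "(f (fst p) * indicator ?D (snd p)) * ?j p = f (fst p) * ?j p" if "\<And>z. z \<notin> S \<Longrightarrow> f z = 0" for f :: "real \<times> real \<Rightarrow> real" and p
      using D[of "fst p" "snd p"] that[of "fst p"] by (cases "fst p \<in> S"; cases "?j p = 0") (auto simp: indicator_def)
    have i1: "integrable ?P (\<lambda>p. f (fst p) * ?j p)"
      if "f \<in> borel_measurable borel" "\<And>z. \<bar>f z\<bar> \<le> MM" "\<And>z. z \<notin> S \<Longrightarrow> f z = 0" for f MM
    proof -
      have "(\<lambda>p. (f (fst p) * indicator ?D (snd p)) * ?j p) = (\<lambda>p. f (fst p) * ?j p)"
        by (rule ext, rule drop, rule that(3))
      moreover have "integrable ?P (\<lambda>p. (f (fst p) * indicator ?D (snd p)) * ?j p)"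
        by (rule i_1D[of f MM]; rule that; assumption?)
      ultimately show ?thesis by simp
    qed
    have int1: "(\<integral>p. f (fst p) * ?j p \<partial>?P) = (\<integral>z. f z \<partial>lborel)"
      if "f \<in> borel_measurable borel" "\<And>z. \<bar>f z\<bar> \<le> MM" "\<And>z. z \<notin> S \<Longrightarrow> f z = 0" for f MM
    proof -
      have "integrable ?P (\<lambda>(z, z'). f z * mollifier2 \<epsilon> z z')"
        using i1[of f MM] that by (simp add: case_prod_beta' del: split_paired_All)
      from lborel_pair.integral_fst[OF this] show ?thesis
        by (simp add: case_prod_beta' mollifier2_integral[OF \<epsilon>(1)])
    qed
    have iUV: "integrable ?P (\<lambda>p. (U (fst p) * V (snd p)) * ?j p)"
      by (rule integrable_tensor_times_continuous[OF U V S cj])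
    have iUW: "integrable ?P (\<lambda>p. (\<bar>U (fst p)\<bar> * W (snd p)) * ?j p)"
      by (rule integrable_tensor_times_continuous[OF absU W S(1) SK cj])
    have w: "(\<integral>p. (\<bar>U (fst p)\<bar> * W (snd p)) * ?j p \<partial>?P) \<le> M * (\<integral>z. W z \<partial>lborel)"
    proof -
      have "integrable ?P (\<lambda>(z, z'). (\<bar>U z\<bar> * W z') * mollifier2 \<epsilon> z z')"
        using iUW by (simp add: case_prod_beta')
      from lborel_pair.integral_snd[OF this]
      have "(\<integral>p. (\<bar>U (fst p)\<bar> * W (snd p)) * ?j p \<partial>?P) = (\<integral>z'. \<integral>z. (\<bar>U z\<bar> * W z') * mollifier2 \<epsilon> z z' \<partial>lborel \<partial>lborel)"
        by (simp add: case_prod_beta')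
      also have "\<dots> \<le> (\<integral>z'. M * W z' \<partial>lborel)"
      proof (rule integral_mono')
        show "integrable lborel (\<lambda>z'. M * W z')" using iW by simp
        fix z' 
        have W0: "0 \<le> W z'" by (simp add: W_def)
        have "(\<integral>z. (\<bar>U z\<bar> * W z') * mollifier2 \<epsilon> z z' \<partial>lborel) \<le> (\<integral>z. (M * W z') * mollifier2 \<epsilon> z z' \<partial>lborel)"
        proof (rule integral_mono')
          show "integrable lborel (\<lambda>z. (M * W z') * mollifier2 \<epsilon> z z')"
            by (intro integrable_mult_right mollifier2_integral(3) \<epsilon>(1))
        qed (intro mult_right_mono mult_nonneg_nonneg U(2) W0 j0 M)+
        then show "(\<integral>z. (\<bar>U z\<bar> * W z') * mollifier2 \<epsilon> z z' \<partial>lborel) \<le> M * W z'"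
          by (simp add: mollifier2_integral[OF \<epsilon>(1)])
        show "0 \<le> M * W z'" using M W0 by simp
      qed
      finally show ?thesis by simp
    qed
    have pw: "\<bar>(U (fst p) * V (snd p)) * ?j p - (U (fst p) * V (fst p)) * ?j p\<bar>
        \<le> (\<bar>U (fst p)\<bar> * W (snd p)) * ?j p + e2 * (\<bar>U (fst p)\<bar> * ?j p) + (\<bar>U (fst p)\<bar> * W (fst p)) * ?j p" for p
    proof (cases "?j p = 0")
      case False
      then have "dist (fst p) (snd p) < min d 1" using mollifier2_near[OF \<epsilon>(1) False] \<epsilon>(2) by linarith
      from gu[OF this] have "\<bar>V (snd p) - V (fst p)\<bar> \<le> W (snd p) + e2 + W (fst p)"
        unfolding W_def by linarith
      then have "(\<bar>U (fst p)\<bar> * ?j p) * \<bar>V (snd p) - V (fst p)\<bar> \<le> (\<bar>U (fst p)\<bar> * ?j p) * (W (snd p) + e2 + W (fst p))"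
        using j0 by (intro mult_left_mono) auto
      moreover have "\<bar>(U (fst p) * V (snd p)) * ?j p - (U (fst p) * V (fst p)) * ?j p\<bar>
         = (\<bar>U (fst p)\<bar> * ?j p) * \<bar>V (snd p) - V (fst p)\<bar>"
        using j0[of "fst p" "snd p"] by (simp add: abs_mult[symmetric] left_diff_distrib[symmetric] right_diff_distrib[symmetric] abs_mult mult_ac)
      ultimately show ?thesis by (simp add: algebra_simps)
    qed simp
    have "\<bar>(\<integral>p. (U (fst p) * V (snd p)) * ?j p \<partial>?P) - (\<integral>z. U z * V z \<partial>lborel)\<bar>
       = \<bar>\<integral>p. (U (fst p) * V (snd p)) * ?j p - (U (fst p) * V (fst p)) * ?j p \<partial>?P\<bar>"
      using Bochner_Integration.integral_diff[OF iUV i1[OF UV]] int1[OF UV] by simp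
    also have "\<dots> \<le> (\<integral>p. \<bar>(U (fst p) * V (snd p)) * ?j p - (U (fst p) * V (fst p)) * ?j p\<bar> \<partial>?P)"
      by (rule integral_abs_bound)
    also have "\<dots> \<le> (\<integral>p. (\<bar>U (fst p)\<bar> * W (snd p)) * ?j p + e2 * (\<bar>U (fst p)\<bar> * ?j p) + (\<bar>U (fst p)\<bar> * W (fst p)) * ?j p \<partial>?P)"
    proof (rule integral_mono')
      show "integrable ?P (\<lambda>p. (\<bar>U (fst p)\<bar> * W (snd p)) * ?j p + e2 * (\<bar>U (fst p)\<bar> * ?j p) + (\<bar>U (fst p)\<bar> * W (fst p)) * ?j p)"
        by (intro Bochner_Integration.integrable_add iUW integrable_mult_right i1[OF absU] i1[OF absUW])
      show "0 \<le> (\<bar>U (fst p)\<bar> * W (snd p)) * ?j p + e2 * (\<bar>U (fst p)\<bar> * ?j p) + (\<bar>U (fst p)\<bar> * W (fst p)) * ?j p" for p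
        using pw[of p] by linarith
    qed (rule pw)
    also have "\<dots> = (\<integral>p. (\<bar>U (fst p)\<bar> * W (snd p)) * ?j p \<partial>?P) + e2 * I + (\<integral>z. \<bar>U z\<bar> * W z \<partial>lborel)"
    proof -
      have iB: "integrable ?P (\<lambda>p. e2 * (\<bar>U (fst p)\<bar> * ?j p))"
        by (intro integrable_mult_right i1[OF absU])
      have iC: "integrable ?P (\<lambda>p. (\<bar>U (fst p)\<bar> * W (fst p)) * ?j p)"
        by (intro i1[OF absUW])
      have vB: "(\<integral>p. \<bar>U (fst p)\<bar> * ?j p \<partial>?P) = I"
        using int1[OF absU] by (simp add: I_def)
      have vC: "(\<integral>p. (\<bar>U (fst p)\<bar> * W (fst p)) * ?j p \<partial>?P) = (\<integral>z. \<bar>U z\<bar> * W z \<partial>lborel)"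
        using int1[OF absUW] by simp
      show ?thesis
        unfolding Bochner_Integration.integral_add[OF Bochner_Integration.integrable_add[OF iUW iB] iC]
          Bochner_Integration.integral_add[OF iUW iB] vC integral_mult_right_zero vB ..
    qed
    also have "(\<integral>z. \<bar>U z\<bar> * W z \<partial>lborel) \<le> M * (\<integral>z. W z \<partial>lborel)"
    proof -
      have "(\<integral>z. \<bar>U z\<bar> * W z \<partial>lborel) \<le> (\<integral>z. M * W z \<partial>lborel)"
      proof (rule integral_mono')
        show "integrable lborel (\<lambda>z. M * W z)" using iW by simp
        have W0: "0 \<le> W z" for z by (simp add: W_def)
        show "\<bar>U z\<bar> * W z \<le> M * W z" "0 \<le> M * W z" for z
          by (intro mult_right_mono mult_nonneg_nonneg U(2) W0 M)+
      qed
      then show ?thesis by simp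
    qed
    also note w
    finally have "\<bar>(\<integral>p. (U (fst p) * V (snd p)) * ?j p \<partial>?P) - (\<integral>z. U z * V z \<partial>lborel)\<bar>
       \<le> M * (\<integral>z. W z \<partial>lborel) + e2 * I + M * (\<integral>z. W z \<partial>lborel)" by simp
    moreover have "M * (\<integral>z. W z \<partial>lborel) \<le> M * e1"
      using M g(4) by (intro mult_left_mono) (auto simp: W_def)
    ultimately show ?thesis using small e by (simp add: dist_real_def mult.commute)
  qed
  then show "eventually (\<lambda>\<epsilon>. dist (\<integral>p. (U (fst p) * V (snd p)) * mollifier2 \<epsilon> (fst p) (snd p) \<partial>(lborel \<Otimes>\<^sub>M lborel)) (\<integral>z. U z * V z \<partial>lborel) < e) (at_right 0)"
    unfolding eventually_at_right_field using d(1) by (intro exI[of _ "min d 1 / 2"]) auto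
qed

section \<open>Interaction of dissipative pairs\<close>

text \<open>
  Density and flux of a nonnegative quantity that is not created in \<open>\<Omega>\<close> and moves with speed at most
  \<open>\<Lambda>\<close>. Both are extended by zero, but test functions must be supported in \<open>\<Omega>\<close>.
\<close>

definition dissipative_pair ::
    "(real \<times> real) set \<Rightarrow> real \<Rightarrow> real \<Rightarrow> (real \<times> real \<Rightarrow> real) \<Rightarrow> (real \<times> real \<Rightarrow> real) \<Rightarrow> bool" where
  "dissipative_pair \<Omega> \<Lambda> M A B \<longleftrightarrow>
     A \<in> borel_measurable borel \<and> B \<in> borel_measurable borel \<and>
     (\<forall>p. 0 \<le> A p \<and> A p \<le> M \<and> \<bar>B p\<bar> \<le> \<Lambda> * A p) \<and> (\<forall>p. p \<notin> \<Omega> \<longrightarrow> A p = 0) \<and>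
     (\<forall>\<phi> K. (\<forall>k. Ck k \<phi>) \<and> (\<forall>p. 0 \<le> \<phi> p) \<and> compact K \<and> K \<subseteq> \<Omega> \<and> (\<forall>p. p \<notin> K \<longrightarrow> \<phi> p = 0) \<longrightarrow>
        0 \<le> (\<integral>p. A p * pd1 \<phi> p + B p * pd2 \<phi> p \<partial>lborel))"

text \<open>
  The weight does not increase in time along any path of speed at most \<open>\<Lambda>\<close>. Therefore multiplication by it
  preserves dissipative pairs (\<open>cone_cutoff_sign\<close>).
\<close>

definition cone_cutoff :: "real \<Rightarrow> (real \<times> real \<Rightarrow> real) \<Rightarrow> bool" where
  "cone_cutoff \<Lambda> \<Phi> \<longleftrightarrow> (\<forall>k. Ck k \<Phi>) \<and> (\<forall>p. 0 \<le> \<Phi> p) \<and> (\<forall>p. pd1 \<Phi> p + \<Lambda> * \<bar>pd2 \<Phi> p\<bar> \<le> 0)"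

lemma dissipative_pairD:
  assumes "dissipative_pair \<Omega> \<Lambda> M A B"
  shows "A \<in> borel_measurable borel" "B \<in> borel_measurable borel"
    "0 \<le> A p" "\<bar>A p\<bar> \<le> M" "\<bar>B p\<bar> \<le> \<bar>\<Lambda>\<bar> * M" "\<bar>B p\<bar> \<le> \<Lambda> * A p" "p \<notin> \<Omega> \<Longrightarrow> A p = 0" "p \<notin> \<Omega> \<Longrightarrow> B p = 0"
proof -
  show *: "A \<in> borel_measurable borel" "B \<in> borel_measurable borel"
    "0 \<le> A p" "\<bar>A p\<bar> \<le> M" "\<bar>B p\<bar> \<le> \<Lambda> * A p" "p \<notin> \<Omega> \<Longrightarrow> A p = 0" for p
    using assms unfolding dissipative_pair_def by (auto simp del: split_paired_All)
  have "\<Lambda> * A p \<le> \<bar>\<Lambda>\<bar> * A p" using *(3) by (intro mult_right_mono) auto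
  also have "\<dots> \<le> \<bar>\<Lambda>\<bar> * M" using *(3,4)[of p] by (intro mult_left_mono) auto
  finally show "\<bar>B p\<bar> \<le> \<bar>\<Lambda>\<bar> * M" using *(5)[of p] by linarith
  show "p \<notin> \<Omega> \<Longrightarrow> B p = 0" using *(5)[of p] *(6)[of p] by simp
qed

lemma dissipative_pair_weak:
  assumes "dissipative_pair \<Omega> \<Lambda> M A B" "\<And>k. Ck k \<phi>" "\<And>p. 0 \<le> \<phi> p" "compact K" "K \<subseteq> \<Omega>" "\<And>p. p \<notin> K \<Longrightarrow> \<phi> p = 0"
  shows "0 \<le> (\<integral>p. A p * pd1 \<phi> p + B p * pd2 \<phi> p \<partial>lborel)"
  using assms unfolding dissipative_pair_def by blast

lemma cone_cutoff_sign:
  assumes "dissipative_pair \<Omega> \<Lambda> M A B" "cone_cutoff \<Lambda> \<Phi>"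
  shows "A p * pd1 \<Phi> p + B p * pd2 \<Phi> p \<le> 0"
proof -
  have "B p * pd2 \<Phi> p \<le> \<bar>B p\<bar> * \<bar>pd2 \<Phi> p\<bar>" by (metis abs_ge_self abs_mult)
  also have "\<dots> \<le> \<Lambda> * A p * \<bar>pd2 \<Phi> p\<bar>" using dissipative_pairD(6)[OF assms(1)] by (intro mult_right_mono) auto
  finally have "A p * pd1 \<Phi> p + B p * pd2 \<Phi> p \<le> A p * (pd1 \<Phi> p + \<Lambda> * \<bar>pd2 \<Phi> p\<bar>)"
    by (simp add: algebra_simps)
  also have "\<dots> \<le> 0"
  proof (rule mult_nonneg_nonpos[OF dissipative_pairD(3)[OF assms(1)]])
    show "pd1 \<Phi> p + \<Lambda> * \<bar>pd2 \<Phi> p\<bar> \<le> 0" using assms(2) unfolding cone_cutoff_def by blast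
  qed
  finally show ?thesis by simp
qed

lemma smooth_mollifier: "smooth (mollifier \<epsilon>)"
  using smooth_mult[OF smooth_affine[OF smooth_bump, of "1/\<epsilon>" 0] smooth_const[of "1/\<epsilon>"]]
  by (simp add: mollifier_def[abs_def])

lemma smooth_scaled_step: "smooth (\<lambda>u. step (u / \<epsilon>))"
  using smooth_affine[OF smooth_step, of "1/\<epsilon>" 0] by simp

lemma Ck_fst: "smooth f \<Longrightarrow> Ck k (\<lambda>p. f (fst p - t))"
  using Ck_smooth_affine[of f k 1 0 "-t"] by simp

lemma Ck_fst': "smooth f \<Longrightarrow> Ck k (\<lambda>p. f (t - fst p))"
  using Ck_smooth_affine[of f k "-1" 0 t] by simp

lemma Ck_snd: "smooth f \<Longrightarrow> Ck k (\<lambda>p. f (snd p - t))"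
  using Ck_smooth_affine[of f k 0 1 "-t"] by simp

lemma Ck_snd': "smooth f \<Longrightarrow> Ck k (\<lambda>p. f (t - snd p))"
  using Ck_smooth_affine[of f k 0 "-1" t] by simp

lemma integrable_dissipative:
  assumes "dissipative_pair \<Omega> \<Lambda> M A B" "bounded \<Omega>" "continuous_on UNIV g"
  shows "integrable lborel (\<lambda>p. A p * g p)" "integrable lborel (\<lambda>p. B p * g p)"
  using dissipative_pairD[OF assms(1)] assms(2,3)
  by (auto intro!: integrable_bounded_times_continuous[where S=\<Omega>] simp del: split_paired_All split_paired_all)

text \<open>
  The weighted amount of \<open>C\<close> at a time \<open>t\<close> is at most its average over an earlier window around \<open>a\<close>.
  Both are expressed with mollifiers in time, because \<open>C\<close> has no values on time slices.
\<close>

lemma window_bound: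
  assumes d: "dissipative_pair \<Omega> \<Lambda> M C D" and \<Omega>: "bounded \<Omega>" and \<Phi>: "cone_cutoff \<Lambda> \<Phi>"
    and K: "compact K" "K \<subseteq> \<Omega>" "\<And>t x. T0 \<le> t \<Longrightarrow> t \<le> T3 \<Longrightarrow> \<Phi> (t, x) \<noteq> 0 \<Longrightarrow> (t, x) \<in> K"
    and b: "0 < b" "0 < \<epsilon>" "T0 \<le> a - b" "a + b \<le> t - \<epsilon>" "t + \<epsilon> \<le> T3"
  shows "(\<integral>p. C p * (\<Phi> p * mollifier \<epsilon> (fst p - t)) \<partial>lborel) \<le> (\<integral>p. C p * (\<Phi> p * mollifier b (fst p - a)) \<partial>lborel)"
proof -
  \<comment> \<open>The profile rises from 0 to 1 around \<open>a\<close> and falls back to 0 around \<open>t\<close>.\<close>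
  define \<zeta> where "\<zeta> u = step ((u - a) / b) + (-1) * step ((u - t) / \<epsilon>)" for u
  define \<zeta>' where "\<zeta>' u = mollifier b (u - a) - mollifier \<epsilon> (u - t)" for u
  define \<phi> where "\<phi> p = \<Phi> p * \<zeta> (fst p)" for p
  have C\<Phi>: "\<And>k. Ck k \<Phi>" and \<Phi>0: "\<And>p. 0 \<le> \<Phi> p" using \<Phi> unfolding cone_cutoff_def by blast+
  note P = Ck_partials[OF C\<Phi>]
  have \<zeta>0: "0 \<le> \<zeta> u" for u
  proof (cases "u \<le> t - \<epsilon>")
    case True
    then have "step ((u - t) / \<epsilon>) = 0" using b by (intro step_left) (simp add: pos_divide_le_eq)
    then show ?thesis by (simp add: \<zeta>_def step_nonneg)
  next
    case False
    then have "step ((u - a) / b) = 1" using b by (intro step_right) (simp add: pos_le_divide_eq)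
    then show ?thesis using step_le_1 by (simp add: \<zeta>_def)
  qed
  have \<zeta>z: "\<zeta> u = 0" if "u < T0 \<or> T3 < u" for u
  proof (cases "u < T0")
    case True
    then have "step ((u - a) / b) = 0" "step ((u - t) / \<epsilon>) = 0"
      using b by (auto intro!: step_left simp: pos_divide_le_eq)
    then show ?thesis by (simp add: \<zeta>_def)
  next
    case False
    then have "step ((u - a) / b) = 1" "step ((u - t) / \<epsilon>) = 1"
      using b that by (auto intro!: step_right simp: pos_le_divide_eq)
    then show ?thesis by (simp add: \<zeta>_def)
  qed
  have d\<zeta>: "(\<zeta> has_real_derivative \<zeta>' u) (at u)" for u
  proof -
    have sh: "((\<lambda>u. u - c) has_real_derivative 1) (at u)" for c by (auto intro!: derivative_eq_intros)
    show ?thesis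
      unfolding \<zeta>_def \<zeta>'_def
      by (rule DERIV_cong[OF DERIV_add[OF DERIV_chain2[OF step_scaled_deriv[OF b(1)] sh]
            DERIV_cmult[OF DERIV_chain2[OF step_scaled_deriv[OF b(2)] sh]]]]) simp
  qed
  have c\<zeta>: "continuous_on UNIV (\<lambda>p::real\<times>real. \<zeta> (fst p))" "continuous_on UNIV (\<lambda>p::real\<times>real. \<zeta>' (fst p))"
    "continuous_on UNIV (\<lambda>p::real\<times>real. mollifier b (fst p - a))" "continuous_on UNIV (\<lambda>p::real\<times>real. mollifier \<epsilon> (fst p - t))"
  proof -
    show 1: "continuous_on UNIV (\<lambda>p::real\<times>real. mollifier b (fst p - a))" "continuous_on UNIV (\<lambda>p::real\<times>real. mollifier \<epsilon> (fst p - t))"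
      by (intro continuous_on_compose2[OF continuous_mollifier[of UNIV]] continuous_intros; simp)+
    show "continuous_on UNIV (\<lambda>p::real\<times>real. \<zeta>' (fst p))" unfolding \<zeta>'_def by (intro continuous_intros 1)
    have cz: "continuous_on UNIV \<zeta>"
      by (intro continuous_at_imp_continuous_on ballI DERIV_isCont[OF d\<zeta>])
    show "continuous_on UNIV (\<lambda>p::real\<times>real. \<zeta> (fst p))"
      by (rule continuous_on_compose2[OF cz continuous_on_fst[OF continuous_on_id] subset_UNIV])
  qed
  have "0 \<le> (\<integral>p. C p * pd1 \<phi> p + D p * pd2 \<phi> p \<partial>lborel)"
  proof (rule dissipative_pair_weak[OF d _ _ K(1,2)])
    show "Ck k \<phi>" for k
      unfolding \<phi>_def \<zeta>_def by (intro Ck_mult C\<Phi> Ck_add Ck_const Ck_fst[OF smooth_scaled_step])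
    show "0 \<le> \<phi> p" for p unfolding \<phi>_def by (intro mult_nonneg_nonneg \<Phi>0 \<zeta>0)
    show "\<phi> p = 0" if "p \<notin> K" for p
      using that K(3)[of "fst p" "snd p"] \<zeta>z[of "fst p"] unfolding \<phi>_def by (cases p) fastforce
  qed
  also have "(\<lambda>p. C p * pd1 \<phi> p + D p * pd2 \<phi> p) =
      (\<lambda>p. (C p * pd1 \<Phi> p + D p * pd2 \<Phi> p) * \<zeta> (fst p) + C p * (\<Phi> p * \<zeta>' (fst p)))"
  proof
    fix p
    have "pd1 \<phi> p = pd1 \<Phi> p * \<zeta> (fst p) + \<zeta>' (fst p) * \<Phi> p"
      using DERIV_mult[OF P(1)[of p] d\<zeta>[of "fst p"]] by - (rule pd1_eq, simp add: \<phi>_def)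
    moreover have "pd2 \<phi> p = pd2 \<Phi> p * \<zeta> (fst p)"
      using DERIV_mult[OF P(2)[of p] DERIV_const[of "\<zeta> (fst p)"]] by - (rule pd2_eq, simp add: \<phi>_def)
    ultimately show "C p * pd1 \<phi> p + D p * pd2 \<phi> p =
        (C p * pd1 \<Phi> p + D p * pd2 \<Phi> p) * \<zeta> (fst p) + C p * (\<Phi> p * \<zeta>' (fst p))"
      by (simp add: algebra_simps)
  qed
  also have "(\<integral>p. (C p * pd1 \<Phi> p + D p * pd2 \<Phi> p) * \<zeta> (fst p) + C p * (\<Phi> p * \<zeta>' (fst p)) \<partial>lborel)
      \<le> (\<integral>p. C p * (\<Phi> p * \<zeta>' (fst p)) \<partial>lborel)"
  proof (rule integral_mono)
    show i: "integrable lborel (\<lambda>p. C p * (\<Phi> p * \<zeta>' (fst p)))"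
      by (rule integrable_dissipative[OF d \<Omega>]) (intro continuous_intros P c\<zeta>)
    have "integrable lborel (\<lambda>p. (C p * (pd1 \<Phi> p * \<zeta> (fst p)) + D p * (pd2 \<Phi> p * \<zeta> (fst p))) + C p * (\<Phi> p * \<zeta>' (fst p)))"
      by (intro Bochner_Integration.integrable_add i integrable_dissipative[OF d \<Omega>] continuous_intros P c\<zeta>)
    then show "integrable lborel (\<lambda>p. (C p * pd1 \<Phi> p + D p * pd2 \<Phi> p) * \<zeta> (fst p) + C p * (\<Phi> p * \<zeta>' (fst p)))"
      by (simp add: algebra_simps)
    show "(C p * pd1 \<Phi> p + D p * pd2 \<Phi> p) * \<zeta> (fst p) + C p * (\<Phi> p * \<zeta>' (fst p)) \<le> C p * (\<Phi> p * \<zeta>' (fst p))" for p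
      using mult_nonpos_nonneg[OF cone_cutoff_sign[OF d \<Phi>, of p] \<zeta>0[of "fst p"]] by simp
  qed
  also have "\<dots> = (\<integral>p. C p * (\<Phi> p * mollifier b (fst p - a)) - C p * (\<Phi> p * mollifier \<epsilon> (fst p - t)) \<partial>lborel)"
    by (simp add: \<zeta>'_def algebra_simps)
  also have "\<dots> = (\<integral>p. C p * (\<Phi> p * mollifier b (fst p - a)) \<partial>lborel) - (\<integral>p. C p * (\<Phi> p * mollifier \<epsilon> (fst p - t)) \<partial>lborel)"
    by (intro Bochner_Integration.integral_diff integrable_dissipative[OF d \<Omega>] continuous_intros P c\<zeta>)
  finally show ?thesis by simp
qed

text \<open>
  Both inequalities are tested with \<open>\<Phi>(z) \<Phi>(z') \<theta>(t) k(t' - t) H(x' - x)\<close>, one in \<open>z = (t, x)\<close> with the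
  weight \<open>C(z')\<close>, the other in \<open>z' = (t', x')\<close> with the weight \<open>A(z)\<close>. Here \<open>k\<close> approximates the point
  mass at 0 and \<open>H\<close> the indicator of the positive numbers, so that this is the interaction integral
  over \<open>x < x'\<close> at equal times. In the sum the derivatives of \<open>k\<close> cancel, those of \<open>\<Phi>\<close> have a sign, that
  of \<open>\<theta>\<close> is bounded by \<open>\<kappa>\<close>, and that of \<open>H\<close> leaves the integrand \<open>A D - B C\<close> near the diagonal.
\<close>

lemma doubled_inequality:
  fixes A B C D \<Phi> \<theta> :: "_ \<Rightarrow> real"
  assumes dA: "dissipative_pair \<Omega> \<Lambda> M A B" and dC: "dissipative_pair \<Omega> \<Lambda> M' C D"
    and \<Omega>: "bounded \<Omega>" and \<Phi>: "cone_cutoff \<Lambda> \<Phi>"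
    and K: "compact K" "K \<subseteq> \<Omega>" "\<And>t x. T0 \<le> t \<Longrightarrow> t \<le> T3 \<Longrightarrow> \<Phi> (t, x) \<noteq> 0 \<Longrightarrow> (t, x) \<in> K"
    and \<theta>: "smooth \<theta>" "\<And>t. (\<theta> has_real_derivative \<theta>' t) (at t)" "smooth \<theta>'" "\<And>t. 0 \<le> \<theta> t" "\<And>t. t < T1 \<or> T2 < t \<Longrightarrow> \<theta> t = 0"
      "\<And>t. \<theta>' t \<le> \<kappa> t" "continuous_on UNIV \<kappa>" "\<And>t. 0 \<le> \<kappa> t"
    and \<epsilon>: "0 < \<epsilon>" "T0 \<le> T1 - \<epsilon>" "T2 + \<epsilon> \<le> T3"
  shows "(\<integral>p. (B (fst p) * C (snd p)) * (\<Phi> (fst p) * \<Phi> (snd p) * \<theta> (fst (fst p)) * mollifier2 \<epsilon> (fst p) (snd p))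
       - (A (fst p) * D (snd p)) * (\<Phi> (fst p) * \<Phi> (snd p) * \<theta> (fst (fst p)) * mollifier2 \<epsilon> (fst p) (snd p)) \<partial>(lborel \<Otimes>\<^sub>M lborel))
    \<le> (\<integral>p. (A (fst p) * C (snd p)) * (\<Phi> (fst p) * \<Phi> (snd p) * \<kappa> (fst (fst p)) * mollifier \<epsilon> (fst (snd p) - fst (fst p))) \<partial>(lborel \<Otimes>\<^sub>M lborel))"
proof -
  define k where "k = mollifier \<epsilon>"
  obtain k' where k': "\<And>u. (k has_real_derivative k' u) (at u)" "smooth k'"
    using smooth_derivE[OF smooth_mollifier[of \<epsilon>]] unfolding k_def by metis
  define H where "H u = step (u / \<epsilon>)" for u
  have H: "(H has_real_derivative k u) (at u)" "smooth H" "0 \<le> H u" "H u \<le> 1" for u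
    unfolding H_def k_def using step_scaled_deriv[OF \<epsilon>(1)] smooth_scaled_step step_nonneg step_le_1 by auto
  have k0: "0 \<le> k u" for u by (simp add: k_def mollifier_nonneg[OF \<epsilon>(1)])
  have smk: "smooth k" by (simp add: k_def smooth_mollifier)
  have C\<Phi>: "\<And>k. Ck k \<Phi>" and \<Phi>0: "\<And>p. 0 \<le> \<Phi> p" using \<Phi> unfolding cone_cutoff_def by blast+
  note P = Ck_partials[OF C\<Phi>]
  note A = dissipative_pairD[OF dA] and C = dissipative_pairD[OF dC]
  define kk where "kk z z' = k (fst z' - fst z)" for z z' :: "real \<times> real"
  define kd where "kd z z' = k' (fst z' - fst z)" for z z' :: "real \<times> real"
  define hh where "hh z z' = H (snd z' - snd z)" for z z' :: "real \<times> real"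
  define k2 where "k2 z z' = k (snd z' - snd z)" for z z' :: "real \<times> real"
  \<comment> \<open>The partial derivatives of the two test functions: \<open>P1\<close>, \<open>P2\<close> in \<open>z\<close> and \<open>Q1\<close>, \<open>Q2\<close> in \<open>z'\<close>. The weight
      \<open>\<theta>\<close> belongs to the first test function only.\<close>
  define P1 where "P1 z z' = (pd1 \<Phi> z * \<theta> (fst z) + \<Phi> z * \<theta>' (fst z)) * kk z z' * hh z z' - \<Phi> z * \<theta> (fst z) * kd z z' * hh z z'" for z z'
  define P2 where "P2 z z' = pd2 \<Phi> z * \<theta> (fst z) * kk z z' * hh z z' - \<Phi> z * \<theta> (fst z) * kk z z' * k2 z z'" for z z'
  define Q1 where "Q1 z z' = pd1 \<Phi> z' * kk z z' * hh z z' + \<Phi> z' * kd z z' * hh z z'" for z z'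
  define Q2 where "Q2 z z' = pd2 \<Phi> z' * kk z z' * hh z z' + \<Phi> z' * kk z z' * k2 z z'" for z z'
  have shift: "((\<lambda>u. u - c) has_real_derivative 1) (at u)" "((\<lambda>u. c - u) has_real_derivative - 1) (at u)" for c u :: real
    by (auto intro!: derivative_eq_intros)
  have test1: "0 \<le> (\<integral>z. A z * P1 z z' + B z * P2 z z' \<partial>lborel)" for z'
  proof -
    define \<phi> where "\<phi> z = \<Phi> z * \<theta> (fst z) * k (fst z' - fst z) * H (snd z' - snd z)" for z
    have "pd1 \<phi> z = P1 z z'" for z
    proof -
      have "((\<lambda>t. \<Phi> (t, snd z) * \<theta> t * k (fst z' - t) * H (snd z' - snd z)) has_real_derivative P1 z z') (at (fst z))"
        by (rule DERIV_cong[OF DERIV_mult[OF DERIV_mult[OF DERIV_mult[OF P(1)[of z] \<theta>(2)] DERIV_chain2[OF k'(1) shift(2)]] DERIV_const]])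
          (simp add: P1_def kk_def kd_def hh_def algebra_simps)
      then show ?thesis by - (rule pd1_eq, simp add: \<phi>_def)
    qed
    moreover have "pd2 \<phi> z = P2 z z'" for z
    proof -
      have "((\<lambda>x. \<Phi> (fst z, x) * (\<theta> (fst z) * k (fst z' - fst z)) * H (snd z' - x)) has_real_derivative P2 z z') (at (snd z))"
        by (rule DERIV_cong[OF DERIV_mult[OF DERIV_mult[OF P(2)[of z] DERIV_const] DERIV_chain2[OF H(1) shift(2)]]])
          (simp add: P2_def kk_def k2_def hh_def algebra_simps)
      then show ?thesis by - (rule pd2_eq, simp add: \<phi>_def mult.assoc)
    qed
    moreover have "0 \<le> (\<integral>z. A z * pd1 \<phi> z + B z * pd2 \<phi> z \<partial>lborel)"
    proof (rule dissipative_pair_weak[OF dA _ _ K(1,2)])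
      show "Ck j \<phi>" for j
        unfolding \<phi>_def
        by (intro Ck_mult C\<Phi> Ck_fst'[OF smk] Ck_snd'[OF H(2)] Ck_fst[OF \<theta>(1), of j 0, simplified])
      show "0 \<le> \<phi> z" for z unfolding \<phi>_def by (intro mult_nonneg_nonneg \<Phi>0 \<theta>(4) k0 H(3))
      show "\<phi> z = 0" if "z \<notin> K" for z
      proof (cases "\<theta> (fst z) = 0")
        case False
        then have "T1 \<le> fst z" "fst z \<le> T2" using \<theta>(5)[of "fst z"] by force+
        then have "\<Phi> z = 0" using K(3)[of "fst z" "snd z"] that \<epsilon> by force
        then show ?thesis by (simp add: \<phi>_def)
      qed (simp add: \<phi>_def)
    qed
    ultimately show ?thesis by simp
  qed
  have test2: "0 \<le> \<theta> (fst z) * (\<integral>z'. C z' * Q1 z z' + D z' * Q2 z z' \<partial>lborel)" for z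
  proof (cases "\<theta> (fst z) = 0")
    case False
    then have t: "T1 \<le> fst z" "fst z \<le> T2" using \<theta>(5)[of "fst z"] by force+
    define \<phi> where "\<phi> z' = \<Phi> z' * k (fst z' - fst z) * H (snd z' - snd z)" for z'
    have "pd1 \<phi> z' = Q1 z z'" for z'
    proof -
      have "((\<lambda>t. \<Phi> (t, snd z') * k (t - fst z) * H (snd z' - snd z)) has_real_derivative Q1 z z') (at (fst z'))"
        by (rule DERIV_cong[OF DERIV_mult[OF DERIV_mult[OF P(1)[of z'] DERIV_chain2[OF k'(1) shift(1)]] DERIV_const]])
          (simp add: Q1_def kk_def kd_def hh_def algebra_simps)
      then show ?thesis by - (rule pd1_eq, simp add: \<phi>_def)
    qed
    moreover have "pd2 \<phi> z' = Q2 z z'" for z'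
    proof -
      have "((\<lambda>x. \<Phi> (fst z', x) * k (fst z' - fst z) * H (x - snd z)) has_real_derivative Q2 z z') (at (snd z'))"
        by (rule DERIV_cong[OF DERIV_mult[OF DERIV_mult[OF P(2)[of z'] DERIV_const] DERIV_chain2[OF H(1) shift(1)]]])
          (simp add: Q2_def kk_def k2_def hh_def algebra_simps)
      then show ?thesis by - (rule pd2_eq, simp add: \<phi>_def)
    qed
    moreover have "0 \<le> (\<integral>z'. C z' * pd1 \<phi> z' + D z' * pd2 \<phi> z' \<partial>lborel)"
    proof (rule dissipative_pair_weak[OF dC _ _ K(1,2)])
      show "Ck j \<phi>" for j
        unfolding \<phi>_def by (intro Ck_mult C\<Phi> Ck_fst[OF smk] Ck_snd[OF H(2)])
      show "0 \<le> \<phi> z'" for z' unfolding \<phi>_def by (intro mult_nonneg_nonneg \<Phi>0 k0 H(3))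
      show "\<phi> z' = 0" if "z' \<notin> K" for z'
      proof (cases "\<epsilon> \<le> \<bar>fst z' - fst z\<bar>")
        case True
        then show ?thesis by (simp add: \<phi>_def k_def mollifier_zero[OF \<epsilon>(1)])
      next
        case False
        then have "T0 \<le> fst z'" "fst z' \<le> T3" using t \<epsilon> by linarith+
        then have "\<Phi> z' = 0" using K(3)[of "fst z'" "snd z'"] that by force
        then show ?thesis by (simp add: \<phi>_def)
      qed
    qed
    ultimately show ?thesis using \<theta>(4) by simp
  qed simp
  let ?P = "lborel \<Otimes>\<^sub>M lborel :: ((real \<times> real) \<times> (real \<times> real)) measure"
  have comp: "continuous_on UNIV (\<lambda>p :: (real \<times> real) \<times> (real \<times> real). f (g p))"
    if "continuous_on UNIV f" "continuous_on UNIV g" for f :: "'b::topological_space \<Rightarrow> real" and g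
    by (rule continuous_on_compose2[OF that subset_UNIV])
  have c\<theta>': "continuous_on UNIV \<theta>'" by (rule smooth_continuous[OF \<theta>(3)])
  have ff: "continuous_on UNIV (\<lambda>p :: (real \<times> real) \<times> (real \<times> real). fst p)"
    "continuous_on UNIV (\<lambda>p :: (real \<times> real) \<times> (real \<times> real). snd p)"
    "continuous_on UNIV (\<lambda>p :: (real \<times> real) \<times> (real \<times> real). fst (fst p))"
    "continuous_on UNIV (\<lambda>p :: (real \<times> real) \<times> (real \<times> real). fst (snd p) - fst (fst p))"
    "continuous_on UNIV (\<lambda>p :: (real \<times> real) \<times> (real \<times> real). snd (snd p) - snd (fst p))"
    by (intro continuous_intros)+
  note cont = comp[OF P(3) ff(1)] comp[OF P(3) ff(2)] comp[OF P(4) ff(1)] comp[OF P(4) ff(2)]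
    comp[OF P(5) ff(1)] comp[OF P(5) ff(2)] comp[OF smooth_continuous[OF \<theta>(1)] ff(3)] comp[OF c\<theta>' ff(3)] comp[OF \<theta>(7) ff(3)]
    comp[OF smooth_continuous[OF smk] ff(4)] comp[OF smooth_continuous[OF smk] ff(5)]
    comp[OF smooth_continuous[OF k'(2)] ff(4)] comp[OF smooth_continuous[OF H(2)] ff(5)]
  have cPQ: "continuous_on UNIV (\<lambda>p. P1 (fst p) (snd p))" "continuous_on UNIV (\<lambda>p. P2 (fst p) (snd p))"
    "continuous_on UNIV (\<lambda>p. Q1 (fst p) (snd p))" "continuous_on UNIV (\<lambda>p. Q2 (fst p) (snd p))"
    unfolding P1_def P2_def Q1_def Q2_def kk_def kd_def hh_def k2_def
    by (intro continuous_on_add continuous_on_diff continuous_on_mult cont)+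
  have int: "integrable ?P (\<lambda>p. (A (fst p) * C (snd p)) * J p)" "integrable ?P (\<lambda>p. (B (fst p) * C (snd p)) * J p)"
    "integrable ?P (\<lambda>p. (A (fst p) * D (snd p)) * J p)" if "continuous_on UNIV J" for J
    by (rule integrable_tensor_times_continuous[OF _ _ _ _ _ _ \<Omega> \<Omega> that]; (rule A C; assumption?))+
  define G1 where "G1 p = C (snd p) * \<Phi> (snd p) * (A (fst p) * P1 (fst p) (snd p) + B (fst p) * P2 (fst p) (snd p))" for p
  define G2 where "G2 p = A (fst p) * \<Phi> (fst p) * \<theta> (fst (fst p)) * (C (snd p) * Q1 (fst p) (snd p) + D (snd p) * Q2 (fst p) (snd p))" for p
  have iG1: "integrable ?P G1"
  proof -
    have "integrable ?P (\<lambda>p. (A (fst p) * C (snd p)) * (\<Phi> (snd p) * P1 (fst p) (snd p)) + (B (fst p) * C (snd p)) * (\<Phi> (snd p) * P2 (fst p) (snd p)))"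
      by (intro Bochner_Integration.integrable_add int continuous_on_mult cont cPQ)
    also have "(\<lambda>p. (A (fst p) * C (snd p)) * (\<Phi> (snd p) * P1 (fst p) (snd p)) + (B (fst p) * C (snd p)) * (\<Phi> (snd p) * P2 (fst p) (snd p))) = G1"
      by (rule ext) (simp add: G1_def algebra_simps)
    finally show ?thesis .
  qed
  have iG2: "integrable ?P G2"
  proof -
    have "integrable ?P (\<lambda>p. (A (fst p) * C (snd p)) * (\<Phi> (fst p) * \<theta> (fst (fst p)) * Q1 (fst p) (snd p)) + (A (fst p) * D (snd p)) * (\<Phi> (fst p) * \<theta> (fst (fst p)) * Q2 (fst p) (snd p)))"
      by (intro Bochner_Integration.integrable_add int continuous_on_mult cont cPQ)
    also have "(\<lambda>p. (A (fst p) * C (snd p)) * (\<Phi> (fst p) * \<theta> (fst (fst p)) * Q1 (fst p) (snd p)) + (A (fst p) * D (snd p)) * (\<Phi> (fst p) * \<theta> (fst (fst p)) * Q2 (fst p) (snd p))) = G2"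
      by (rule ext) (simp add: G2_def algebra_simps)
    finally show ?thesis .
  qed
  have G1: "0 \<le> (\<integral>p. G1 p \<partial>?P)"
  proof -
    have "integrable ?P (\<lambda>(z, z'). G1 (z, z'))" using iG1 by (simp add: case_prod_beta')
    from lborel_pair.integral_snd[OF this]
    have "(\<integral>p. G1 p \<partial>?P) = (\<integral>z'. \<integral>z. G1 (z, z') \<partial>lborel \<partial>lborel)" by (simp add: case_prod_beta')
    also have "\<dots> = (\<integral>z'. C z' * \<Phi> z' * (\<integral>z. A z * P1 z z' + B z * P2 z z' \<partial>lborel) \<partial>lborel)"
      unfolding G1_def fst_conv snd_conv by simp
    also have "0 \<le> \<dots>"
      by (intro Bochner_Integration.integral_nonneg mult_nonneg_nonneg C \<Phi>0 test1)
    finally show ?thesis .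
  qed
  have G2: "0 \<le> (\<integral>p. G2 p \<partial>?P)"
  proof -
    have "integrable ?P (\<lambda>(z, z'). G2 (z, z'))" using iG2 by (simp add: case_prod_beta')
    from lborel_pair.integral_fst[OF this]
    have "(\<integral>p. G2 p \<partial>?P) = (\<integral>z. \<integral>z'. G2 (z, z') \<partial>lborel \<partial>lborel)" by (simp add: case_prod_beta')
    also have "\<dots> = (\<integral>z. (A z * \<Phi> z) * (\<theta> (fst z) * (\<integral>z'. C z' * Q1 z z' + D z' * Q2 z z' \<partial>lborel)) \<partial>lborel)"
      unfolding G2_def fst_conv snd_conv by (simp add: mult.assoc)
    also have "0 \<le> \<dots>"
      by (intro Bochner_Integration.integral_nonneg mult_nonneg_nonneg[OF mult_nonneg_nonneg] A \<Phi>0 test2)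
    finally show ?thesis .
  qed
  define R where "R p = (A (fst p) * C (snd p)) * (\<Phi> (fst p) * \<Phi> (snd p) * \<kappa> (fst (fst p)) * mollifier \<epsilon> (fst (snd p) - fst (fst p)))" for p
  define L where "L p = (B (fst p) * C (snd p)) * (\<Phi> (fst p) * \<Phi> (snd p) * \<theta> (fst (fst p)) * mollifier2 \<epsilon> (fst p) (snd p))
       - (A (fst p) * D (snd p)) * (\<Phi> (fst p) * \<Phi> (snd p) * \<theta> (fst (fst p)) * mollifier2 \<epsilon> (fst p) (snd p))" for p
  have iR: "integrable ?P R"
    unfolding R_def k_def[symmetric] by (intro int continuous_on_mult cont)
  have iL: "integrable ?P L"
    unfolding L_def
    by (intro Bochner_Integration.integrable_diff int continuous_on_mult cont continuous_mollifier2)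
  \<comment> \<open>The terms with \<open>kd\<close> cancel in the sum.\<close>
  have pw: "G1 p + G2 p \<le> R p - L p" for p
  proof -
    obtain z z' where p: "p = (z, z')" by (cases p)
    let ?k = "kk z z'" and ?h = "hh z z'" and ?k2 = "k2 z z'" and ?kd = "kd z z'" and ?t = "\<theta> (fst z)"
    have kh: "0 \<le> ?k" "0 \<le> ?h" "?h \<le> 1" using k0 H by (auto simp: kk_def hh_def)
    have X: "A z * pd1 \<Phi> z + B z * pd2 \<Phi> z \<le> 0" by (rule cone_cutoff_sign[OF dA \<Phi>])
    have Y: "C z' * pd1 \<Phi> z' + D z' * pd2 \<Phi> z' \<le> 0" by (rule cone_cutoff_sign[OF dC \<Phi>])
    have m2: "mollifier2 \<epsilon> z z' = ?k * ?k2" by (simp add: mollifier2_def kk_def k2_def k_def)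
    have "(C z' * \<Phi> z' * ?t * ?k * ?h) * (A z * pd1 \<Phi> z + B z * pd2 \<Phi> z) \<le> 0"
      using X by (intro mult_nonneg_nonpos mult_nonneg_nonneg C(3) \<Phi>0 \<theta>(4) kh)
    moreover have "(A z * \<Phi> z * ?t * ?k * ?h) * (C z' * pd1 \<Phi> z' + D z' * pd2 \<Phi> z') \<le> 0"
      using Y by (intro mult_nonneg_nonpos mult_nonneg_nonneg A(3) \<Phi>0 \<theta>(4) kh)
    moreover have "(A z * C z' * \<Phi> z * \<Phi> z') * (\<theta>' (fst z) * (?k * ?h)) \<le> (A z * C z' * \<Phi> z * \<Phi> z') * (\<kappa> (fst z) * ?k)"
    proof (rule mult_left_mono)
      have "\<theta>' (fst z) * (?k * ?h) \<le> \<kappa> (fst z) * (?k * ?h)" using kh \<theta>(6) by (intro mult_right_mono) auto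
      also have "\<dots> \<le> \<kappa> (fst z) * (?k * 1)" using kh \<theta>(8) by (intro mult_left_mono) auto
      finally show "\<theta>' (fst z) * (?k * ?h) \<le> \<kappa> (fst z) * ?k" by simp
    qed (intro mult_nonneg_nonneg A(3) C(3) \<Phi>0)
    moreover have "G1 p + G2 p = (C z' * \<Phi> z' * ?t * ?k * ?h) * (A z * pd1 \<Phi> z + B z * pd2 \<Phi> z)
       + (A z * \<Phi> z * ?t * ?k * ?h) * (C z' * pd1 \<Phi> z' + D z' * pd2 \<Phi> z')
       + (A z * C z' * \<Phi> z * \<Phi> z') * (\<theta>' (fst z) * (?k * ?h)) - L p"
      unfolding p G1_def G2_def L_def fst_conv snd_conv m2 P1_def P2_def Q1_def Q2_def by (simp add: algebra_simps)
    moreover have "R p = (A z * C z' * \<Phi> z * \<Phi> z') * (\<kappa> (fst z) * ?k)"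
      unfolding p R_def fst_conv snd_conv kk_def k_def by (simp add: mult_ac)
    ultimately show ?thesis by linarith
  qed
  have "0 \<le> (\<integral>p. G1 p \<partial>?P) + (\<integral>p. G2 p \<partial>?P)" using G1 G2 by simp
  also have "\<dots> = (\<integral>p. G1 p + G2 p \<partial>?P)" by (rule Bochner_Integration.integral_add[OF iG1 iG2, symmetric])
  also have "\<dots> \<le> (\<integral>p. R p - L p \<partial>?P)"
    by (intro integral_mono pw Bochner_Integration.integrable_add Bochner_Integration.integrable_diff iG1 iG2 iR iL)
  also have "\<dots> = (\<integral>p. R p \<partial>?P) - (\<integral>p. L p \<partial>?P)" by (rule Bochner_Integration.integral_diff[OF iR iL])
  finally show ?thesis unfolding L_def R_def by simp
qed

lemma bounded_times_continuous:
  fixes f g :: "'a::euclidean_space \<Rightarrow> real"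
  assumes f: "\<And>x. \<bar>f x\<bar> \<le> M" "\<And>x. x \<notin> S \<Longrightarrow> f x = 0" "bounded S" and g: "continuous_on UNIV g"
  obtains B where "\<And>x. \<bar>f x * g x\<bar> \<le> B"
proof -
  obtain a where a: "S \<subseteq> cbox (-a) a" using bounded_subset_cbox_symmetric[OF f(3)] by auto
  have "bounded (g ` cbox (-a) a)"
    by (intro compact_imp_bounded compact_continuous_image continuous_on_subset[OF g]) auto
  then obtain B where B: "\<And>x. x \<in> cbox (-a) a \<Longrightarrow> \<bar>g x\<bar> \<le> B"
    unfolding bounded_iff by auto
  have "\<bar>f x * g x\<bar> \<le> M * \<bar>B\<bar>" for x
  proof (cases "x \<in> S")
    case True
    then have "x \<in> cbox (-a) a" using a by auto
    from B[OF this] f(1)[of x] show ?thesis unfolding abs_mult by (intro mult_mono) auto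
  next
    case False
    then show ?thesis using f(1)[of x] f(2)[of x] by simp
  qed
  then show ?thesis by (rule that)
qed

text \<open>
  The limit \<open>\<epsilon> \<rightarrow> 0\<close> of \<open>doubled_inequality\<close>. On its right-hand side, \<open>window_bound\<close> replaces the
  value of the integral of \<open>\<Phi> C\<close> at time \<open>t\<close> by an average that does not depend on \<open>t\<close>, so that the
  double integral becomes a product.
\<close>

lemma interaction_estimate:
  fixes A B C D \<Phi> \<theta> :: "_ \<Rightarrow> real"
  assumes dA: "dissipative_pair \<Omega> \<Lambda> M A B" and dC: "dissipative_pair \<Omega> \<Lambda> M' C D"
    and \<Omega>: "bounded \<Omega>" and \<Phi>: "cone_cutoff \<Lambda> \<Phi>"
    and K: "compact K" "K \<subseteq> \<Omega>" "\<And>t x. T0 \<le> t \<Longrightarrow> t \<le> T3 \<Longrightarrow> \<Phi> (t, x) \<noteq> 0 \<Longrightarrow> (t, x) \<in> K"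
    and \<theta>: "smooth \<theta>" "\<And>t. (\<theta> has_real_derivative \<theta>' t) (at t)" "smooth \<theta>'" "\<And>t. 0 \<le> \<theta> t" "\<And>t. t < T1 \<or> T2 < t \<Longrightarrow> \<theta> t = 0"
      "\<And>t. \<theta>' t \<le> \<kappa> t" "continuous_on UNIV \<kappa>" "\<And>t. 0 \<le> \<kappa> t" "\<And>t. t < T1 \<or> T2 < t \<Longrightarrow> \<kappa> t = 0"
    and T: "0 < b" "T0 \<le> a - b" "a + b < T1" "T2 < T3"
  shows "(\<integral>z. (B z * C z - A z * D z) * ((\<Phi> z)\<^sup>2 * \<theta> (fst z)) \<partial>lborel)
    \<le> (\<integral>z. A z * (\<Phi> z * \<kappa> (fst z)) \<partial>lborel) * (\<integral>z. C z * (\<Phi> z * mollifier b (fst z - a)) \<partial>lborel)"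
proof -
  have C\<Phi>: "\<And>k. Ck k \<Phi>" and \<Phi>0: "\<And>p. 0 \<le> \<Phi> p" using \<Phi> unfolding cone_cutoff_def by blast+
  note P = Ck_partials[OF C\<Phi>]
  note A = dissipative_pairD[OF dA] and C = dissipative_pairD[OF dC]
  have cfst: "continuous_on UNIV (\<lambda>z :: real \<times> real. f (fst z))" if "continuous_on UNIV f" for f :: "real \<Rightarrow> real"
    by (rule continuous_on_compose2[OF that continuous_on_fst[OF continuous_on_id] subset_UNIV])
  have c\<theta>: "continuous_on UNIV (\<lambda>z :: real \<times> real. \<Phi> z * \<theta> (fst z))"
    by (intro continuous_on_mult P cfst smooth_continuous \<theta>(1))
  have c\<kappa>: "continuous_on UNIV (\<lambda>z :: real \<times> real. \<Phi> z * \<kappa> (fst z))"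
    by (intro continuous_on_mult P cfst \<theta>(7))
  let ?P = "lborel \<Otimes>\<^sub>M lborel :: ((real \<times> real) \<times> (real \<times> real)) measure"
  define W where "W = (\<integral>z. C z * (\<Phi> z * mollifier b (fst z - a)) \<partial>lborel)"
  define L1 where "L1 \<epsilon> = (\<integral>p. ((B (fst p) * (\<Phi> (fst p) * \<theta> (fst (fst p)))) * (C (snd p) * \<Phi> (snd p))) * mollifier2 \<epsilon> (fst p) (snd p) \<partial>?P)" for \<epsilon>
  define L2 where "L2 \<epsilon> = (\<integral>p. ((A (fst p) * (\<Phi> (fst p) * \<theta> (fst (fst p)))) * (D (snd p) * \<Phi> (snd p))) * mollifier2 \<epsilon> (fst p) (snd p) \<partial>?P)" for \<epsilon>
  have m: "continuous_on UNIV g \<Longrightarrow> g \<in> borel_measurable borel" for g :: "real \<times> real \<Rightarrow> real"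
    by (rule borel_measurable_continuous_onI)
  obtain b1 where b1: "\<And>z. \<bar>A z * (\<Phi> z * \<theta> (fst z))\<bar> \<le> b1"
    by (rule bounded_times_continuous[where f=A, OF A(4) A(7) \<Omega> c\<theta>]) auto
  obtain b2 where b2: "\<And>z. \<bar>B z * (\<Phi> z * \<theta> (fst z))\<bar> \<le> b2"
    by (rule bounded_times_continuous[where f=B, OF A(5) A(8) \<Omega> c\<theta>]) auto
  obtain b3 where b3: "\<And>z. \<bar>C z * \<Phi> z\<bar> \<le> b3"
    by (rule bounded_times_continuous[where f=C, OF C(4) C(7) \<Omega> P(3)]) auto
  obtain b4 where b4: "\<And>z. \<bar>D z * \<Phi> z\<bar> \<le> b4"
    by (rule bounded_times_continuous[where f=D, OF C(5) C(8) \<Omega> P(3)]) auto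
  have meas: "(\<lambda>z. A z * (\<Phi> z * \<theta> (fst z))) \<in> borel_measurable borel" "(\<lambda>z. B z * (\<Phi> z * \<theta> (fst z))) \<in> borel_measurable borel"
    "(\<lambda>z. C z * \<Phi> z) \<in> borel_measurable borel" "(\<lambda>z. D z * \<Phi> z) \<in> borel_measurable borel"
    by (intro borel_measurable_times A(1,2) C(1,2) m c\<theta> P(3))+
  have zero: "z \<notin> \<Omega> \<Longrightarrow> A z * (\<Phi> z * \<theta> (fst z)) = 0" "z \<notin> \<Omega> \<Longrightarrow> B z * (\<Phi> z * \<theta> (fst z)) = 0"
    "z \<notin> \<Omega> \<Longrightarrow> C z * \<Phi> z = 0" "z \<notin> \<Omega> \<Longrightarrow> D z * \<Phi> z = 0" for z
    using A(7,8) C(7,8) by simp_all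
  have lim1: "(L1 \<longlongrightarrow> (\<integral>z. (B z * (\<Phi> z * \<theta> (fst z))) * (C z * \<Phi> z) \<partial>lborel)) (at_right 0)"
    unfolding L1_def by (rule mollification_limit[OF meas(2) b2 zero(2) meas(3) b3 zero(3) \<Omega> \<Omega>])
  have lim2: "(L2 \<longlongrightarrow> (\<integral>z. (A z * (\<Phi> z * \<theta> (fst z))) * (D z * \<Phi> z) \<partial>lborel)) (at_right 0)"
    unfolding L2_def by (rule mollification_limit[OF meas(1) b1 zero(1) meas(4) b4 zero(4) \<Omega> \<Omega>])
  have main: "L1 \<epsilon> - L2 \<epsilon> \<le> (\<integral>z. A z * (\<Phi> z * \<kappa> (fst z)) \<partial>lborel) * W"
    if \<epsilon>: "0 < \<epsilon>" "a + b \<le> T1 - \<epsilon>" "T2 + \<epsilon> \<le> T3" for \<epsilon>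
  proof -
    have i1: "integrable ?P (\<lambda>p. ((B (fst p) * (\<Phi> (fst p) * \<theta> (fst (fst p)))) * (C (snd p) * \<Phi> (snd p))) * mollifier2 \<epsilon> (fst p) (snd p))"
      by (rule integrable_tensor_times_continuous[OF meas(2) b2 zero(2) meas(3) b3 zero(3) \<Omega> \<Omega> continuous_mollifier2])
    have i2: "integrable ?P (\<lambda>p. ((A (fst p) * (\<Phi> (fst p) * \<theta> (fst (fst p)))) * (D (snd p) * \<Phi> (snd p))) * mollifier2 \<epsilon> (fst p) (snd p))"
      by (rule integrable_tensor_times_continuous[OF meas(1) b1 zero(1) meas(4) b4 zero(4) \<Omega> \<Omega> continuous_mollifier2])
    have "L1 \<epsilon> - L2 \<epsilon> = (\<integral>p. (B (fst p) * C (snd p)) * (\<Phi> (fst p) * \<Phi> (snd p) * \<theta> (fst (fst p)) * mollifier2 \<epsilon> (fst p) (snd p))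
       - (A (fst p) * D (snd p)) * (\<Phi> (fst p) * \<Phi> (snd p) * \<theta> (fst (fst p)) * mollifier2 \<epsilon> (fst p) (snd p)) \<partial>?P)"
      unfolding L1_def L2_def Bochner_Integration.integral_diff[OF i1 i2, symmetric]
      by (rule Bochner_Integration.integral_cong) (simp_all add: mult_ac)
    also have "\<dots> \<le> (\<integral>p. (A (fst p) * C (snd p)) * (\<Phi> (fst p) * \<Phi> (snd p) * \<kappa> (fst (fst p)) * mollifier \<epsilon> (fst (snd p) - fst (fst p))) \<partial>?P)"
      using T \<epsilon> by (intro doubled_inequality[OF dA dC \<Omega> \<Phi> K \<theta>(1-8)]) auto
    also have "\<dots> = (\<integral>z. (A z * (\<Phi> z * \<kappa> (fst z))) * (\<integral>z'. C z' * (\<Phi> z' * mollifier \<epsilon> (fst z' - fst z)) \<partial>lborel) \<partial>lborel)"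
    proof -
      have cJ: "continuous_on UNIV (\<lambda>p :: (real \<times> real) \<times> (real \<times> real). \<Phi> (fst p) * \<Phi> (snd p) * \<kappa> (fst (fst p)) * mollifier \<epsilon> (fst (snd p) - fst (fst p)))"
        by (intro continuous_on_mult continuous_on_compose2[OF P(3) _ subset_UNIV] continuous_on_compose2[OF \<theta>(7) _ subset_UNIV]
           continuous_on_compose2[OF continuous_mollifier _ subset_UNIV]; intro continuous_intros)
      have "integrable ?P (\<lambda>p. (A (fst p) * C (snd p)) * (\<Phi> (fst p) * \<Phi> (snd p) * \<kappa> (fst (fst p)) * mollifier \<epsilon> (fst (snd p) - fst (fst p))))"
        by (rule integrable_tensor_times_continuous[OF A(1,4,7) C(1,4,7) \<Omega> \<Omega> cJ])
      then have "integrable ?P (\<lambda>(z, z'). (A z * C z') * (\<Phi> z * \<Phi> z' * \<kappa> (fst z) * mollifier \<epsilon> (fst z' - fst z)))"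
        by (simp add: case_prod_beta')
      from lborel_pair.integral_fst[OF this] show ?thesis
        by (simp add: case_prod_beta' mult_ac flip: integral_mult_right_zero)
    qed
    also have "\<dots> \<le> (\<integral>z. (A z * (\<Phi> z * \<kappa> (fst z))) * W \<partial>lborel)"
    proof (rule integral_mono')
      show "integrable lborel (\<lambda>z. (A z * (\<Phi> z * \<kappa> (fst z))) * W)"
        by (intro integrable_mult_left integrable_dissipative[OF dA \<Omega> c\<kappa>])
      have W0: "0 \<le> W"
        unfolding W_def
        by (intro Bochner_Integration.integral_nonneg mult_nonneg_nonneg C(3) \<Phi>0 mollifier_nonneg T)
      show "0 \<le> A z * (\<Phi> z * \<kappa> (fst z)) * W" for z
        by (intro mult_nonneg_nonneg W0 A(3) \<Phi>0 \<theta>(8))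
      fix z :: "real \<times> real"
      show "(A z * (\<Phi> z * \<kappa> (fst z))) * (\<integral>z'. C z' * (\<Phi> z' * mollifier \<epsilon> (fst z' - fst z)) \<partial>lborel) \<le> (A z * (\<Phi> z * \<kappa> (fst z))) * W"
      proof (cases "\<kappa> (fst z) = 0")
        case False
        then have "T1 \<le> fst z" "fst z \<le> T2" using \<theta>(9)[of "fst z"] by force+
        then have "(\<integral>z'. C z' * (\<Phi> z' * mollifier \<epsilon> (fst z' - fst z)) \<partial>lborel) \<le> W"
          unfolding W_def using \<epsilon> T by (intro window_bound[OF dC \<Omega> \<Phi> K]) auto
        then show ?thesis by (intro mult_left_mono mult_nonneg_nonneg A(3) \<Phi>0 \<theta>(8))
      qed simp
    qed
    finally show ?thesis by simp
  qed
  have "(\<integral>z. (B z * (\<Phi> z * \<theta> (fst z))) * (C z * \<Phi> z) \<partial>lborel) - (\<integral>z. (A z * (\<Phi> z * \<theta> (fst z))) * (D z * \<Phi> z) \<partial>lborel)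
      \<le> (\<integral>z. A z * (\<Phi> z * \<kappa> (fst z)) \<partial>lborel) * W"
  proof (rule tendsto_upperbound[OF tendsto_diff[OF lim1 lim2]])
    show "eventually (\<lambda>\<epsilon>. L1 \<epsilon> - L2 \<epsilon> \<le> (\<integral>z. A z * (\<Phi> z * \<kappa> (fst z)) \<partial>lborel) * W) (at_right 0)"
      unfolding eventually_at_right_field
      using T main by (intro exI[of _ "min (T1 - (a + b)) (T3 - T2)"]) auto
  qed simp
  moreover have "integrable lborel (\<lambda>z. (B z * (\<Phi> z * \<theta> (fst z))) * (C z * \<Phi> z))"
    "integrable lborel (\<lambda>z. (A z * (\<Phi> z * \<theta> (fst z))) * (D z * \<Phi> z))"
  proof -
    have "integrable lborel (\<lambda>z. (f z * g z) * 1)" if "f \<in> borel_measurable borel" "g \<in> borel_measurable borel"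
       "\<And>z. \<bar>f z\<bar> \<le> m1" "\<And>z. \<bar>g z\<bar> \<le> m2" "\<And>z. z \<notin> \<Omega> \<Longrightarrow> f z = 0" for f g :: "real \<times> real \<Rightarrow> real" and m1 m2
    proof (rule integrable_bounded_times_continuous[where f="\<lambda>z. f z * g z" and M="m1 * m2" and S=\<Omega>])
      show "\<bar>f z * g z\<bar> \<le> m1 * m2" for z
        unfolding abs_mult using that(3)[of z] that(4)[of z] by (intro mult_mono) auto
      show "f z * g z = 0" if "z \<notin> \<Omega>" for z using \<open>\<And>z. z \<notin> \<Omega> \<Longrightarrow> f z = 0\<close>[OF that] by simp
    qed (intro borel_measurable_times that(1,2) \<Omega> continuous_on_const)+
    from this[OF meas(2,3) b2 b3 zero(2)] this[OF meas(1,4) b1 b4 zero(1)]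
    show "integrable lborel (\<lambda>z. (B z * (\<Phi> z * \<theta> (fst z))) * (C z * \<Phi> z))"
      "integrable lborel (\<lambda>z. (A z * (\<Phi> z * \<theta> (fst z))) * (D z * \<Phi> z))" by simp_all
  qed
  from Bochner_Integration.integral_diff[OF this]
  have "(\<integral>z. (B z * C z - A z * D z) * ((\<Phi> z)\<^sup>2 * \<theta> (fst z)) \<partial>lborel) =
     (\<integral>z. (B z * (\<Phi> z * \<theta> (fst z))) * (C z * \<Phi> z) \<partial>lborel) - (\<integral>z. (A z * (\<Phi> z * \<theta> (fst z))) * (D z * \<Phi> z) \<partial>lborel)"
    by (simp add: power2_eq_square algebra_simps)
  ultimately show ?thesis unfolding W_def by simp
qed

section \<open>De Giorgi iteration\<close>

text \<open>
  With \<open>u = w - h' > 0\<close> and \<open>e = h' - h\<close> the right-hand side equals \<open>u\<^sup>2 e (u + e)\<^sup>2 / 12\<close>. It is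
  positive because the ratio of flux and energy increases with the level.
\<close>

lemma level_bilinear_bound:
  assumes "h < h'"
  shows "(h' - h) ^ 3 / 6 * pos_sq (w - h') \<le> pos_flux h' (w - h') * pos_sq (w - h) - pos_sq (w - h') * pos_flux h (w - h)"
proof (cases "w \<le> h'")
  case True
  then show ?thesis by (simp add: pos_sq_def pos_flux_def max_def)
next
  case False
  define u where "u = w - h'"
  define e where "e = h' - h"
  have u: "0 < u" "0 < e" using False assms by (auto simp: u_def e_def)
  have w: "w - h' = u" "w - h = u + e" "h' = h + e" "h' - h = e" by (auto simp: u_def e_def)
  have 1: "pos_flux h' u * pos_sq (u + e) - pos_sq u * pos_flux h (u + e) = u\<^sup>2 * e / 12 * (u + e)\<^sup>2"
    unfolding w(3) using u by (simp add: pos_sq_def pos_flux_def max_def field_simps power2_eq_square power3_eq_cube)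
  have "u\<^sup>2 * e / 12 * e\<^sup>2 \<le> u\<^sup>2 * e / 12 * (u + e)\<^sup>2"
    using u by (intro mult_left_mono power_mono) auto
  also have "u\<^sup>2 * e / 12 * e\<^sup>2 = e ^ 3 / 6 * pos_sq u"
    using u by (simp add: pos_sq_def max_def power2_eq_square power3_eq_cube)
  finally show ?thesis unfolding w(1,2,4) 1 .
qed

lemma pos_sq_nonneg: "0 \<le> pos_sq y"
  by (simp add: pos_sq_def)

lemma pos_sq_zero: "y \<le> 0 \<Longrightarrow> pos_sq y = 0"
  by (simp add: pos_sq_def)

definition level_energy :: "(real \<times> real \<Rightarrow> real) \<Rightarrow> real \<Rightarrow> real \<times> real \<Rightarrow> real" where
  "level_energy w h p = pos_sq (w p - h)"

definition level_flux :: "real \<Rightarrow> (real \<times> real \<Rightarrow> real) \<Rightarrow> real \<Rightarrow> real \<times> real \<Rightarrow> real" where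
  "level_flux s w h p = s * pos_flux h (w p - h)"

lemma level_energy_antimono: "h \<le> h' \<Longrightarrow> level_energy w h' p \<le> level_energy w h p"
  unfolding level_energy_def by (rule pos_sq_mono) simp

text \<open>
  The sign \<open>s\<close> of the flux decides in which of the two orders the pairs of the levels \<open>h\<close> and \<open>h'\<close> are
  inserted into \<open>interaction_estimate\<close>.
\<close>

lemma level_interaction:
  fixes \<Phi> \<theta> :: "_ \<Rightarrow> real"
  assumes s: "s = 1 \<or> s = -1"
    and d: "dissipative_pair \<Omega> \<Lambda> M (level_energy w h) (level_flux s w h)"
    and d': "dissipative_pair \<Omega> \<Lambda> M (level_energy w h') (level_flux s w h')" and hh: "h < h'"
    and \<Omega>: "bounded \<Omega>" and \<Phi>: "cone_cutoff \<Lambda> \<Phi>"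
    and K: "compact K" "K \<subseteq> \<Omega>" "\<And>t x. T0 \<le> t \<Longrightarrow> t \<le> T3 \<Longrightarrow> \<Phi> (t, x) \<noteq> 0 \<Longrightarrow> (t, x) \<in> K"
    and \<theta>: "smooth \<theta>" "\<And>t. (\<theta> has_real_derivative \<theta>' t) (at t)" "smooth \<theta>'" "\<And>t. 0 \<le> \<theta> t" "\<And>t. t < T1 \<or> T2 < t \<Longrightarrow> \<theta> t = 0"
      "\<And>t. \<theta>' t \<le> \<kappa> t" "continuous_on UNIV \<kappa>" "\<And>t. 0 \<le> \<kappa> t" "\<And>t. t < T1 \<or> T2 < t \<Longrightarrow> \<kappa> t = 0"
    and T: "0 < b" "T0 \<le> a - b" "a + b < T1" "T2 < T3"
  shows "(h' - h) ^ 3 / 6 * (\<integral>z. level_energy w h' z * ((\<Phi> z)\<^sup>2 * \<theta> (fst z)) \<partial>lborel)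
    \<le> (\<integral>z. level_energy w h z * (\<Phi> z * \<kappa> (fst z)) \<partial>lborel) * (\<integral>z. level_energy w h z * (\<Phi> z * mollifier b (fst z - a)) \<partial>lborel)"
proof -
  let ?E = "level_energy w h" and ?E' = "level_energy w h'" and ?F = "level_flux s w h" and ?F' = "level_flux s w h'"
  have C\<Phi>: "\<And>k. Ck k \<Phi>" and \<Phi>0: "\<And>p. 0 \<le> \<Phi> p" using \<Phi> unfolding cone_cutoff_def by blast+
  note P = Ck_partials[OF C\<Phi>]
  note A = dissipative_pairD[OF d] and A' = dissipative_pairD[OF d']
  have cfst: "continuous_on UNIV (\<lambda>z :: real \<times> real. f (fst z))" if "continuous_on UNIV f" for f :: "real \<Rightarrow> real"
    by (rule continuous_on_compose2[OF that continuous_on_fst[OF continuous_on_id] subset_UNIV])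
  have ck: "continuous_on UNIV (\<lambda>z :: real \<times> real. \<Phi> z * \<kappa> (fst z))"
    by (intro continuous_on_mult P cfst \<theta>(7))
  have cm: "continuous_on UNIV (\<lambda>z :: real \<times> real. \<Phi> z * mollifier b (fst z - a))"
    by (intro continuous_on_mult P continuous_on_compose2[OF continuous_mollifier _ subset_UNIV] continuous_intros)
  have ct: "continuous_on UNIV (\<lambda>z :: real \<times> real. (\<Phi> z)\<^sup>2 * \<theta> (fst z))"
    by (intro continuous_on_mult continuous_on_power P cfst smooth_continuous \<theta>(1))
  have I0: "0 \<le> (\<integral>z. f z * (\<Phi> z * \<kappa> (fst z)) \<partial>lborel)" "0 \<le> (\<integral>z. f z * (\<Phi> z * mollifier b (fst z - a)) \<partial>lborel)"
    if "\<And>z. 0 \<le> f z" for f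
    by (intro Bochner_Integration.integral_nonneg mult_nonneg_nonneg that \<Phi>0 \<theta>(8) mollifier_nonneg T)+
  have mono: "(\<integral>z. ?E' z * g z \<partial>lborel) \<le> (\<integral>z. ?E z * g z \<partial>lborel)"
    if "continuous_on UNIV g" "\<And>z. 0 \<le> g z" for g
    using hh by (intro integral_mono integrable_dissipative[OF d \<Omega>] integrable_dissipative[OF d' \<Omega>] that mult_right_mono level_energy_antimono) auto
  have mk: "(\<integral>z. ?E' z * (\<Phi> z * \<kappa> (fst z)) \<partial>lborel) \<le> (\<integral>z. ?E z * (\<Phi> z * \<kappa> (fst z)) \<partial>lborel)"
    by (intro mono ck mult_nonneg_nonneg \<Phi>0 \<theta>(8))
  have mm: "(\<integral>z. ?E' z * (\<Phi> z * mollifier b (fst z - a)) \<partial>lborel) \<le> (\<integral>z. ?E z * (\<Phi> z * mollifier b (fst z - a)) \<partial>lborel)"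
    by (intro mono cm mult_nonneg_nonneg \<Phi>0 mollifier_nonneg T)
  define Q where "Q z = s * (?F' z * ?E z - ?E' z * ?F z)" for z
  have Q: "(h' - h) ^ 3 / 6 * ?E' z \<le> Q z" for z
    using level_bilinear_bound[OF hh, of "w z"] s by (auto simp: Q_def level_energy_def level_flux_def mult_ac)
  have up: "(\<integral>z. Q z * ((\<Phi> z)\<^sup>2 * \<theta> (fst z)) \<partial>lborel)
    \<le> (\<integral>z. ?E z * (\<Phi> z * \<kappa> (fst z)) \<partial>lborel) * (\<integral>z. ?E z * (\<Phi> z * mollifier b (fst z - a)) \<partial>lborel)"
    using s
  proof
    assume s1: "s = 1"
    have "(\<integral>z. (?F' z * ?E z - ?E' z * ?F z) * ((\<Phi> z)\<^sup>2 * \<theta> (fst z)) \<partial>lborel)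
      \<le> (\<integral>z. ?E' z * (\<Phi> z * \<kappa> (fst z)) \<partial>lborel) * (\<integral>z. ?E z * (\<Phi> z * mollifier b (fst z - a)) \<partial>lborel)"
      by (rule interaction_estimate[OF d' d \<Omega> \<Phi> K \<theta> T])
    also have "\<dots> \<le> (\<integral>z. ?E z * (\<Phi> z * \<kappa> (fst z)) \<partial>lborel) * (\<integral>z. ?E z * (\<Phi> z * mollifier b (fst z - a)) \<partial>lborel)"
      by (intro mult_right_mono mk I0 A(3))
    finally show ?thesis by (simp add: Q_def s1)
  next
    assume s1: "s = -1"
    have "(\<integral>z. (?F z * ?E' z - ?E z * ?F' z) * ((\<Phi> z)\<^sup>2 * \<theta> (fst z)) \<partial>lborel)
      \<le> (\<integral>z. ?E z * (\<Phi> z * \<kappa> (fst z)) \<partial>lborel) * (\<integral>z. ?E' z * (\<Phi> z * mollifier b (fst z - a)) \<partial>lborel)"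
      by (rule interaction_estimate[OF d d' \<Omega> \<Phi> K \<theta> T])
    also have "\<dots> \<le> (\<integral>z. ?E z * (\<Phi> z * \<kappa> (fst z)) \<partial>lborel) * (\<integral>z. ?E z * (\<Phi> z * mollifier b (fst z - a)) \<partial>lborel)"
      by (intro mult_left_mono mm I0 A(3))
    finally show ?thesis by (simp add: Q_def s1 algebra_simps)
  qed
  have "(h' - h) ^ 3 / 6 * (\<integral>z. ?E' z * ((\<Phi> z)\<^sup>2 * \<theta> (fst z)) \<partial>lborel)
      = (\<integral>z. ((h' - h) ^ 3 / 6 * ?E' z) * ((\<Phi> z)\<^sup>2 * \<theta> (fst z)) \<partial>lborel)"
    by (simp only: mult.assoc integral_mult_right_zero)
  also have "\<dots> \<le> (\<integral>z. Q z * ((\<Phi> z)\<^sup>2 * \<theta> (fst z)) \<partial>lborel)"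
  proof (rule integral_mono')
    show "integrable lborel (\<lambda>z. Q z * ((\<Phi> z)\<^sup>2 * \<theta> (fst z)))"
    proof (rule integrable_bounded_times_continuous[where S=\<Omega> and M="(\<bar>\<Lambda>\<bar> * M) * M + M * (\<bar>\<Lambda>\<bar> * M)"])
      show "Q \<in> borel_measurable borel"
        unfolding Q_def by (intro borel_measurable_times borel_measurable_diff borel_measurable_const A(1,2) A'(1,2))
      show "\<bar>Q z\<bar> \<le> (\<bar>\<Lambda>\<bar> * M) * M + M * (\<bar>\<Lambda>\<bar> * M)" for z
      proof -
        have "\<bar>Q z\<bar> = \<bar>?F' z * ?E z - ?E' z * ?F z\<bar>" using s by (auto simp: Q_def abs_minus_commute)
        also have "\<dots> \<le> \<bar>?F' z\<bar> * \<bar>?E z\<bar> + \<bar>?E' z\<bar> * \<bar>?F z\<bar>"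
          by (metis abs_mult abs_triangle_ineq4)
        also have "\<dots> \<le> (\<bar>\<Lambda>\<bar> * M) * M + M * (\<bar>\<Lambda>\<bar> * M)"
          using A(4,5)[of z] A'(4,5)[of z] by (intro add_mono mult_mono) auto
        finally show ?thesis .
      qed
      show "Q z = 0" if "z \<notin> \<Omega>" for z using A(7,8)[OF that] by (simp add: Q_def)
    qed (rule \<Omega> ct)+
    show "(h' - h) ^ 3 / 6 * ?E' z * ((\<Phi> z)\<^sup>2 * \<theta> (fst z)) \<le> Q z * ((\<Phi> z)\<^sup>2 * \<theta> (fst z))" for z
      by (intro mult_right_mono Q mult_nonneg_nonneg zero_le_power2 \<theta>(4))
    show "0 \<le> Q z * ((\<Phi> z)\<^sup>2 * \<theta> (fst z))" for z
    proof -
      have "0 \<le> (h' - h) ^ 3 / 6 * ?E' z" using hh A'(3)[of z] by simp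
      then have "0 \<le> Q z" using Q[of z] by linarith
      then show ?thesis by (intro mult_nonneg_nonneg zero_le_power2 \<theta>(4))
    qed
  qed
  also note up
  finally show ?thesis .
qed

lemma cone_cutoff_mult:
  assumes L: "0 \<le> \<Lambda>" and 1: "cone_cutoff \<Lambda> \<Phi>" and 2: "cone_cutoff \<Lambda> \<Psi>"
  shows "cone_cutoff \<Lambda> (\<lambda>p. \<Phi> p * \<Psi> p)"
proof -
  have C: "\<And>k. Ck k \<Phi>" "\<And>k. Ck k \<Psi>" and n: "\<And>p. 0 \<le> \<Phi> p" "\<And>p. 0 \<le> \<Psi> p"
    and m: "\<And>p. pd1 \<Phi> p + \<Lambda> * \<bar>pd2 \<Phi> p\<bar> \<le> 0" "\<And>p. pd1 \<Psi> p + \<Lambda> * \<bar>pd2 \<Psi> p\<bar> \<le> 0"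
    using 1 2 unfolding cone_cutoff_def by blast+
  note P = Ck_partials[OF C(1)] and Q = Ck_partials[OF C(2)]
  have "pd1 (\<lambda>p. \<Phi> p * \<Psi> p) p + \<Lambda> * \<bar>pd2 (\<lambda>p. \<Phi> p * \<Psi> p) p\<bar> \<le> 0" for p
  proof -
    have e1: "pd1 (\<lambda>p. \<Phi> p * \<Psi> p) p = pd1 \<Phi> p * \<Psi> p + pd1 \<Psi> p * \<Phi> p"
      using DERIV_mult[OF P(1)[of p] Q(1)[of p]] by - (rule pd1_eq, simp)
    have e2: "pd2 (\<lambda>p. \<Phi> p * \<Psi> p) p = pd2 \<Phi> p * \<Psi> p + pd2 \<Psi> p * \<Phi> p"
      using DERIV_mult[OF P(2)[of p] Q(2)[of p]] by - (rule pd2_eq, simp)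
    have "\<bar>pd2 \<Phi> p * \<Psi> p + pd2 \<Psi> p * \<Phi> p\<bar> \<le> \<bar>pd2 \<Phi> p\<bar> * \<Psi> p + \<bar>pd2 \<Psi> p\<bar> * \<Phi> p"
      using n[of p] abs_triangle_ineq[of "pd2 \<Phi> p * \<Psi> p" "pd2 \<Psi> p * \<Phi> p"] by (simp add: abs_mult)
    then have "\<Lambda> * \<bar>pd2 \<Phi> p * \<Psi> p + pd2 \<Psi> p * \<Phi> p\<bar> \<le> \<Lambda> * (\<bar>pd2 \<Phi> p\<bar> * \<Psi> p + \<bar>pd2 \<Psi> p\<bar> * \<Phi> p)"
      using L by (rule mult_left_mono)
    moreover have "(pd1 \<Phi> p + \<Lambda> * \<bar>pd2 \<Phi> p\<bar>) * \<Psi> p \<le> 0" "(pd1 \<Psi> p + \<Lambda> * \<bar>pd2 \<Psi> p\<bar>) * \<Phi> p \<le> 0"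
      by (intro mult_nonpos_nonneg m n)+
    ultimately show ?thesis unfolding e1 e2 by (simp add: algebra_simps)
  qed
  then show ?thesis unfolding cone_cutoff_def using Ck_mult[OF C] n by (auto simp del: split_paired_All)
qed

text \<open>
  Since the weight appears squared on the left of the interaction estimate but not on its right,
  squaring it in each step of the iteration avoids a nested sequence of cut-offs. The squares
  remain 1 where the weight is 1.
\<close>

lemma cone_cutoff_power:
  assumes "0 \<le> \<Lambda>" "cone_cutoff \<Lambda> \<Phi>"
  shows "cone_cutoff \<Lambda> (\<lambda>p. \<Phi> p ^ (2 ^ n))"
proof (induction n)
  case (Suc n)
  from cone_cutoff_mult[OF assms(1) Suc.IH Suc.IH] show ?case
    by (simp add: power_add[symmetric] mult_2[symmetric])
qed (simp add: assms(2))

lemma cone_cutoff_plane_wave: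
  assumes r: "0 < r" and L: "0 \<le> \<Lambda>" and \<mu>: "\<mu> = 1 \<or> \<mu> = -1"
  shows "cone_cutoff \<Lambda> (\<lambda>p. step ((- \<Lambda> / r) * fst p + (\<mu> / r) * snd p + c))"
proof -
  let ?l = "\<lambda>p::real\<times>real. (- \<Lambda> / r) * fst p + (\<mu> / r) * snd p + c"
  have "pd1 (\<lambda>p. step (?l p)) p = (- \<Lambda> / r) * bump (?l p)" for p
  proof -
    have "((\<lambda>t. ?l (t, snd p)) has_real_derivative (- \<Lambda> / r)) (at (fst p))"
      using r by (auto intro!: derivative_eq_intros)
    from DERIV_chain2[OF step_deriv this] show ?thesis by - (rule pd1_eq, simp add: mult.commute)
  qed
  moreover have "pd2 (\<lambda>p. step (?l p)) p = (\<mu> / r) * bump (?l p)" for p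
  proof -
    have "((\<lambda>t. ?l (fst p, t)) has_real_derivative (\<mu> / r)) (at (snd p))"
      using r by (auto intro!: derivative_eq_intros)
    from DERIV_chain2[OF step_deriv this] show ?thesis by - (rule pd2_eq, simp add: mult.commute)
  qed
  moreover have "\<bar>(\<mu> / r) * bump u\<bar> = bump u / r" for u using \<mu> r bump_nonneg[of u] by (auto simp: abs_mult)
  ultimately have "pd1 (\<lambda>p. step (?l p)) p + \<Lambda> * \<bar>pd2 (\<lambda>p. step (?l p)) p\<bar> \<le> 0" for p
    by (simp only:) simp
  then show ?thesis
    unfolding cone_cutoff_def by (intro conjI allI Ck_smooth_affine smooth_step step_nonneg)
qed

text \<open>
  A product of two plane waves that move inward with speed \<open>\<Lambda>\<close> from the two sides.
\<close>

lemma cone_cutoff_exists: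
  fixes t0 x0 r \<Lambda> :: real
  assumes r: "0 < r" and L: "0 \<le> \<Lambda>"
  obtains \<Phi> where "cone_cutoff \<Lambda> \<Phi>" "\<And>p. \<Phi> p \<le> 1"
    "\<And>t x. \<bar>t - t0\<bar> \<le> r \<Longrightarrow> \<bar>x - x0\<bar> \<le> r \<Longrightarrow> \<Phi> (t, x) = 1"
    "\<And>t x. \<bar>t - t0\<bar> \<le> 3 * r \<Longrightarrow> \<Phi> (t, x) \<noteq> 0 \<Longrightarrow> \<bar>x - x0\<bar> \<le> (3 + 4 * \<Lambda>) * r"
proof -
  \<comment> \<open>With these offsets both arguments of \<open>step\<close> are at least 1 where \<open>\<bar>t - t0\<bar> \<le> r\<close> and \<open>\<bar>x - x0\<bar> \<le> r\<close>.\<close>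
  define c1 where "c1 = (\<Lambda> * t0 + x0) / r + (2 + \<Lambda>)"
  define c2 where "c2 = (\<Lambda> * t0 - x0) / r + (2 + \<Lambda>)"
  define f where "f p = step ((- \<Lambda> / r) * fst p + (-1 / r) * snd p + c1)" for p :: "real \<times> real"
  define g where "g p = step ((- \<Lambda> / r) * fst p + (1 / r) * snd p + c2)" for p :: "real \<times> real"
  have arg: "(- \<Lambda> / r) * t + (-1 / r) * x + c1 = 2 + \<Lambda> - (\<Lambda> * (t - t0) + (x - x0)) / r"
    "(- \<Lambda> / r) * t + (1 / r) * x + c2 = 2 + \<Lambda> - (\<Lambda> * (t - t0) - (x - x0)) / r" for t x
    by (simp_all add: c1_def c2_def diff_divide_distrib add_divide_distrib algebra_simps)
  define \<Phi> where "\<Phi> p = f p * g p" for p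
  show ?thesis
  proof (rule that[of \<Phi>])
    show "cone_cutoff \<Lambda> \<Phi>"
      unfolding \<Phi>_def f_def g_def by (intro cone_cutoff_mult L cone_cutoff_plane_wave r) auto
    have "f p * g p \<le> 1 * 1" for p
      unfolding f_def g_def by (intro mult_mono step_le_1 step_nonneg) auto
    then show "\<Phi> p \<le> 1" for p by (simp add: \<Phi>_def)
    fix t x
    { assume a: "\<bar>t - t0\<bar> \<le> r" "\<bar>x - x0\<bar> \<le> r"
      have "\<Lambda> * (t - t0) \<le> \<Lambda> * r" using a L by (intro mult_left_mono) auto
      then have "(\<Lambda> * (t - t0) + (x - x0)) / r \<le> 1 + \<Lambda>" "(\<Lambda> * (t - t0) - (x - x0)) / r \<le> 1 + \<Lambda>"
        using a r by (auto simp: pos_divide_le_eq algebra_simps)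
      then have "f (t, x) = 1" "g (t, x) = 1"
        unfolding f_def g_def fst_conv snd_conv arg by (auto intro!: step_right)
      then show "\<Phi> (t, x) = 1" by (simp add: \<Phi>_def) }
    { assume a: "\<bar>t - t0\<bar> \<le> 3 * r" and nz: "\<Phi> (t, x) \<noteq> 0"
      have "\<Lambda> * (t0 - t) \<le> \<Lambda> * (3 * r)" using a L by (intro mult_left_mono) auto
      then have lo: "- (3 * \<Lambda> * r) \<le> \<Lambda> * (t - t0)" by (simp add: algebra_simps)
      have "f (t, x) \<noteq> 0" "g (t, x) \<noteq> 0" using nz by (auto simp: \<Phi>_def)
      then have "\<not> 2 + \<Lambda> - (\<Lambda> * (t - t0) + (x - x0)) / r \<le> -1" "\<not> 2 + \<Lambda> - (\<Lambda> * (t - t0) - (x - x0)) / r \<le> -1"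
        using step_left unfolding f_def g_def fst_conv snd_conv arg by blast+
      then have "(\<Lambda> * (t - t0) + (x - x0)) / r < 3 + \<Lambda>" "(\<Lambda> * (t - t0) - (x - x0)) / r < 3 + \<Lambda>" by linarith+
      then have "\<Lambda> * (t - t0) + (x - x0) < (3 + \<Lambda>) * r" "\<Lambda> * (t - t0) - (x - x0) < (3 + \<Lambda>) * r"
        using r by (simp_all add: pos_divide_less_eq)
      then show "\<bar>x - x0\<bar> \<le> (3 + 4 * \<Lambda>) * r" using lo by (simp add: algebra_simps abs_le_iff) }
  qed
qed

text \<open>
  The numbers \<open>Y n = c * 32 ^ Suc n * X n\<close> satisfy \<open>Y (Suc n) \<le> (Y n)\<^sup>2\<close> and \<open>Y 0 \<le> 1 / 2\<close>.
\<close>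

lemma iteration_decay:
  fixes X :: "nat \<Rightarrow> real"
  assumes X: "\<And>n. 0 \<le> X n" "\<And>n. X (Suc n) \<le> c * 32 ^ n * (X n)\<^sup>2" and c: "0 < c" "c * 32 * X 0 \<le> 1 / 2"
  shows "X \<longlonglongrightarrow> 0"
proof -
  define Y where "Y n = c * 32 ^ Suc n * X n" for n
  have Y0: "0 \<le> Y n" for n using X(1) c(1) by (simp add: Y_def)
  have Y: "Y (Suc n) \<le> (Y n)\<^sup>2" for n
  proof -
    have "Y (Suc n) \<le> c * 32 ^ Suc (Suc n) * (c * 32 ^ n * (X n)\<^sup>2)"
      unfolding Y_def using c(1) by (intro mult_left_mono X) auto
    also have "\<dots> = (Y n)\<^sup>2" by (simp add: Y_def power2_eq_square)
    finally show ?thesis .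
  qed
  have half: "Y n \<le> (1 / 2) ^ Suc n" for n
  proof (induction n)
    case 0
    then show ?case using c(2) by (simp add: Y_def)
  next
    case (Suc n)
    have "Y (Suc n) \<le> Y n * Y n" using Y[of n] by (simp add: power2_eq_square)
    also have "\<dots> \<le> (1 / 2) ^ Suc n * (1 / 2)"
    proof (intro mult_mono Suc Y0)
      have "(1 / 2 :: real) ^ Suc n \<le> (1 / 2) ^ 1" by (rule power_decreasing) auto
      then show "Y n \<le> 1 / 2" using Suc by simp
    qed auto
    finally show ?case by simp
  qed
  have up: "X n \<le> (1 / c) * (1 / 2) ^ Suc n" for n
  proof -
    have "c * X n * 1 \<le> c * X n * 32 ^ Suc n"
      using c(1) X(1)[of n] by (intro mult_left_mono one_le_power) auto
    also have "\<dots> = Y n" by (simp add: Y_def)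
    also note half[of n]
    finally have "c * X n \<le> (1 / 2) ^ Suc n" by simp
    then show ?thesis using c(1) by (simp add: pos_le_divide_eq mult_ac)
  qed
  have lim: "(\<lambda>n. (1 / c) * (1 / 2 :: real) ^ Suc n) \<longlonglongrightarrow> 0"
    using tendsto_mult_left[OF LIMSEQ_Suc[OF LIMSEQ_realpow_zero[of "1 / 2 :: real"]], of "1 / c"] by simp
  show ?thesis
    by (rule tendsto_sandwich[OF always_eventually always_eventually tendsto_const lim]) (intro allI X(1) up)+
qed

text \<open>
  One step from the level \<open>h\<close> to \<open>h'\<close> and from the time interval \<open>[S - \<delta>, T]\<close> to \<open>[S, T]\<close>. Both factors on
  the right of the interaction estimate are averages over time windows of length proportional to
  \<open>\<delta>\<close>, which is where the factor \<open>1 / \<delta>\<close> comes from.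
\<close>

lemma de_giorgi_step:
  fixes w :: "real \<times> real \<Rightarrow> real"
  assumes s: "s = 1 \<or> s = -1"
    and d: "dissipative_pair \<Omega> \<Lambda> M (level_energy w h) (level_flux s w h)"
    and d': "dissipative_pair \<Omega> \<Lambda> M (level_energy w h') (level_flux s w h')" and hh: "h < h'"
    and \<Omega>: "bounded \<Omega>" and \<Phi>: "cone_cutoff \<Lambda> \<Phi>"
    and K: "compact K" "K \<subseteq> \<Omega>" "\<And>t x. S - \<delta> \<le> t \<Longrightarrow> t \<le> T + 2 * \<tau> \<Longrightarrow> \<Phi> (t, x) \<noteq> 0 \<Longrightarrow> (t, x) \<in> K"
    and t: "0 < \<delta>" "0 < \<tau>" "S < T" and B: "\<And>u. bump u \<le> B"
  shows "(h' - h) ^ 3 / 6 * (\<integral>z. level_energy w h' z * ((\<Phi> z)\<^sup>2 * indicator {S..T} (fst z)) \<partial>lborel)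
    \<le> (8 * B / \<delta> * (\<integral>z. level_energy w h z * (\<Phi> z * indicator {S - \<delta>..T} (fst z)) \<partial>lborel))\<^sup>2"
proof -
  \<comment> \<open>The window for \<open>window_bound\<close> is the first quarter of \<open>[S - \<delta>, S]\<close>, and \<open>\<theta>\<close> rises in the last quarter.\<close>
  define b where "b = \<delta> / 8"
  define \<theta> where "\<theta> u = step ((u - (S - b)) / b) * step ((T + \<tau> / 2 - u) / (\<tau> / 2))" for u
  define \<theta>' where "\<theta>' u = mollifier b (u - (S - b)) * step ((T + \<tau> / 2 - u) / (\<tau> / 2))
    + (-1) * (mollifier (\<tau> / 2) (T + \<tau> / 2 - u) * step ((u - (S - b)) / b))" for u
  define \<kappa> where "\<kappa> u = mollifier b (u - (S - b))" for u
  let ?E = "level_energy w h" and ?E' = "level_energy w h'"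
  have b: "0 < b" "0 < \<tau> / 2" using t by (auto simp: b_def)
  note A = dissipative_pairD[OF d] and A' = dissipative_pairD[OF d']
  have C\<Phi>: "\<And>k. Ck k \<Phi>" and \<Phi>0: "\<And>p. 0 \<le> \<Phi> p" using \<Phi> unfolding cone_cutoff_def by blast+
  note P = Ck_partials[OF C\<Phi>]
  have sh: "smooth f \<Longrightarrow> smooth (\<lambda>u. f (u - c))" "smooth f \<Longrightarrow> smooth (\<lambda>u. f (c - u))" for f c
    using smooth_affine[of f 1 "-c"] smooth_affine[of f "-1" c] by simp_all
  have shift: "((\<lambda>u. u - c) has_real_derivative 1) (at u)" "((\<lambda>u. c - u) has_real_derivative - 1) (at u)" for c u :: real
    by (auto intro!: derivative_eq_intros)
  have sm\<theta>: "smooth \<theta>"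
    unfolding \<theta>_def by (intro smooth_mult sh[OF smooth_scaled_step])
  have der: "(\<theta> has_real_derivative \<theta>' u) (at u)" for u
    unfolding \<theta>_def \<theta>'_def
    by (rule DERIV_cong[OF DERIV_mult[OF DERIV_chain2[OF step_scaled_deriv[OF b(1)] shift(1)] DERIV_chain2[OF step_scaled_deriv[OF b(2)] shift(2)]]]) simp
  have sm\<theta>': "smooth \<theta>'"
  proof (rule smooth_derivE[OF sm\<theta>])
    fix f assume f: "\<And>x. (\<theta> has_real_derivative f x) (at x)" "smooth f"
    have "f = \<theta>'" using f(1) der DERIV_unique by blast
    then show ?thesis using f(2) by simp
  qed
  have \<theta>0: "0 \<le> \<theta> u" for u by (simp add: \<theta>_def step_nonneg)
  have \<kappa>0: "0 \<le> \<kappa> u" for u by (simp add: \<kappa>_def mollifier_nonneg[OF b(1)])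
  have \<theta>z: "\<theta> u = 0" if "u < S - 2 * b \<or> T + \<tau> < u" for u
  proof (cases "u < S - 2 * b")
    case True
    then have "step ((u - (S - b)) / b) = 0" using b by (intro step_left) (simp add: pos_divide_le_eq)
    then show ?thesis by (simp add: \<theta>_def)
  next
    case False
    then have "step ((T + \<tau> / 2 - u) / (\<tau> / 2)) = 0" using b that by (intro step_left) (simp add: pos_divide_le_eq)
    then show ?thesis by (simp add: \<theta>_def)
  qed
  have \<theta>1: "\<theta> u = 1" if "S \<le> u" "u \<le> T" for u
  proof -
    have "step ((u - (S - b)) / b) = 1" using b that by (intro step_right) (simp add: pos_le_divide_eq)
    moreover have "step ((T + \<tau> / 2 - u) / (\<tau> / 2)) = 1" using b that by (intro step_right) (simp add: pos_le_divide_eq)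
    ultimately show ?thesis by (simp add: \<theta>_def)
  qed
  have \<theta>\<kappa>: "\<theta>' u \<le> \<kappa> u" for u
  proof -
    have "\<kappa> u * step ((T + \<tau> / 2 - u) / (\<tau> / 2)) \<le> \<kappa> u * 1" by (intro mult_left_mono step_le_1 \<kappa>0)
    moreover have "0 \<le> mollifier (\<tau> / 2) (T + \<tau> / 2 - u) * step ((u - (S - b)) / b)"
      by (intro mult_nonneg_nonneg mollifier_nonneg b step_nonneg)
    ultimately show ?thesis by (simp add: \<theta>'_def \<kappa>_def)
  qed
  have \<kappa>c: "continuous_on UNIV \<kappa>"
    unfolding \<kappa>_def by (intro continuous_on_compose2[OF continuous_mollifier _ subset_UNIV] continuous_intros)
  have \<kappa>z: "\<kappa> u = 0" if "u < S - 2 * b \<or> S < u" for u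
    unfolding \<kappa>_def using that b by (intro mollifier_zero) (auto simp: abs_if)
  define I where "I = (\<integral>z. ?E z * (\<Phi> z * indicator {S - \<delta>..T} (fst z)) \<partial>lborel)"
  have ind: "(\<lambda>z :: real \<times> real. indicator {u..v} (fst z) :: real) \<in> borel_measurable borel" for u v :: real
    by (rule measurable_compose[OF borel_measurable_continuous_onI[OF continuous_on_fst[OF continuous_on_id]]],
        rule borel_measurable_indicator) simp
  have iI: "integrable lborel (\<lambda>z. (f z * indicator {u..v} (fst z)) * g z)"
    if "f \<in> borel_measurable borel" "\<And>z. \<bar>f z\<bar> \<le> M" "\<And>z. z \<notin> \<Omega> \<Longrightarrow> f z = 0" "continuous_on UNIV g" for f g :: "real \<times> real \<Rightarrow> real" and u v
  proof (rule integrable_bounded_times_continuous[where S=\<Omega> and M=M])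
    show "(\<lambda>z. f z * indicator {u..v} (fst z)) \<in> borel_measurable borel"
      by (intro borel_measurable_times that(1) ind)
    show "\<bar>f z * indicator {u..v} (fst z)\<bar> \<le> M" for z using that(2)[of z] by (auto simp: indicator_def)
    show "f z * indicator {u..v} (fst z) = 0" if "z \<notin> \<Omega>" for z
      using \<open>\<And>z. z \<notin> \<Omega> \<Longrightarrow> f z = 0\<close>[OF that] by simp
  qed (rule \<Omega> that(4))+
  have mb: "(\<integral>z. ?E z * (\<Phi> z * mollifier b (fst z - c)) \<partial>lborel) \<le> B / b * I" if c: "S - \<delta> \<le> c - b" "c + b \<le> T" for c
  proof -
    have "(\<integral>z. ?E z * (\<Phi> z * mollifier b (fst z - c)) \<partial>lborel) \<le> (\<integral>z. B / b * ((?E z * indicator {S - \<delta>..T} (fst z)) * \<Phi> z) \<partial>lborel)"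
    proof (rule integral_mono)
      show "integrable lborel (\<lambda>z. ?E z * (\<Phi> z * mollifier b (fst z - c)))"
        by (rule integrable_dissipative[OF d \<Omega>], intro continuous_on_mult P continuous_on_compose2[OF continuous_mollifier _ subset_UNIV] continuous_intros)
      show "integrable lborel (\<lambda>z. B / b * ((?E z * indicator {S - \<delta>..T} (fst z)) * \<Phi> z))"
        by (intro integrable_mult_right iI A(1) A(4) A(7) P)
      fix z :: "real \<times> real"
      have "mollifier b (fst z - c) \<le> B / b * indicator {S - \<delta>..T} (fst z)"
      proof (cases "b \<le> \<bar>fst z - c\<bar>")
        case True
        have "0 \<le> B" using B[of 2] bump_nonneg[of 2] by linarith
        then show ?thesis using True b by (simp add: mollifier_zero)
      next
        case False
        then have "fst z \<in> {S - \<delta>..T}" using c by auto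
        then show ?thesis using B b by (simp add: mollifier_def divide_right_mono)
      qed
      from mult_left_mono[OF this mult_nonneg_nonneg[OF A(3) \<Phi>0], of z z]
      show "?E z * (\<Phi> z * mollifier b (fst z - c)) \<le> B / b * ((?E z * indicator {S - \<delta>..T} (fst z)) * \<Phi> z)"
        by (simp add: mult_ac)
    qed
    also have "\<dots> = B / b * I" by (simp add: I_def mult_ac)
    finally show ?thesis .
  qed
  have "(h' - h) ^ 3 / 6 * (\<integral>z. ?E' z * ((\<Phi> z)\<^sup>2 * indicator {S..T} (fst z)) \<partial>lborel)
     \<le> (h' - h) ^ 3 / 6 * (\<integral>z. ?E' z * ((\<Phi> z)\<^sup>2 * \<theta> (fst z)) \<partial>lborel)"
  proof (rule mult_left_mono[OF integral_mono])
    have "integrable lborel (\<lambda>z. (?E' z * indicator {S..T} (fst z)) * (\<Phi> z)\<^sup>2)"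
      by (intro iI A'(1) A'(4) A'(7) continuous_on_power P)
    then show "integrable lborel (\<lambda>z. ?E' z * ((\<Phi> z)\<^sup>2 * indicator {S..T} (fst z)))" by (simp add: mult_ac)
    show "integrable lborel (\<lambda>z. ?E' z * ((\<Phi> z)\<^sup>2 * \<theta> (fst z)))"
      by (rule integrable_dissipative[OF d' \<Omega>], intro continuous_on_mult continuous_on_power P
         continuous_on_compose2[OF smooth_continuous[OF sm\<theta>] _ subset_UNIV] continuous_intros)
    show "?E' z * ((\<Phi> z)\<^sup>2 * indicator {S..T} (fst z)) \<le> ?E' z * ((\<Phi> z)\<^sup>2 * \<theta> (fst z))" for z
      using \<theta>0 \<theta>1 by (intro mult_left_mono A'(3) zero_le_power2) (auto simp: indicator_def)
  qed (use hh in auto)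
  also have "\<dots> \<le> (\<integral>z. ?E z * (\<Phi> z * \<kappa> (fst z)) \<partial>lborel) * (\<integral>z. ?E z * (\<Phi> z * mollifier b (fst z - (S - \<delta> + b))) \<partial>lborel)"
  proof (rule level_interaction[OF s d d' hh \<Omega> \<Phi> K sm\<theta> der sm\<theta>' \<theta>0 \<theta>z \<theta>\<kappa> \<kappa>c \<kappa>0 _ b(1)])
    show "\<kappa> u = 0" if "u < S - 2 * b \<or> T + \<tau> < u" for u using that \<kappa>z[of u] t by auto
  qed (use t in \<open>auto simp: b_def\<close>)
  also have "\<dots> \<le> (B / b * I) * (B / b * I)"
  proof (rule mult_mono)
    show "(\<integral>z. ?E z * (\<Phi> z * \<kappa> (fst z)) \<partial>lborel) \<le> B / b * I"
      unfolding \<kappa>_def using t by (intro mb) (auto simp: b_def)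
    show "(\<integral>z. ?E z * (\<Phi> z * mollifier b (fst z - (S - \<delta> + b))) \<partial>lborel) \<le> B / b * I"
      using t by (intro mb) (auto simp: b_def)
    show "0 \<le> (\<integral>z. ?E z * (\<Phi> z * mollifier b (fst z - (S - \<delta> + b))) \<partial>lborel)"
      by (intro Bochner_Integration.integral_nonneg mult_nonneg_nonneg A(3) \<Phi>0 mollifier_nonneg b)
    have "0 \<le> B" using B[of 2] bump_nonneg[of 2] by linarith
    then show "0 \<le> B / b * I"
      unfolding I_def using b by (intro mult_nonneg_nonneg Bochner_Integration.integral_nonneg A(3) \<Phi>0) auto
  qed
  also have "\<dots> = (8 * B / \<delta> * I)\<^sup>2" by (simp add: b_def power2_eq_square)
  finally show ?thesis unfolding I_def .
qed

text \<open>
  The smallness condition is invariant under the scaling of \<open>(t, x)\<close> by \<open>r\<close>: the constant \<open>\<delta>\<close> does not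
  depend on \<open>r\<close>. The box is a neighbourhood of the ball that contains everything that can influence
  it at speed \<open>\<Lambda>\<close> during the times involved.
\<close>

lemma de_giorgi:
  fixes w :: "real \<times> real \<Rightarrow> real"
  assumes s: "s = 1 \<or> s = -1" and d: "0 < d" and L: "0 \<le> \<Lambda>" and \<Omega>: "bounded \<Omega>"
    and diss: "\<And>h. k \<le> h \<Longrightarrow> h \<le> k + d \<Longrightarrow> dissipative_pair \<Omega> \<Lambda> M (level_energy w h) (level_flux s w h)"
    and w: "w \<in> borel_measurable borel"
  shows "\<exists>\<delta>>0. \<forall>t0 x0 r. 0 < r \<longrightarrow>
      cbox (t0 - 3 * r, x0 - (3 + 4 * \<Lambda>) * r) (t0 + 3 * r, x0 + (3 + 4 * \<Lambda>) * r) \<subseteq> \<Omega> \<longrightarrow>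
      measure lborel ({p. k < w p} \<inter> cbox (t0 - 3 * r, x0 - (3 + 4 * \<Lambda>) * r) (t0 + 3 * r, x0 + (3 + 4 * \<Lambda>) * r)) \<le> \<delta> * r\<^sup>2 \<longrightarrow>
      (AE p in lborel. p \<in> ball (t0, x0) r \<longrightarrow> w p \<le> k + d)"
proof -
  obtain B where B: "0 < B" "\<And>u. bump u \<le> B" using bump_bounded by metis
  have M: "0 \<le> M" using dissipative_pairD(3,4)[OF diss[of k], of "(0,0)"] d by simp
  \<comment> \<open>For steps of size \<open>d / 2 ^ Suc n\<close> in the level and \<open>r / 2 ^ Suc n\<close> in time, \<open>de_giorgi_step\<close> yields the
      factor \<open>c0 / r\<^sup>2 * 32 ^ n\<close>.\<close>
  define c0 where "c0 = 6 * 8 * (16 * B)\<^sup>2 / d ^ 3"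
  have c0: "0 < c0" using B d by (simp add: c0_def)
  \<comment> \<open>This makes \<open>c0 / r\<^sup>2 * 32 * X 0\<close> at most \<open>1 / 2\<close>, as \<open>iteration_decay\<close> requires.\<close>
  define \<delta> where "\<delta> = 1 / (64 * c0 * (M + 1))"
  have \<delta>: "0 < \<delta>" using c0 M by (simp add: \<delta>_def)
  show ?thesis
  proof (intro exI[of _ \<delta>] conjI \<delta> allI impI)
    fix t0 x0 r :: real
    let ?K = "cbox (t0 - 3 * r, x0 - (3 + 4 * \<Lambda>) * r) (t0 + 3 * r, x0 + (3 + 4 * \<Lambda>) * r)"
    assume r: "0 < r" and K: "?K \<subseteq> \<Omega>" and small: "measure lborel ({p. k < w p} \<inter> ?K) \<le> \<delta> * r\<^sup>2"
    obtain \<Phi> where \<Phi>: "cone_cutoff \<Lambda> \<Phi>" "\<And>p. \<Phi> p \<le> 1"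
      "\<And>t x. \<bar>t - t0\<bar> \<le> r \<Longrightarrow> \<bar>x - x0\<bar> \<le> r \<Longrightarrow> \<Phi> (t, x) = 1"
      "\<And>t x. \<bar>t - t0\<bar> \<le> 3 * r \<Longrightarrow> \<Phi> (t, x) \<noteq> 0 \<Longrightarrow> \<bar>x - x0\<bar> \<le> (3 + 4 * \<Lambda>) * r"
      by (rule cone_cutoff_exists[OF r L, of t0 x0]) blast
    have \<Phi>0: "\<And>p. 0 \<le> \<Phi> p" and C\<Phi>: "\<And>k. Ck k \<Phi>" using \<Phi>(1) unfolding cone_cutoff_def by blast+
    define h where "h n = k + d * (1 - (1/2) ^ n)" for n :: nat
    define S where "S n = t0 - r - r * (1/2) ^ n" for n :: nat
    define \<Psi> where "\<Psi> n p = \<Phi> p ^ (2 ^ n)" for n :: nat and p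
    have hk: "k \<le> h n" "h n \<le> k + d" for n
    proof -
      have "(1/2::real) ^ n \<le> 1" by (simp add: power_le_one)
      then show "k \<le> h n" using d by (simp add: h_def)
      show "h n \<le> k + d" using d by (simp add: h_def algebra_simps)
    qed
    define X where "X n = (\<integral>z. level_energy w (h n) z * (\<Psi> n z * indicator {S n..t0 + r} (fst z)) \<partial>lborel)" for n
    have dp: "dissipative_pair \<Omega> \<Lambda> M (level_energy w (h n)) (level_flux s w (h n))" for n
      using diss hk by blast
    have cc: "cone_cutoff \<Lambda> (\<Psi> n)" for n unfolding \<Psi>_def by (rule cone_cutoff_power[OF L \<Phi>(1)])
    have \<Psi>0: "0 \<le> \<Psi> n p" for n p by (simp add: \<Psi>_def \<Phi>0)
    have X0: "0 \<le> X n" for n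
      unfolding X_def by (intro Bochner_Integration.integral_nonneg mult_nonneg_nonneg dissipative_pairD(3)[OF dp] \<Psi>0) auto
    have step: "X (Suc n) \<le> (c0 / r\<^sup>2) * 32 ^ n * (X n)\<^sup>2" for n
    proof -
      have S1: "S (Suc n) - S n = r * (1/2) ^ Suc n" by (simp add: S_def)
      have Srange: "t0 - 2 * r \<le> S m" "S m < t0 + r" for m
      proof -
        have "(1/2::real) ^ m \<le> 1" by (simp add: power_le_one)
        then have "r * (1/2::real) ^ m \<le> r" using r by simp
        then show "t0 - 2 * r \<le> S m" by (simp add: S_def)
        have "0 < r * (1/2::real) ^ m" using r by simp
        then show "S m < t0 + r" unfolding S_def using r by linarith
      qed
      have "(h (Suc n) - h n) ^ 3 / 6 * (\<integral>z. level_energy w (h (Suc n)) z * ((\<Psi> n z)\<^sup>2 * indicator {S (Suc n)..t0 + r} (fst z)) \<partial>lborel)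
        \<le> (8 * B / (S (Suc n) - S n) * (\<integral>z. level_energy w (h n) z * (\<Psi> n z * indicator {S (Suc n) - (S (Suc n) - S n)..t0 + r} (fst z)) \<partial>lborel))\<^sup>2"
      proof (rule de_giorgi_step[OF s dp dp _ \<Omega> cc _ K _ _ r _ B(2)])
        show "h n < h (Suc n)" using d by (simp add: h_def)
        show "compact ?K" by simp
        show "S (Suc n) < t0 + r" by (rule Srange)
        show "0 < S (Suc n) - S n" unfolding S1 using r by simp
        fix t x assume t: "S (Suc n) - (S (Suc n) - S n) \<le> t" "t \<le> t0 + r + 2 * r" "\<Psi> n (t, x) \<noteq> 0"
        then have "\<bar>t - t0\<bar> \<le> 3 * r" using Srange(1)[of n] r by (auto simp: abs_le_iff)
        moreover have "\<Phi> (t, x) \<noteq> 0" using t(3) by (auto simp: \<Psi>_def)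
        ultimately have "\<bar>x - x0\<bar> \<le> (3 + 4 * \<Lambda>) * r" by (rule \<Phi>(4))
        then show "(t, x) \<in> ?K" using \<open>\<bar>t - t0\<bar> \<le> 3 * r\<close> by (auto simp: cbox_Pair_eq abs_le_iff)
      qed
      also have "(\<lambda>z. level_energy w (h (Suc n)) z * ((\<Psi> n z)\<^sup>2 * indicator {S (Suc n)..t0 + r} (fst z)))
         = (\<lambda>z. level_energy w (h (Suc n)) z * (\<Psi> (Suc n) z * indicator {S (Suc n)..t0 + r} (fst z)))"
        by (simp add: \<Psi>_def power2_eq_square power_add[symmetric] mult_2)
      finally have "(h (Suc n) - h n) ^ 3 / 6 * X (Suc n) \<le> (8 * B / (S (Suc n) - S n) * X n)\<^sup>2"
        by (simp add: X_def)
      moreover have "h (Suc n) - h n = d / 2 ^ Suc n" by (simp add: h_def power_one_over field_simps)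
      moreover have "S (Suc n) - S n = r / 2 ^ Suc n" unfolding S1 by (simp add: power_one_over)
      ultimately have *: "(d / 2 ^ Suc n) ^ 3 / 6 * X (Suc n) \<le> (8 * B / (r / 2 ^ Suc n) * X n)\<^sup>2" by simp
      have "X (Suc n) = (6 * (2 ^ Suc n / d) ^ 3) * ((d / 2 ^ Suc n) ^ 3 / 6 * X (Suc n))"
        using d by (simp add: power_divide)
      also have "\<dots> \<le> (6 * (2 ^ Suc n / d) ^ 3) * (8 * B / (r / 2 ^ Suc n) * X n)\<^sup>2"
        using d by (intro mult_left_mono *) auto
      also have "\<dots> = (c0 / r\<^sup>2) * ((2 ^ n) ^ 3 * (2 ^ n)\<^sup>2) * (X n)\<^sup>2"
        using d r by (simp add: c0_def power_divide power_mult_distrib field_simps)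
      also have "((2::real) ^ n) ^ 3 * (2 ^ n)\<^sup>2 = 32 ^ n"
        by (simp add: power_mult[symmetric] power_add[symmetric] power_mult mult.commute[of n] flip: power_mult_distrib)
      finally show ?thesis .
    qed
    have "X 0 \<le> M * (\<delta> * r\<^sup>2)"
    proof -
      have mK: "{p. k < w p} \<inter> ?K \<in> sets lborel" "emeasure lborel ({p. k < w p} \<inter> ?K) < \<infinity>"
      proof -
        have "{p. k < w p} \<in> sets borel" using borel_measurable_less[OF borel_measurable_const w] by simp
        then show "{p. k < w p} \<inter> ?K \<in> sets lborel" by simp
        show "emeasure lborel ({p. k < w p} \<inter> ?K) < \<infinity>"
          by (intro emeasure_bounded_finite bounded_Int) simp
      qed
      have "X 0 \<le> (\<integral>z. M * indicator ({p. k < w p} \<inter> ?K) z \<partial>lborel)"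
        unfolding X_def
      proof (rule integral_mono')
        show "integrable lborel (\<lambda>z. M * indicator ({p. k < w p} \<inter> ?K) z)"
          using mK by (intro integrable_mult_right integrable_real_indicator)
        show "0 \<le> M * indicator ({p. k < w p} \<inter> ?K) z" for z using M by simp
        fix z :: "real \<times> real"
        show "level_energy w (h 0) z * (\<Psi> 0 z * indicator {S 0..t0 + r} (fst z)) \<le> M * indicator ({p. k < w p} \<inter> ?K) z"
        proof (cases "k < w z \<and> \<Phi> z \<noteq> 0 \<and> fst z \<in> {S 0..t0 + r}")
          case True
          obtain t x where z: "z = (t, x)" by (cases z)
          have "\<bar>t - t0\<bar> \<le> 3 * r" using True r by (auto simp: S_def z abs_le_iff)
          moreover from this have "\<bar>x - x0\<bar> \<le> (3 + 4 * \<Lambda>) * r" using True by (intro \<Phi>(4)) (auto simp: z)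
          ultimately have "z \<in> ?K" by (auto simp: z cbox_Pair_eq abs_le_iff)
          moreover have "level_energy w (h 0) z * (\<Psi> 0 z * indicator {S 0..t0 + r} (fst z)) \<le> M * 1"
            using dissipative_pairD(3,4)[OF dp, of 0 z] \<Phi>(2)[of z] \<Phi>0[of z] True
            by (intro mult_mono) (auto simp: \<Psi>_def)
          ultimately show ?thesis using True by simp
        next
          case False
          then have "level_energy w (h 0) z * (\<Psi> 0 z * indicator {S 0..t0 + r} (fst z)) = 0"
            by (auto simp: h_def level_energy_def pos_sq_zero \<Psi>_def)
          then show ?thesis using M by (simp only: zero_le_mult_iff) simp
        qed
      qed
      also have "\<dots> = M * measure lborel ({p. k < w p} \<inter> ?K)"
        using mK by simp
      also have "\<dots> \<le> M * (\<delta> * r\<^sup>2)" using small M by (intro mult_left_mono)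
      finally show ?thesis .
    qed
    then have "(c0 / r\<^sup>2) * 32 * X 0 \<le> (c0 / r\<^sup>2) * 32 * (M * (\<delta> * r\<^sup>2))"
      using c0 by (intro mult_left_mono) auto
    also have "\<dots> = (M / (M + 1)) / 2"
    proof -
      have "(c0 / r\<^sup>2) * 32 * (M * (1 / (64 * c0 * N) * r\<^sup>2)) = (M / N) / 2" if "0 < N" for N
        using r c0 that by (simp add: field_simps)
      from this[of "M + 1"] show ?thesis using M by (simp add: \<delta>_def)
    qed
    also have "\<dots> \<le> 1 / 2" using M by simp
    finally have "(c0 / r\<^sup>2) * 32 * X 0 \<le> 1 / 2" .
    with X0 step c0 r have lim: "X \<longlonglongrightarrow> 0" by (intro iteration_decay[of X "c0 / r\<^sup>2"]) auto
    define core where "core = cbox (t0 - r, x0 - r) (t0 + r, x0 + r)"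
    let ?E = "level_energy w (k + d)"
    have dk: "dissipative_pair \<Omega> \<Lambda> M ?E (level_flux s w (k + d))" using diss d by simp
    have iE: "integrable lborel (\<lambda>z. ?E z * indicator core z)"
    proof -
      have "integrable lborel (\<lambda>z. (?E z * indicator core z) * 1)"
        by (rule integrable_bounded_times_continuous[where S=\<Omega> and M=M])
          (use dissipative_pairD[OF dk] \<Omega> in \<open>auto simp: core_def indicator_def M intro!: borel_measurable_times simp del: split_paired_All split_paired_all\<close>)
      then show ?thesis by simp
    qed
    have le: "(\<integral>z. ?E z * indicator core z \<partial>lborel) \<le> X n" for n
      unfolding X_def
    proof (rule integral_mono[OF iE])
      have Sn: "S n \<le> t0 - r" using r by (simp add: S_def)
      have c: "continuous_on UNIV (\<lambda>z. \<Psi> n z)"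
        using cc[of n] Ck_partials(3)[of "\<Psi> n"] unfolding cone_cutoff_def by auto
      have "integrable lborel (\<lambda>z. (level_energy w (h n) z * indicator {S n..t0 + r} (fst z)) * \<Psi> n z)"
      proof (rule integrable_bounded_times_continuous[where S=\<Omega> and M=M, OF _ _ _ \<Omega> c])
        have "(\<lambda>z :: real \<times> real. indicator {S n..t0 + r} (fst z) :: real) \<in> borel_measurable borel"
          by (rule measurable_compose[OF borel_measurable_continuous_onI[OF continuous_on_fst[OF continuous_on_id]]],
        rule borel_measurable_indicator) simp
        then show "(\<lambda>z. level_energy w (h n) z * indicator {S n..t0 + r} (fst z)) \<in> borel_measurable borel"
          by (intro borel_measurable_times dissipative_pairD(1)[OF dp])
        show "\<bar>level_energy w (h n) z * indicator {S n..t0 + r} (fst z)\<bar> \<le> M" for z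
          using dissipative_pairD(4)[OF dp, of n z] M by (auto simp: indicator_def)
        show "level_energy w (h n) z * indicator {S n..t0 + r} (fst z) = 0" if "z \<notin> \<Omega>" for z
          using dissipative_pairD(7)[OF dp that] by simp
      qed
      then show "integrable lborel (\<lambda>z. level_energy w (h n) z * (\<Psi> n z * indicator {S n..t0 + r} (fst z)))"
        by (simp add: mult_ac)
      fix z :: "real \<times> real"
      show "?E z * indicator core z \<le> level_energy w (h n) z * (\<Psi> n z * indicator {S n..t0 + r} (fst z))"
      proof (rule mult_mono)
        show "?E z \<le> level_energy w (h n) z" by (rule level_energy_antimono[OF hk(2)])
        show "0 \<le> level_energy w (h n) z" by (rule dissipative_pairD(3)[OF dp])
        obtain t x where z: "z = (t, x)" by (cases z)
        show "indicator core z \<le> \<Psi> n z * indicator {S n..t0 + r} (fst z)"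
        proof (cases "z \<in> core")
          case True
          then have "\<bar>t - t0\<bar> \<le> r" "\<bar>x - x0\<bar> \<le> r" by (auto simp: core_def z cbox_Pair_eq abs_le_iff)
          moreover from this have "\<Phi> z = 1" unfolding z by (intro \<Phi>(3))
          ultimately show ?thesis using Sn by (auto simp: \<Psi>_def z indicator_def abs_le_iff)
        next
          case False
          then show ?thesis using \<Psi>0[of n z] by (simp add: indicator_def)
        qed
      qed simp
    qed
    have "(\<integral>z. ?E z * indicator core z \<partial>lborel) \<le> 0"
      by (rule LIMSEQ_le_const[OF lim]) (use le in auto)
    moreover have "0 \<le> (\<integral>z. ?E z * indicator core z \<partial>lborel)"
      by (intro Bochner_Integration.integral_nonneg mult_nonneg_nonneg dissipative_pairD(3)[OF dk]) auto
    ultimately have "(\<integral>z. ?E z * indicator core z \<partial>lborel) = 0" by simp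
    then have "AE z in lborel. ?E z * indicator core z = 0"
      using integral_nonneg_eq_0_iff_AE[OF iE] dissipative_pairD(3)[OF dk] by auto
    then show "AE p in lborel. p \<in> ball (t0, x0) r \<longrightarrow> w p \<le> k + d"
    proof (rule eventually_mono, intro impI)
      fix p assume p: "?E p * indicator core p = 0" "p \<in> ball (t0, x0) r"
      obtain t x where tx: "p = (t, x)" by (cases p)
      have "dist t0 t \<le> dist (t0, x0) p" "dist x0 x \<le> dist (t0, x0) p"
        using dist_fst_le[of "(t0, x0)" p] dist_snd_le[of "(t0, x0)" p] by (simp_all add: tx)
      then have "p \<in> core" using p(2) by (auto simp: core_def tx cbox_Pair_eq dist_real_def)
      then have "pos_sq (w p - (k + d)) = 0" using p(1) by (simp add: level_energy_def)
      then show "w p \<le> k + d" by (simp add: pos_sq_def)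
    qed
  qed
qed

section \<open>Semicontinuity of the Riemann invariants\<close>

lemma lebesgue_integral_eq_lborel:
  fixes f g :: "real \<times> real \<Rightarrow> real"
  assumes "AE p in lebesgue. (if p \<in> half_plane then f p else 0) = g p" "g \<in> borel_measurable borel"
  shows "(LINT p|lebesgue_on half_plane. f p) = (\<integral>p. g p \<partial>lborel)"
proof -
  have g: "g \<in> borel_measurable lebesgue" using assms(2) by (simp add: measurable_completion)
  have "AE p in lebesgue. g p = (if p \<in> half_plane then f p else 0)" using assms(1) by (rule eventually_mono) simp
  then have f: "(\<lambda>p. if p \<in> half_plane then f p else 0) \<in> borel_measurable lebesgue"
    using borel_measurable_AE[OF g] by simp
  have "(LINT p|lebesgue_on half_plane. f p) = (\<integral>p. (if p \<in> half_plane then f p else 0) \<partial>lebesgue)"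
    by (rule Lebesgue_Measure.integral_restrict_UNIV[OF half_plane_lebesgue, symmetric])
  also have "\<dots> = (\<integral>p. g p \<partial>lebesgue)" by (rule integral_cong_AE[OF f g assms(1)])
  also have "\<dots> = (\<integral>p. g p \<partial>lborel)" using assms(2) by (intro integral_completion) simp
  finally show ?thesis .
qed

lemma borel_representative:
  fixes f :: "real \<times> real \<Rightarrow> real"
  assumes "f \<in> borel_measurable (lebesgue_on half_plane)"
  obtains f' where "f' \<in> borel_measurable borel" "AE p in lebesgue. p \<in> half_plane \<longrightarrow> f p = f' p"
proof -
  have "(\<lambda>p. if p \<in> half_plane then f p else 0) \<in> borel_measurable (completion lborel)"
    by (rule borel_measurable_if_I[OF assms half_plane_lebesgue])
  from completion_ex_borel_measurable_real[OF this]
  obtain f' where f': "f' \<in> borel_measurable lborel" "AE p in lborel. (if p \<in> half_plane then f p else 0) = f' p" by blast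
  have "AE p in lebesgue. (if p \<in> half_plane then f p else 0) = f' p"
    using f'(2) by (simp only: AE_completion_iff)
  then have "AE p in lebesgue. p \<in> half_plane \<longrightarrow> f p = f' p" by (rule eventually_mono) (simp split: if_splits)
  with f'(1) show ?thesis by (intro that[of f']) simp_all
qed

lemma pos_flux_eq: "pos_flux h y = pos_sq y * (h + 2 / 3 * max 0 y)"
  by (simp add: pos_flux_def pos_sq_def power2_eq_square power3_eq_cube algebra_simps)

text \<open>
  In \<open>\<Omega>\<close> the smaller of the two shifted invariants is not positive, so that only the larger one, \<open>W - h\<close>,
  contributes to the kinetic entropy and its flux.
\<close>

lemma local_dissipative_pair:
  fixes \<rho> m W :: "real \<times> real \<Rightarrow> real"
  assumes sol: "bounded_entropy_solution \<rho> m" and s: "s = 1 \<or> s = -1"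
    and \<Omega>: "open \<Omega>" "\<Omega> \<subseteq> half_plane" "bounded \<Omega>"
    and W: "W \<in> borel_measurable borel" "\<And>p. W p \<le> C" "\<And>p. p \<notin> \<Omega> \<Longrightarrow> W p \<le> k"
    and ae: "AE p in lebesgue. p \<in> \<Omega> \<longrightarrow> 0 < \<rho> p \<and> W p = s * (m p / \<rho> p) + \<rho> p / 2 \<and> s * (m p / \<rho> p) - \<rho> p / 2 \<le> k"
    and h: "k \<le> h" "h \<le> k + d" and C: "k \<le> C"
  shows "dissipative_pair \<Omega> (\<bar>k\<bar> + \<bar>d\<bar> + (C - k)) ((C - k)\<^sup>2) (level_energy W h) (level_flux s W h)"
proof -
  let ?E = "level_energy W h" and ?F = "level_flux s W h"
  define \<Lambda> where "\<Lambda> = \<bar>k\<bar> + \<bar>d\<bar> + (C - k)"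
  have s2: "s\<^sup>2 = 1" "\<bar>s\<bar> = 1" using s by auto
  have cont: "continuous_on UNIV pos_sq" "continuous_on UNIV (pos_flux h)"
    unfolding pos_sq_def pos_flux_def by (intro continuous_intros; simp)+
  have mE: "?E \<in> borel_measurable borel"
    unfolding level_energy_def
    by (rule measurable_compose[OF _ borel_measurable_continuous_onI[OF cont(1)]]) (use W(1) in measurable)
  have mF: "?F \<in> borel_measurable borel"
    unfolding level_flux_def
    by (intro borel_measurable_times borel_measurable_const measurable_compose[OF _ borel_measurable_continuous_onI[OF cont(2)]])
      (use W(1) in measurable)
  have b: "0 \<le> ?E p" "?E p \<le> (C - k)\<^sup>2" "\<bar>?F p\<bar> \<le> \<Lambda> * ?E p" for p
  proof -
    show E0: "0 \<le> ?E p" by (simp add: level_energy_def pos_sq_nonneg)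
    have y: "max 0 (W p - h) \<le> C - k" using W(2)[of p] h C by simp
    then have "(max 0 (W p - h))\<^sup>2 \<le> (C - k)\<^sup>2" by (intro power_mono) auto
    moreover have "0 \<le> (C - k)\<^sup>2" by simp
    ultimately show "?E p \<le> (C - k)\<^sup>2" unfolding level_energy_def pos_sq_def by linarith
    have "\<bar>h + 2 / 3 * max 0 (W p - h)\<bar> \<le> \<Lambda>"
    proof -
      have "\<bar>h\<bar> \<le> \<bar>k\<bar> + \<bar>d\<bar>" using h by linarith
      then have "\<bar>h + 2 / 3 * x\<bar> \<le> \<bar>k\<bar> + \<bar>d\<bar> + (C - k)" if "0 \<le> x" "x \<le> C - k" for x
        using that by linarith
      from this[OF _ y] show ?thesis unfolding \<Lambda>_def by simp
    qed
    then have "?E p * \<bar>h + 2 / 3 * max 0 (W p - h)\<bar> \<le> ?E p * \<Lambda>" using E0 by (rule mult_left_mono)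
    then show "\<bar>?F p\<bar> \<le> \<Lambda> * ?E p"
      unfolding level_flux_def pos_flux_eq level_energy_def
      using s2 pos_sq_nonneg[of "W p - h"] by (simp add: abs_mult mult.commute)
  qed
  have z: "?E p = 0" "?F p = 0" if "p \<notin> \<Omega>" for p
  proof -
    show "?E p = 0" using W(3)[OF that] h by (simp add: level_energy_def pos_sq_zero)
    then show "?F p = 0" using b(3)[of p] by simp
  qed
  have weak: "0 \<le> (\<integral>p. ?E p * pd1 \<phi> p + ?F p * pd2 \<phi> p \<partial>lborel)"
    if \<phi>: "\<And>k. Ck k \<phi>" "\<And>p. 0 \<le> \<phi> p" and K: "compact K" "K \<subseteq> \<Omega>" "\<And>p. p \<notin> K \<Longrightarrow> \<phi> p = 0" for \<phi> K
  proof -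
    note P = Ck_partials[OF \<phi>(1)]
    have out: "pd1 \<phi> p = 0" "pd2 \<phi> p = 0" if "p \<notin> K" for p
    proof -
      show "pd1 \<phi> p = 0"
        by (rule derivative_outside_support[OF P(1) K(1,3)]) (use that in \<open>auto intro: continuous_intros\<close>)
      show "pd2 \<phi> p = 0"
        by (rule derivative_outside_support[OF P(2) K(1,3)]) (use that in \<open>auto intro: continuous_intros\<close>)
    qed
    have tf: "test_function \<phi>" unfolding test_function_def using \<phi>(1) K \<Omega>(2) by blast
    let ?\<eta> = "\<lambda>p. with_vacuum (kin_entropy s h) 0 (\<rho> p, m p)" and ?q = "\<lambda>p. with_vacuum (kin_flux s h) 0 (\<rho> p, m p)"
    have "dist_d1 ?\<eta> \<phi> + dist_d2 ?q \<phi> \<le> 0"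
    proof -
      have "\<forall>\<eta> q a b. entropy_pair \<eta> q \<and> vacuum_limit \<eta> a \<and> vacuum_limit q b \<longrightarrow>
        (\<forall>\<phi>. test_function \<phi> \<and> (\<forall>p. 0 \<le> \<phi> p) \<longrightarrow>
           dist_d1 (\<lambda>p. with_vacuum \<eta> a (\<rho> p, m p)) \<phi> + dist_d2 (\<lambda>p. with_vacuum q b (\<rho> p, m p)) \<phi> \<le> 0)"
        using sol unfolding bounded_entropy_solution_def by (elim conjE)
      then show ?thesis
        using entropy_pair_kin[OF s2(1)] vacuum_limit_kin[OF s2(2)] tf \<phi>(2) by blast
    qed
    moreover have "(LINT p|lebesgue_on half_plane. ?\<eta> p * pd1 \<phi> p) = (\<integral>p. ?E p * pd1 \<phi> p \<partial>lborel)"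
      "(LINT p|lebesgue_on half_plane. ?q p * pd2 \<phi> p) = (\<integral>p. ?F p * pd2 \<phi> p \<partial>lborel)"
    proof -
      have eq: "?\<eta> p = ?E p \<and> ?q p = ?F p" if "0 < \<rho> p \<and> W p = s * (m p / \<rho> p) + \<rho> p / 2 \<and> s * (m p / \<rho> p) - \<rho> p / 2 \<le> k" for p
      proof -
        have "shifted_invariant s (1/2) h (\<rho> p, m p) = W p - h" using that by (simp add: shifted_invariant_def)
        moreover have "shifted_invariant s (-1/2) h (\<rho> p, m p) \<le> 0" using that h by (simp add: shifted_invariant_def)
        then have "pos_sq (shifted_invariant s (-1/2) h (\<rho> p, m p)) = 0" by (rule pos_sq_zero)
        moreover from this have "pos_flux h (shifted_invariant s (-1/2) h (\<rho> p, m p)) = 0" by (simp add: pos_flux_eq)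
        ultimately show ?thesis
          using that by (simp add: with_vacuum_def kin_entropy_def kin_flux_def level_energy_def level_flux_def)
      qed
      show "(LINT p|lebesgue_on half_plane. ?\<eta> p * pd1 \<phi> p) = (\<integral>p. ?E p * pd1 \<phi> p \<partial>lborel)"
      proof (rule lebesgue_integral_eq_lborel)
        show "AE p in lebesgue. (if p \<in> half_plane then ?\<eta> p * pd1 \<phi> p else 0) = ?E p * pd1 \<phi> p"
          using ae
        proof (rule eventually_mono)
          fix p assume "p \<in> \<Omega> \<longrightarrow> 0 < \<rho> p \<and> W p = s * (m p / \<rho> p) + \<rho> p / 2 \<and> s * (m p / \<rho> p) - \<rho> p / 2 \<le> k"
          then show "(if p \<in> half_plane then ?\<eta> p * pd1 \<phi> p else 0) = ?E p * pd1 \<phi> p"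
            using eq[of p] out[of p] K(2) \<Omega>(2) by (cases "p \<in> \<Omega>") auto
        qed
        show "(\<lambda>p. ?E p * pd1 \<phi> p) \<in> borel_measurable borel"
          by (intro borel_measurable_times mE borel_measurable_continuous_onI P)
      qed
      show "(LINT p|lebesgue_on half_plane. ?q p * pd2 \<phi> p) = (\<integral>p. ?F p * pd2 \<phi> p \<partial>lborel)"
      proof (rule lebesgue_integral_eq_lborel)
        show "AE p in lebesgue. (if p \<in> half_plane then ?q p * pd2 \<phi> p else 0) = ?F p * pd2 \<phi> p"
          using ae
        proof (rule eventually_mono)
          fix p assume "p \<in> \<Omega> \<longrightarrow> 0 < \<rho> p \<and> W p = s * (m p / \<rho> p) + \<rho> p / 2 \<and> s * (m p / \<rho> p) - \<rho> p / 2 \<le> k"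
          then show "(if p \<in> half_plane then ?q p * pd2 \<phi> p else 0) = ?F p * pd2 \<phi> p"
            using eq[of p] out[of p] K(2) \<Omega>(2) by (cases "p \<in> \<Omega>") auto
        qed
        show "(\<lambda>p. ?F p * pd2 \<phi> p) \<in> borel_measurable borel"
          by (intro borel_measurable_times mF borel_measurable_continuous_onI P)
      qed
    qed
    ultimately have "0 \<le> (\<integral>p. ?E p * pd1 \<phi> p \<partial>lborel) + (\<integral>p. ?F p * pd2 \<phi> p \<partial>lborel)"
      unfolding dist_d1_def dist_d2_def by linarith
    also have "\<dots> = (\<integral>p. ?E p * pd1 \<phi> p + ?F p * pd2 \<phi> p \<partial>lborel)"
    proof (rule Bochner_Integration.integral_add[symmetric])
      show "integrable lborel (\<lambda>p. ?E p * pd1 \<phi> p)"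
      proof (rule integrable_bounded_times_continuous[OF mE _ _ \<Omega>(3) P(4)])
        show "\<bar>?E p\<bar> \<le> (C - k)\<^sup>2" for p using b(1,2)[of p] by simp
      qed (rule z)
      show "integrable lborel (\<lambda>p. ?F p * pd2 \<phi> p)"
      proof (rule integrable_bounded_times_continuous[OF mF _ _ \<Omega>(3) P(5)])
        have "0 \<le> \<Lambda>" using C by (simp add: \<Lambda>_def)
        then have "\<Lambda> * ?E p \<le> \<Lambda> * (C - k)\<^sup>2" for p using b(2) by (intro mult_left_mono) auto
        then show "\<bar>?F p\<bar> \<le> \<Lambda> * (C - k)\<^sup>2" for p using b(3)[of p] order_trans by blast
      qed (rule z)
    qed
    finally show ?thesis .
  qed
  show ?thesis
    unfolding dissipative_pair_def \<Lambda>_def[symmetric]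
  proof (intro conjI allI impI mE mF b z)
    fix \<phi> K assume "(\<forall>k. Ck k \<phi>) \<and> (\<forall>p. 0 \<le> \<phi> p) \<and> compact K \<and> K \<subseteq> \<Omega> \<and> (\<forall>p. p \<notin> K \<longrightarrow> \<phi> p = 0)"
    then show "0 \<le> (\<integral>p. ?E p * pd1 \<phi> p + ?F p * pd2 \<phi> p \<partial>lborel)" by (intro weak[of \<phi> K]) blast+
  qed
qed

lemma measure_ball_le:
  assumes "0 \<le> r" shows "measure lebesgue (ball (p :: real \<times> real) r) \<le> 4 * r\<^sup>2"
proof -
  obtain t x where p: "p = (t, x)" by (cases p)
  let ?B = "cbox (t - r, x - r) (t + r, x + r)"
  have sub: "ball p r \<subseteq> ?B"
  proof
    fix q assume q: "q \<in> ball p r"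
    obtain t' x' where q': "q = (t', x')" by (cases q)
    have "dist t t' \<le> dist p q" "dist x x' \<le> dist p q"
      using dist_fst_le[of p q] dist_snd_le[of p q] by (simp_all add: p q')
    then show "q \<in> ?B" using q by (auto simp: q' cbox_Pair_eq dist_real_def)
  qed
  have "measure lebesgue (ball p r) \<le> measure lebesgue ?B"
    by (rule measure_mono_fmeasurable[OF sub]) auto
  also have "\<dots> = (2 * r) * (2 * r)"
    using assms by (simp add: content_Pair)
  finally show ?thesis by (simp add: power2_eq_square)
qed

lemma square_difference_bound:
  fixes v1 v2 a b e :: real
  assumes "v1 \<le> v2" "v2 < b + e" "a - e < v1" "0 \<le> a" "a \<le> b" "0 < e" "e \<le> 1"
  shows "(v2\<^sup>2 - v1\<^sup>2) / 2 \<le> (b\<^sup>2 - a\<^sup>2) / 2 + (a + b + 1) * e"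
proof -
  have "v2\<^sup>2 \<le> (b + e)\<^sup>2" using assms by (simp add: abs_le_square_iff[symmetric])
  moreover have "a\<^sup>2 - 2 * a * e \<le> v1\<^sup>2"
  proof (cases "e \<le> a")
    case True
    then have "(a - e)\<^sup>2 \<le> v1\<^sup>2" using assms by (intro power_mono) auto
    moreover have "a\<^sup>2 - 2 * a * e \<le> (a - e)\<^sup>2" by (simp add: power2_diff)
    ultimately show ?thesis by linarith
  next
    case False
    have "a * a \<le> a * (2 * e)" using False assms by (intro mult_left_mono) auto
    then have "a\<^sup>2 - 2 * a * e \<le> 0" by (simp add: power2_eq_square)
    also have "0 \<le> v1\<^sup>2" by simp
    finally show ?thesis .
  qed
  moreover have "(b + e)\<^sup>2 = b\<^sup>2 + 2 * b * e + e * e" by (simp add: power2_eq_square algebra_simps)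
  moreover have "e * e \<le> e * 1" using assms by (intro mult_left_mono) auto
  ultimately have "v2\<^sup>2 - v1\<^sup>2 \<le> b\<^sup>2 - a\<^sup>2 + 2 * b * e + 2 * a * e + e" by linarith
  then have "(v2\<^sup>2 - v1\<^sup>2) / 2 \<le> (b\<^sup>2 - a\<^sup>2 + 2 * b * e + 2 * a * e + e) / 2"
    by (rule divide_right_mono) simp
  also have "\<dots> = (b\<^sup>2 - a\<^sup>2) / 2 + (a + b + 1) * e - e / 2" by (simp add: field_simps)
  finally show ?thesis using assms(6) by linarith
qed

text \<open>
  This is \<open>\<lambda>\<^sub>2\<close> for \<open>s = 1\<close> and \<open>- \<lambda>\<^sub>1\<close> for \<open>s = -1\<close>, so that upper semicontinuity is the claim in both
  cases.
\<close>

definition outer_invariant :: "real \<Rightarrow> (real \<times> real \<Rightarrow> real) \<Rightarrow> (real \<times> real \<Rightarrow> real) \<Rightarrow> real \<times> real \<Rightarrow> real" where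
  "outer_invariant s \<rho> m p = s * (m p / \<rho> p) + \<rho> p / 2"

lemma outer_invariant_measurable:
  assumes "bounded_entropy_solution \<rho> m"
  shows "outer_invariant s \<rho> m \<in> borel_measurable (lebesgue_on half_plane)"
proof -
  have [measurable]: "\<rho> \<in> borel_measurable (lebesgue_on half_plane)" "m \<in> borel_measurable (lebesgue_on half_plane)"
    using assms unfolding bounded_entropy_solution_def by auto
  show ?thesis unfolding outer_invariant_def by measurable
qed

lemma lower_env_pos:
  assumes \<rho>: "\<rho> \<in> borel_measurable (lebesgue_on half_plane)" "AE p in lebesgue. p \<in> half_plane \<longrightarrow> 0 \<le> \<rho> p"
    and nz: "lower_env \<rho> p \<noteq> 0"
  obtains c r where "0 < c" "0 < r" "AE z in lebesgue. z \<in> ball p r \<and> z \<in> half_plane \<longrightarrow> c < \<rho> z"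
proof -
  have m: "(\<lambda>z. - \<rho> z) \<in> borel_measurable (lebesgue_on half_plane)" using \<rho>(1) by simp
  have "AE z in lebesgue. z \<in> ball p 1 \<and> z \<in> half_plane \<longrightarrow> ereal (- \<rho> z) \<le> 0"
    using \<rho>(2) by (rule eventually_mono) (auto simp: zero_ereal_def)
  then have "upper_env (\<lambda>z. - \<rho> z) p \<le> 0" by (rule upper_env_le[OF m zero_less_one])
  moreover have "upper_env (\<lambda>z. - \<rho> z) p \<noteq> 0" using nz by (simp add: lower_env_eq[OF \<rho>(1)])
  ultimately have "upper_env (\<lambda>z. - \<rho> z) p < 0" by simp
  then obtain c' where c': "upper_env (\<lambda>z. - \<rho> z) p < ereal c'" "c' < 0"
    using ereal_dense2[of "upper_env (\<lambda>z. - \<rho> z) p" 0] by (auto simp: zero_ereal_def)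
  obtain r where "0 < r" "AE z in lebesgue. z \<in> ball p r \<and> z \<in> half_plane \<longrightarrow> ereal (- \<rho> z) < ereal c'"
    by (rule upper_env_lessE[OF m c'(1)])
  then have "AE z in lebesgue. z \<in> ball p r \<and> z \<in> half_plane \<longrightarrow> - c' < \<rho> z"
    by (auto elim!: eventually_mono)
  with \<open>0 < r\<close> c'(2) show ?thesis by (intro that[of "- c'" r]) auto
qed

text \<open>
  The De Giorgi lemma on a small ball around \<open>p\<close>, for a Borel function that agrees with the invariant
  almost everywhere near \<open>p\<close>.
\<close>

lemma small_density_imp_bound:
  fixes \<rho> m :: "real \<times> real \<Rightarrow> real"
  assumes sol: "bounded_entropy_solution \<rho> m" and s: "s = 1 \<or> s = -1"
    and r0: "0 < r0" "ball p r0 \<subseteq> half_plane"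
    and C: "AE z in lebesgue. z \<in> half_plane \<longrightarrow> outer_invariant s \<rho> m z \<le> C" and kC: "k \<le> C"
    and ae: "AE z in lebesgue. z \<in> ball p r0 \<longrightarrow> 0 < \<rho> z \<and> s * (m z / \<rho> z) - \<rho> z / 2 \<le> k"
    and dens: "\<And>e. 0 < e \<Longrightarrow> \<exists>\<delta>>0. \<forall>r. 0 < r \<and> r < \<delta> \<longrightarrow>
       measure lebesgue ({z \<in> half_plane. k < outer_invariant s \<rho> m z} \<inter> ball p r) \<le> e * measure lebesgue (ball p r)"
    and d: "0 < d"
  obtains r where "0 < r" "AE z in lebesgue. z \<in> ball p r \<longrightarrow> outer_invariant s \<rho> m z \<le> k + d"
proof -
  let ?w = "outer_invariant s \<rho> m"
  obtain w' where w': "w' \<in> borel_measurable borel" "AE z in lebesgue. z \<in> half_plane \<longrightarrow> ?w z = w' z"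
    by (rule borel_representative[OF outer_invariant_measurable[OF sol]])
  define \<Omega> where "\<Omega> = ball p r0"
  \<comment> \<open>A Borel function, bounded above, that has no energy above the level \<open>k\<close> outside \<open>\<Omega>\<close>.\<close>
  define W where "W z = (if z \<in> \<Omega> then min C (w' z) else k)" for z
  have Wm: "W \<in> borel_measurable borel"
    unfolding W_def \<Omega>_def by (intro measurable_If_set borel_measurable_min w'(1) borel_measurable_const) simp_all
  have Wle: "W z \<le> C" for z using kC by (simp add: W_def)
  have Wout: "z \<notin> \<Omega> \<Longrightarrow> W z \<le> k" for z by (simp add: W_def)
  have Weq: "AE z in lebesgue. z \<in> \<Omega> \<longrightarrow> W z = ?w z"
    using w'(2) C by eventually_elim (use r0(2) in \<open>auto simp: W_def \<Omega>_def\<close>)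
  have ae': "AE z in lebesgue. z \<in> \<Omega> \<longrightarrow> 0 < \<rho> z \<and> W z = s * (m z / \<rho> z) + \<rho> z / 2 \<and> s * (m z / \<rho> z) - \<rho> z / 2 \<le> k"
    using ae Weq by eventually_elim (auto simp: \<Omega>_def outer_invariant_def)
  have \<Omega>: "open \<Omega>" "\<Omega> \<subseteq> half_plane" "bounded \<Omega>" using r0 by (auto simp: \<Omega>_def)
  define \<Lambda> where "\<Lambda> = \<bar>k\<bar> + \<bar>d\<bar> + (C - k)"
  have \<Lambda>: "0 \<le> \<Lambda>" using kC by (simp add: \<Lambda>_def)
  have diss: "dissipative_pair \<Omega> \<Lambda> ((C - k)\<^sup>2) (level_energy W h) (level_flux s W h)"
    if "k \<le> h" "h \<le> k + d" for h
    unfolding \<Lambda>_def by (rule local_dissipative_pair[OF sol s \<Omega> Wm Wle Wout ae' that kC])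
  obtain t0 x0 where p: "p = (t0, x0)" by (cases p)
  have "\<exists>\<delta>>0. \<forall>t0 x0 r. 0 < r \<longrightarrow>
      cbox (t0 - 3 * r, x0 - (3 + 4 * \<Lambda>) * r) (t0 + 3 * r, x0 + (3 + 4 * \<Lambda>) * r) \<subseteq> \<Omega> \<longrightarrow>
      measure lborel ({p. k < W p} \<inter> cbox (t0 - 3 * r, x0 - (3 + 4 * \<Lambda>) * r) (t0 + 3 * r, x0 + (3 + 4 * \<Lambda>) * r)) \<le> \<delta> * r\<^sup>2 \<longrightarrow>
      (AE p in lborel. p \<in> ball (t0, x0) r \<longrightarrow> W p \<le> k + d)"
    by (rule de_giorgi[OF s d \<Lambda> \<Omega>(3) diss Wm])
  then obtain \<delta> where \<delta>: "0 < \<delta>" "\<forall>t0 x0 r. 0 < r \<longrightarrow>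
      cbox (t0 - 3 * r, x0 - (3 + 4 * \<Lambda>) * r) (t0 + 3 * r, x0 + (3 + 4 * \<Lambda>) * r) \<subseteq> \<Omega> \<longrightarrow>
      measure lborel ({p. k < W p} \<inter> cbox (t0 - 3 * r, x0 - (3 + 4 * \<Lambda>) * r) (t0 + 3 * r, x0 + (3 + 4 * \<Lambda>) * r)) \<le> \<delta> * r\<^sup>2 \<longrightarrow>
      (AE p in lborel. p \<in> ball (t0, x0) r \<longrightarrow> W p \<le> k + d)"
    by blast
  \<comment> \<open>The ball of radius \<open>N * r\<close> contains the box of \<open>de_giorgi\<close>.\<close>
  define N where "N = 7 + 4 * \<Lambda>"
  have N: "0 < N" using \<Lambda> by (simp add: N_def)
  define e where "e = \<delta> / (4 * N\<^sup>2)"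
  have e: "0 < e" using \<delta>(1) N by (simp add: e_def)
  obtain \<delta>' where \<delta>': "0 < \<delta>'" "\<And>r. 0 < r \<Longrightarrow> r < \<delta>' \<Longrightarrow>
     measure lebesgue ({z \<in> half_plane. k < ?w z} \<inter> ball p r) \<le> e * measure lebesgue (ball p r)"
    using dens[OF e] by blast
  define r where "r = min \<delta>' r0 / (2 * N)"
  have r: "0 < r" using \<delta>'(1) r0(1) N by (simp add: r_def)
  have "N * r = min \<delta>' r0 / 2" using N by (simp add: r_def)
  then have Nr: "0 < N * r" "N * r < \<delta>'" "N * r < r0"
    using \<delta>'(1) r0(1) by (simp_all add: min_def split: if_splits)
  let ?K = "cbox (t0 - 3 * r, x0 - (3 + 4 * \<Lambda>) * r) (t0 + 3 * r, x0 + (3 + 4 * \<Lambda>) * r)"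
  have KN: "?K \<subseteq> ball p (N * r)"
  proof
    fix z assume z: "z \<in> ?K"
    obtain t x where tx: "z = (t, x)" by (cases z)
    have a: "\<bar>t0 - t\<bar> \<le> 3 * r" "\<bar>x0 - x\<bar> \<le> (3 + 4 * \<Lambda>) * r"
      using z by (auto simp: tx cbox_Pair_eq abs_le_iff)
    have "dist p z \<le> \<bar>t0 - t\<bar> + \<bar>x0 - x\<bar>"
      unfolding p tx dist_Pair_Pair dist_real_def by (rule sqrt_sum_squares_le_sum_abs[THEN order_trans]) simp
    also have "\<dots> \<le> 3 * r + (3 + 4 * \<Lambda>) * r" using a by linarith
    also have "\<dots> < N * r" using r by (simp add: N_def algebra_simps)
    finally show "z \<in> ball p (N * r)" by simp
  qed
  have K\<Omega>: "?K \<subseteq> \<Omega>" using KN subset_ball[of "N * r" r0 p] Nr(3) by (auto simp: \<Omega>_def)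
  have "measure lborel ({z. k < W z} \<inter> ?K) \<le> \<delta> * r\<^sup>2"
  proof -
    have mS: "{z. k < W z} \<inter> ?K \<in> sets borel"
    proof -
      have "{z. k < W z} \<in> sets borel" using borel_measurable_less[OF borel_measurable_const Wm] by simp
      then show ?thesis by simp
    qed
    have wm: "(\<lambda>z. if z \<in> half_plane then ?w z else k) \<in> borel_measurable lebesgue"
    proof -
      have "(\<lambda>z. if z \<in> half_plane then ?w z - k else 0) \<in> borel_measurable lebesgue"
        using outer_invariant_measurable[OF sol] by (intro borel_measurable_if_I half_plane_lebesgue) simp
      then have "(\<lambda>z. (if z \<in> half_plane then ?w z - k else 0) + k) \<in> borel_measurable lebesgue" by simp
      moreover have "(\<lambda>z. (if z \<in> half_plane then ?w z - k else 0) + k) = (\<lambda>z. if z \<in> half_plane then ?w z else k)" by auto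
      ultimately show ?thesis by simp
    qed
    have "{z. k < (if z \<in> half_plane then ?w z else k)} \<in> sets lebesgue"
      using borel_measurable_less[OF borel_measurable_const wm] by simp
    also have "{z. k < (if z \<in> half_plane then ?w z else k)} = {z \<in> half_plane. k < ?w z}" by auto
    finally have A: "{z \<in> half_plane. k < ?w z} \<inter> ball p (N * r) \<in> sets lebesgue" by auto
    have "measure lborel ({z. k < W z} \<inter> ?K) = measure lebesgue ({z. k < W z} \<inter> ?K)"
      using mS by (simp add: measure_completion)
    also have "\<dots> \<le> measure lebesgue ({z \<in> half_plane. k < ?w z} \<inter> ball p (N * r))"
    proof -
      have "emeasure lebesgue ({z. k < W z} \<inter> ?K) \<le> emeasure lebesgue ({z \<in> half_plane. k < ?w z} \<inter> ball p (N * r))"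
      proof (rule emeasure_mono_AE[OF _ A])
        show "AE z in lebesgue. z \<in> {z. k < W z} \<inter> ?K \<longrightarrow> z \<in> {z \<in> half_plane. k < ?w z} \<inter> ball p (N * r)"
          using Weq by (rule eventually_mono) (use KN K\<Omega> \<Omega>(2) in auto)
      qed
      moreover have "emeasure lebesgue ({z \<in> half_plane. k < ?w z} \<inter> ball p (N * r)) < \<infinity>"
      proof -
        have "emeasure lebesgue ({z \<in> half_plane. k < ?w z} \<inter> ball p (N * r)) \<le> emeasure lebesgue (ball p (N * r))"
          by (rule emeasure_mono) auto
        also have "\<dots> < \<infinity>" using fmeasurableD2[OF lmeasurable_ball] by (simp add: less_top)
        finally show ?thesis .
      qed
      ultimately show ?thesis unfolding measure_def by (intro enn2real_mono) auto
    qed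
    also have "\<dots> \<le> e * measure lebesgue (ball p (N * r))" by (rule \<delta>'(2)[OF Nr(1,2)])
    also have "\<dots> \<le> e * (4 * (N * r)\<^sup>2)" using e Nr(1) by (intro mult_left_mono measure_ball_le) auto
    also have "\<dots> = \<delta> * r\<^sup>2" using N by (simp add: e_def power_mult_distrib)
    finally show ?thesis .
  qed
  from \<delta>(2)[rule_format, OF r K\<Omega> this] have "AE z in lebesgue. z \<in> ball p r \<longrightarrow> W z \<le> k + d"
    by (simp only: AE_completion_iff p)
  then have "AE z in lebesgue. z \<in> ball p r \<longrightarrow> ?w z \<le> k + d"
    using Weq
  proof eventually_elim
    case (elim z)
    have "r \<le> N * r" using r \<Lambda> by (simp add: N_def)
    then have "ball p r \<subseteq> \<Omega>" using Nr(3) by (auto simp: \<Omega>_def)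
    with elim show ?case by auto
  qed
  with r show ?thesis by (rule that)
qed

text \<open>
  If the envelope \<open>M\<close> at a density point were larger than the value, the De Giorgi lemma could be
  applied at a level \<open>k < M\<close> so close to \<open>M\<close> that the other invariant is below \<open>k\<close>, and would push the
  envelope below \<open>M\<close>.
\<close>

lemma outer_invariant_upper_semicontinuous:
  fixes \<rho> m :: "real \<times> real \<Rightarrow> real"
  assumes sol: "bounded_entropy_solution \<rho> m" and s: "s = 1 \<or> s = -1"
  shows "AE p in lebesgue. p \<in> half_plane \<longrightarrow> lower_env \<rho> p \<noteq> 0 \<longrightarrow>
    upper_env (outer_invariant s \<rho> m) p = ereal (outer_invariant s \<rho> m p)"
proof -
  let ?w = "outer_invariant s \<rho> m"
  have wm: "?w \<in> borel_measurable (lebesgue_on half_plane)" by (rule outer_invariant_measurable[OF sol])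
  have \<rho>m: "\<rho> \<in> borel_measurable (lebesgue_on half_plane)" using sol unfolding bounded_entropy_solution_def by blast
  have \<rho>0: "AE p in lebesgue. p \<in> half_plane \<longrightarrow> 0 \<le> \<rho> p"
    using sol unfolding bounded_entropy_solution_def AE_half_plane by (auto elim!: eventually_mono)
  obtain C0 where C0: "AE p in lebesgue. p \<in> half_plane \<longrightarrow> \<bar>\<rho> p\<bar> \<le> C0 \<and> \<bar>m p / \<rho> p\<bar> \<le> C0"
    using sol unfolding bounded_entropy_solution_def AE_half_plane by blast
  have C: "AE z in lebesgue. z \<in> half_plane \<longrightarrow> ?w z \<le> 2 * C0"
    using C0
  proof (rule eventually_mono, intro impI)
    fix z assume "z \<in> half_plane \<longrightarrow> \<bar>\<rho> z\<bar> \<le> C0 \<and> \<bar>m z / \<rho> z\<bar> \<le> C0" "z \<in> half_plane"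
    then have "\<bar>\<rho> z\<bar> \<le> C0" "\<bar>m z / \<rho> z\<bar> \<le> C0" by auto
    moreover have "s * (m z / \<rho> z) \<le> \<bar>m z / \<rho> z\<bar>"
      using s abs_ge_self[of "m z / \<rho> z"] abs_ge_minus_self[of "m z / \<rho> z"] by (auto simp del: abs_divide)
    ultimately show "?w z \<le> 2 * C0" unfolding outer_invariant_def by linarith
  qed
  have ue: "upper_env ?w p \<le> ereal (2 * C0)" for p
    by (rule upper_env_le[OF wm zero_less_one]) (use C in \<open>auto elim!: eventually_mono\<close>)
  have "AE p in lebesgue. \<forall>k::rat. p \<notin> {z \<in> half_plane. real_of_rat k < ?w z} \<longrightarrow>
     (\<forall>e>0. \<exists>\<delta>>0. \<forall>r. 0 < r \<and> r < \<delta> \<longrightarrow>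
       measure lebesgue ({z \<in> half_plane. real_of_rat k < ?w z} \<inter> ball p r) \<le> e * measure lebesgue (ball p r))"
    unfolding AE_all_countable
  proof
    fix k :: rat
    have mq: "(\<lambda>z. if z \<in> half_plane then ?w z - real_of_rat k else 0) \<in> borel_measurable lebesgue"
      using wm by (intro borel_measurable_if_I half_plane_lebesgue) simp
    have "{z. 0 < (if z \<in> half_plane then ?w z - real_of_rat k else 0)} \<in> sets lebesgue"
      using borel_measurable_less[OF borel_measurable_const[of 0] mq] by simp
    also have "{z. 0 < (if z \<in> half_plane then ?w z - real_of_rat k else 0)} = {z \<in> half_plane. real_of_rat k < ?w z}" by auto
    finally show "AE p in lebesgue. p \<notin> {z \<in> half_plane. real_of_rat k < ?w z} \<longrightarrow>
     (\<forall>e>0. \<exists>\<delta>>0. \<forall>r. 0 < r \<and> r < \<delta> \<longrightarrow>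
       measure lebesgue ({z \<in> half_plane. real_of_rat k < ?w z} \<inter> ball p r) \<le> e * measure lebesgue (ball p r))"
      by (rule lebesgue_density)
  qed
  then show ?thesis
    using le_upper_env[OF wm]
  proof (eventually_elim, intro impI)
    fix p
    assume dens: "\<forall>k::rat. p \<notin> {z \<in> half_plane. real_of_rat k < ?w z} \<longrightarrow>
       (\<forall>e>0. \<exists>\<delta>>0. \<forall>r. 0 < r \<and> r < \<delta> \<longrightarrow>
         measure lebesgue ({z \<in> half_plane. real_of_rat k < ?w z} \<inter> ball p r) \<le> e * measure lebesgue (ball p r))"
      and le: "p \<in> half_plane \<longrightarrow> ereal (?w p) \<le> upper_env ?w p" and p: "p \<in> half_plane" and nz: "lower_env \<rho> p \<noteq> 0"
    show "upper_env ?w p = ereal (?w p)"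
    proof (rule ccontr)
      assume "upper_env ?w p \<noteq> ereal (?w p)"
      then have lt: "ereal (?w p) < upper_env ?w p" using le p by auto
      obtain M where M: "upper_env ?w p = ereal M"
        using lt ue[of p] by (cases "upper_env ?w p") auto
      have wM: "?w p < M" using lt M by simp
      obtain c r1 where c: "0 < c" "0 < r1" "AE z in lebesgue. z \<in> ball p r1 \<and> z \<in> half_plane \<longrightarrow> c < \<rho> z"
        by (rule lower_env_pos[OF \<rho>m \<rho>0 nz])
      have "upper_env ?w p < ereal (M + c / 4)" using c(1) M by simp
      then obtain r2 where r2: "0 < r2" "AE z in lebesgue. z \<in> ball p r2 \<and> z \<in> half_plane \<longrightarrow> ereal (?w z) < ereal (M + c / 4)"
        by (rule upper_env_lessE[OF wm])
      obtain r3 where r3: "0 < r3" "ball p r3 \<subseteq> half_plane" using open_half_plane p openE by blast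
      define r0 where "r0 = min r1 (min r2 r3)"
      have r0: "0 < r0" "ball p r0 \<subseteq> half_plane" "ball p r0 \<subseteq> ball p r1" "ball p r0 \<subseteq> ball p r2"
        using c(2) r2(1) r3 by (auto simp: r0_def)
      have "max (?w p) (M - c / 4) < M" using wM c(1) by simp
      then obtain q where q: "max (?w p) (M - c / 4) < real_of_rat q" "real_of_rat q < M"
        using of_rat_dense by blast
      define k where "k = real_of_rat q"
      have k: "?w p < k" "M - c / 4 < k" "k < M" using q by (auto simp: k_def)
      have loc: "AE z in lebesgue. z \<in> ball p r0 \<longrightarrow> 0 < \<rho> z \<and> s * (m z / \<rho> z) - \<rho> z / 2 \<le> k"
        using c(3) r2(2)
      proof (eventually_elim, intro impI)
        fix z assume "z \<in> ball p r1 \<and> z \<in> half_plane \<longrightarrow> c < \<rho> z"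
          "z \<in> ball p r2 \<and> z \<in> half_plane \<longrightarrow> ereal (?w z) < ereal (M + c / 4)" "z \<in> ball p r0"
        then have "c < \<rho> z" "?w z < M + c / 4" using r0 by auto
        then show "0 < \<rho> z \<and> s * (m z / \<rho> z) - \<rho> z / 2 \<le> k"
          using c(1) k unfolding outer_invariant_def by auto
      qed
      have kC: "k \<le> 2 * C0" using k(3) ue[of p] M by simp
      have den: "\<exists>\<delta>>0. \<forall>r. 0 < r \<and> r < \<delta> \<longrightarrow>
         measure lebesgue ({z \<in> half_plane. k < ?w z} \<inter> ball p r) \<le> e * measure lebesgue (ball p r)" if "0 < e" for e
      proof -
        have "p \<notin> {z \<in> half_plane. real_of_rat q < ?w z}" using k(1) by (simp add: k_def)
        then show ?thesis using dens that unfolding k_def by blast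
      qed
      have dd: "0 < (M - k) / 2" using k by simp
      obtain r where r: "0 < r" "AE z in lebesgue. z \<in> ball p r \<longrightarrow> ?w z \<le> k + (M - k) / 2"
        by (rule small_density_imp_bound[OF sol s r0(1,2) C kC loc den dd])
      have "upper_env ?w p \<le> ereal (k + (M - k) / 2)"
        by (rule upper_env_le[OF wm r(1)]) (use r(2) in \<open>auto elim!: eventually_mono\<close>)
      then show False using M k(3) by (simp add: field_simps)
    qed
  qed
qed

lemma le_ereal_of_linear_bound:
  assumes "0 \<le> c" "\<And>e. 0 < e \<Longrightarrow> e \<le> 1 \<Longrightarrow> x \<le> ereal (y + c * e)"
  shows "x \<le> ereal y"
proof (rule ereal_le_epsilon2)
  fix \<epsilon> :: real assume \<epsilon>: "0 < \<epsilon>"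
  define e where "e = min 1 (\<epsilon> / (c + 1))"
  have e: "0 < e" "e \<le> 1" using \<epsilon> assms(1) by (auto simp: e_def)
  have "c * e \<le> c * (\<epsilon> / (c + 1))" using assms(1) by (intro mult_left_mono) (auto simp: e_def)
  also have "\<dots> \<le> \<epsilon>" using assms(1) \<epsilon> by (simp add: field_simps)
  finally have "ereal (y + c * e) \<le> ereal y + ereal \<epsilon>" by simp
  with assms(2)[OF e] show "x \<le> ereal y + ereal \<epsilon>" by (rule order_trans)
qed

lemma near_bounds:
  assumes m: "v1 \<in> borel_measurable (lebesgue_on half_plane)" "v2 \<in> borel_measurable (lebesgue_on half_plane)"
    and u: "upper_env v2 p \<le> ereal (v2 p)" "upper_env (\<lambda>z. - v1 z) p \<le> ereal (- v1 p)" and e: "0 < e"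
  obtains r where "0 < r" "AE z in lebesgue. z \<in> ball p r \<and> z \<in> half_plane \<longrightarrow> v2 z < v2 p + e \<and> v1 p - e < v1 z"
proof -
  have m1: "(\<lambda>z. - v1 z) \<in> borel_measurable (lebesgue_on half_plane)" using m(1) by simp
  have "upper_env v2 p < ereal (v2 p + e)" using u(1) e by (auto intro: le_less_trans)
  then obtain r2 where r2: "0 < r2" "AE z in lebesgue. z \<in> ball p r2 \<and> z \<in> half_plane \<longrightarrow> ereal (v2 z) < ereal (v2 p + e)"
    by (rule upper_env_lessE[OF m(2)])
  have "upper_env (\<lambda>z. - v1 z) p < ereal (- v1 p + e)" using u(2) e by (auto intro: le_less_trans)
  then obtain r1 where r1: "0 < r1" "AE z in lebesgue. z \<in> ball p r1 \<and> z \<in> half_plane \<longrightarrow> ereal (- v1 z) < ereal (- v1 p + e)"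
    by (rule upper_env_lessE[OF m1])
  have "AE z in lebesgue. z \<in> ball p (min r1 r2) \<and> z \<in> half_plane \<longrightarrow> v2 z < v2 p + e \<and> v1 p - e < v1 z"
    using r1(2) r2(2) by eventually_elim auto
  then show ?thesis using r1(1) r2(1) by (intro that[of "min r1 r2"]) auto
qed

lemma upper_env_difference:
  assumes m: "v1 \<in> borel_measurable (lebesgue_on half_plane)" "v2 \<in> borel_measurable (lebesgue_on half_plane)"
    and u: "upper_env v2 p \<le> ereal (v2 p)" "upper_env (\<lambda>z. - v1 z) p \<le> ereal (- v1 p)"
    and g: "g \<in> borel_measurable (lebesgue_on half_plane)" "\<And>z. g z = v2 z - v1 z"
  shows "upper_env g p \<le> ereal (g p)"
proof (rule le_ereal_of_linear_bound[of 2])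
  fix e :: real assume e: "0 < e"
  obtain r where r: "0 < r" "AE z in lebesgue. z \<in> ball p r \<and> z \<in> half_plane \<longrightarrow> v2 z < v2 p + e \<and> v1 p - e < v1 z"
    by (rule near_bounds[OF m u e])
  show "upper_env g p \<le> ereal (g p + 2 * e)"
    by (rule upper_env_le[OF g(1) r(1)]) (use r(2) in \<open>auto elim!: eventually_mono simp: g(2)\<close>)
qed simp

text \<open>
  The expression \<open>v2\<^sup>2 - v1\<^sup>2\<close> is increasing in \<open>v2\<close> and decreasing in \<open>v1\<close> only for nonnegative
  arguments. Near \<open>p\<close> both arguments are nonnegative up to an arbitrarily small error, because
  \<open>0 \<le> v1 p\<close>.
\<close>

lemma upper_env_square_difference:
  assumes m: "v1 \<in> borel_measurable (lebesgue_on half_plane)" "v2 \<in> borel_measurable (lebesgue_on half_plane)"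
    and u: "upper_env v2 p \<le> ereal (v2 p)" "upper_env (\<lambda>z. - v1 z) p \<le> ereal (- v1 p)"
    and v: "AE z in lebesgue. z \<in> half_plane \<longrightarrow> v1 z \<le> v2 z" "v1 p \<le> v2 p" "0 \<le> v1 p"
    and g: "g \<in> borel_measurable (lebesgue_on half_plane)"
      "AE z in lebesgue. z \<in> half_plane \<longrightarrow> g z = ((v2 z)\<^sup>2 - (v1 z)\<^sup>2) / 2" "g p = ((v2 p)\<^sup>2 - (v1 p)\<^sup>2) / 2"
  shows "upper_env g p \<le> ereal (g p)"
proof (rule le_ereal_of_linear_bound[of "v1 p + v2 p + 1"])
  show "0 \<le> v1 p + v2 p + 1" using v by simp
  fix e :: real assume e: "0 < e" "e \<le> 1"
  obtain r where r: "0 < r" "AE z in lebesgue. z \<in> ball p r \<and> z \<in> half_plane \<longrightarrow> v2 z < v2 p + e \<and> v1 p - e < v1 z"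
    by (rule near_bounds[OF m u e(1)])
  have "AE z in lebesgue. z \<in> ball p r \<and> z \<in> half_plane \<longrightarrow> ereal (g z) \<le> ereal (g p + (v1 p + v2 p + 1) * e)"
    using r(2) v(1) g(2)
  proof (eventually_elim, intro impI)
    fix z assume *: "z \<in> ball p r \<and> z \<in> half_plane \<longrightarrow> v2 z < v2 p + e \<and> v1 p - e < v1 z"
      "z \<in> half_plane \<longrightarrow> v1 z \<le> v2 z" "z \<in> half_plane \<longrightarrow> g z = ((v2 z)\<^sup>2 - (v1 z)\<^sup>2) / 2" "z \<in> ball p r \<and> z \<in> half_plane"
    have gz: "g z = ((v2 z)\<^sup>2 - (v1 z)\<^sup>2) / 2" using * by blast
    show "ereal (g z) \<le> ereal (g p + (v1 p + v2 p + 1) * e)"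
      unfolding gz g(3) ereal_less_eq by (rule square_difference_bound) (use * v(2,3) e in auto)
  qed
  then show "upper_env g p \<le> ereal (g p + (v1 p + v2 p + 1) * e)" by (rule upper_env_le[OF g(1) r(1)])
qed

theorem theorem1p3:
  fixes \<rho> m :: "real \<times> real \<Rightarrow> real"
  assumes "bounded_entropy_solution \<rho> m"
  shows "(AE p in lebesgue_on half_plane. lower_env \<rho> p \<noteq> 0 \<longrightarrow>
            ereal (\<rho> p) = upper_env \<rho> p \<and>
            ereal (riemann1 \<rho> m p) = lower_env (riemann1 \<rho> m) p \<and>
            ereal (riemann2 \<rho> m p) = upper_env (riemann2 \<rho> m) p) \<and>
         (AE p in lebesgue_on half_plane.
            lower_env \<rho> p \<noteq> 0 \<and> 0 \<le> lower_env (riemann1 \<rho> m) p \<longrightarrow>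
            ereal (m p) = upper_env m p) \<and>
         (AE p in lebesgue_on half_plane.
            lower_env \<rho> p \<noteq> 0 \<and> upper_env (riemann2 \<rho> m) p \<le> 0 \<longrightarrow>
            ereal (m p) = lower_env m p)"
proof -
  let ?l1 = "riemann1 \<rho> m" and ?l2 = "riemann2 \<rho> m"
  have \<rho>m: "\<rho> \<in> borel_measurable (lebesgue_on half_plane)" and mm: "m \<in> borel_measurable (lebesgue_on half_plane)"
    using assms unfolding bounded_entropy_solution_def by blast+
  have vac: "AE p in lebesgue. p \<in> half_plane \<longrightarrow> 0 \<le> \<rho> p \<and> (\<rho> p = 0 \<longrightarrow> m p = 0)"
    using assms unfolding bounded_entropy_solution_def AE_half_plane by blast
  have o2: "outer_invariant 1 \<rho> m = ?l2" and o1: "outer_invariant (-1) \<rho> m = (\<lambda>z. - ?l1 z)"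
    by (auto simp: fun_eq_iff outer_invariant_def riemann1_def riemann2_def)
  have m2: "?l2 \<in> borel_measurable (lebesgue_on half_plane)"
    using outer_invariant_measurable[OF assms, of 1] by (simp add: o2)
  have m1': "(\<lambda>z. - ?l1 z) \<in> borel_measurable (lebesgue_on half_plane)"
    using outer_invariant_measurable[OF assms, of "-1"] by (simp add: o1)
  then have m1: "?l1 \<in> borel_measurable (lebesgue_on half_plane)"
    using borel_measurable_uminus[OF m1'] by simp
  have m2': "(\<lambda>z. - ?l2 z) \<in> borel_measurable (lebesgue_on half_plane)" using m2 by simp
  have mm': "(\<lambda>z. - m z) \<in> borel_measurable (lebesgue_on half_plane)" using mm by simp
  have le1: "?l1 z \<le> ?l2 z" and msq: "m z = ((?l2 z)\<^sup>2 - (?l1 z)\<^sup>2) / 2" if "0 \<le> \<rho> z" "\<rho> z = 0 \<longrightarrow> m z = 0" for z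
    using that by (auto simp: riemann1_def riemann2_def power2_eq_square field_simps)
  have AEle: "AE z in lebesgue. z \<in> half_plane \<longrightarrow> ?l1 z \<le> ?l2 z"
    and AEm: "AE z in lebesgue. z \<in> half_plane \<longrightarrow> m z = ((?l2 z)\<^sup>2 - (?l1 z)\<^sup>2) / 2"
    using vac by (eventually_elim, use le1 in blast) (use vac msq in \<open>eventually_elim, blast\<close>)
  have A2: "AE p in lebesgue. p \<in> half_plane \<longrightarrow> lower_env \<rho> p \<noteq> 0 \<longrightarrow> upper_env ?l2 p = ereal (?l2 p)"
    using outer_invariant_upper_semicontinuous[OF assms, of 1] unfolding o2 by simp
  have A1: "AE p in lebesgue. p \<in> half_plane \<longrightarrow> lower_env \<rho> p \<noteq> 0 \<longrightarrow> upper_env (\<lambda>z. - ?l1 z) p = ereal (- ?l1 p)"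
    using outer_invariant_upper_semicontinuous[OF assms, of "-1"] unfolding o1 by simp
  have main: "AE p in lebesgue. p \<in> half_plane \<longrightarrow> lower_env \<rho> p \<noteq> 0 \<longrightarrow>
     (ereal (\<rho> p) = upper_env \<rho> p \<and> ereal (?l1 p) = lower_env ?l1 p \<and> ereal (?l2 p) = upper_env ?l2 p) \<and>
     (0 \<le> lower_env ?l1 p \<longrightarrow> ereal (m p) = upper_env m p) \<and>
     (upper_env ?l2 p \<le> 0 \<longrightarrow> ereal (m p) = lower_env m p)"
    using A2 A1
      le_upper_env[OF \<rho>m] le_upper_env[OF mm] le_upper_env[OF mm'] vac
  proof (eventually_elim, intro impI)
    fix p
    assume a2: "p \<in> half_plane \<longrightarrow> lower_env \<rho> p \<noteq> 0 \<longrightarrow> upper_env ?l2 p = ereal (?l2 p)"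
      and a1: "p \<in> half_plane \<longrightarrow> lower_env \<rho> p \<noteq> 0 \<longrightarrow> upper_env (\<lambda>z. - ?l1 z) p = ereal (- ?l1 p)"
      and b: "p \<in> half_plane \<longrightarrow> ereal (\<rho> p) \<le> upper_env \<rho> p" "p \<in> half_plane \<longrightarrow> ereal (m p) \<le> upper_env m p"
         "p \<in> half_plane \<longrightarrow> ereal (- m p) \<le> upper_env (\<lambda>z. - m z) p"
      and v: "p \<in> half_plane \<longrightarrow> 0 \<le> \<rho> p \<and> (\<rho> p = 0 \<longrightarrow> m p = 0)"
      and p: "p \<in> half_plane" "lower_env \<rho> p \<noteq> 0"
    have e2: "upper_env ?l2 p = ereal (?l2 p)" and e1: "upper_env (\<lambda>z. - ?l1 z) p = ereal (- ?l1 p)"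
      using a1 a2 p by auto
    have v': "0 \<le> \<rho> p" "\<rho> p = 0 \<longrightarrow> m p = 0" using v p by auto
    have low1: "lower_env ?l1 p = ereal (?l1 p)" by (simp add: lower_env_eq[OF m1] e1)
    have "upper_env \<rho> p \<le> ereal (\<rho> p)"
      by (rule upper_env_difference[OF m1 m2 eq_refl[OF e2] eq_refl[OF e1] \<rho>m]) (simp add: riemann1_def riemann2_def)
    then have R: "ereal (\<rho> p) = upper_env \<rho> p" using b(1) p(1) by auto
    have M1: "ereal (m p) = upper_env m p" if "0 \<le> lower_env ?l1 p"
    proof -
      have "0 \<le> ?l1 p" using that by (simp add: low1)
      then have "upper_env m p \<le> ereal (m p)"
        using upper_env_square_difference[OF m1 m2 _ _ AEle le1[OF v'] _ mm AEm msq[OF v']] e1 e2 by simp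
      then show ?thesis using b(2) p(1) by auto
    qed
    have M2: "ereal (m p) = lower_env m p" if "upper_env ?l2 p \<le> 0"
    proof -
      have "0 \<le> - ?l2 p" using that by (simp add: e2)
      moreover have "AE z in lebesgue. z \<in> half_plane \<longrightarrow> - ?l2 z \<le> - ?l1 z"
        using AEle by (rule eventually_mono) simp
      moreover have "AE z in lebesgue. z \<in> half_plane \<longrightarrow> - m z = ((- ?l1 z)\<^sup>2 - (- ?l2 z)\<^sup>2) / 2"
        using AEm by (rule eventually_mono) (simp add: field_simps)
      moreover have "- m p = ((- ?l1 p)\<^sup>2 - (- ?l2 p)\<^sup>2) / 2" using msq[OF v'] by (simp add: field_simps)
      moreover have "- ?l2 p \<le> - ?l1 p" using le1[OF v'] by simp
      ultimately have "upper_env (\<lambda>z. - m z) p \<le> ereal (- m p)"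
        using e1 e2 by (intro upper_env_square_difference[OF m2' m1' _ _ _ _ _ mm']) simp_all
      then have "upper_env (\<lambda>z. - m z) p = ereal (- m p)" using b(3) p(1) by auto
      then show ?thesis by (simp add: lower_env_eq[OF mm])
    qed
    show "(ereal (\<rho> p) = upper_env \<rho> p \<and> ereal (?l1 p) = lower_env ?l1 p \<and> ereal (?l2 p) = upper_env ?l2 p) \<and>
     (0 \<le> lower_env ?l1 p \<longrightarrow> ereal (m p) = upper_env m p) \<and>
     (upper_env ?l2 p \<le> 0 \<longrightarrow> ereal (m p) = lower_env m p)"
      using R low1 e2 M1 M2 by simp
  qed
  show ?thesis
    unfolding AE_half_plane
    by (intro conjI; rule eventually_mono[OF main]; blast)
qed

end
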